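(* Let $T>0$, $f\in C_b(X)$, $g\in C_b([0,T]\times X)$, and let $$v(t,x)=P_tf(x)+\int_0^tP_{t-s}g(s,\cdot)(x)\,ds,\qquad t\in[0,T],\ x\in X.$$ The following statements hold. (i) If $1/\theta\notin\mathbb{N}$ and $f\in C^{1/\theta}_H(X)$, $g\in C_b([0,T]\times X)$, then $v\in C^{0,1/\theta}_H([0,T]\times X)$, and there exists $C=C(T)>0$, independent of $f$ and $g$, such that $\|v\|_{C^{0,1/\theta}_H([0,T]\times X)}\le C(\|f\|_{C^{1/\theta}_H(X)}+\|g\|_\infty)$. (ii) If $\alpha\in(0,1)$ and $\alpha+1/\theta\notin\mathbb{N}$, $f\in C^{\alpha+1/\theta}_H(X)$ and $g\in C^{0,\alpha}_H([0,T]\times X)$, then $v\in C^{0,\alpha+1/\theta}_H([0,T]\times X)$, and there exists $C=C(T,\alpha)>0$, independent of $f$ and $g$, such that $\|v\|_{C^{0,\alpha+1/\theta}_H([0,T]\times X)}\le C(\|f\|_{C^{\alpha+1/\theta}_H(X)}+\|g\|_{C^{0,\alpha}_H([0,T]\times X)})$.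
   Context: Setting. $X$ is a real separable Banach space; for Banach spaces, $H\subset X$ means that $H$ is contained in $X$ with continuous embedding. $C_b$ denotes bounded continuous real functions with the sup norm $\|\cdot\|_\infty$. $(T_t)_{t\ge0}$ is a strongly continuous semigroup of bounded linear operators on $X$, and $(\mu_t)_{t\ge0}$ are Borel probability measures on $X$ with $\mu_0=\delta_0$, $t\mapsto\mu_t$ weakly continuous on $[0,\infty)$, and $\mu_{t+s}=(\mu_t\circ T_s^{-1})*\mu_s$ for $t,s>0$. The generalized Mehler semigroup is $P_tf(x)=\int_Xf(T_tx+y)\,\mu_t(dy)$, $t\ge0$, $f\in C_b(X)$. Fomin differentiability. A Borel probability measure $\mu$ on $X$ is Fomin differentiable along $v\in X$ if $\lim_{t\to0}(\mu(A+tv)-\mu(A))/t$ exists and is finite for every Borel set $A$. The limit is then a signed measure $d_v\mu$, absolutely continuous with respect to $\mu$, with density $\beta^\mu_v\in L^1(X,\mu)$. Equivalently, there is $\beta^\mu_v\in L^1(X,\mu)$ with $\int_X\frac{\partial f}{\partial v}\,d\mu=-\int_X\beta^\mu_vf\,d\mu$ for all $f\in C^1_b(X)$. Standing hypotheses. (1) For every $t>0$ there is a subspace $\{0\}\ne H_t\subset X$ such that $\mu_t$ is Fomin differentiable along every $h\in H_t$. (2) There exist a Banach space $H\subset X$ and constants $M,C,\theta>0$, $\omega\in\mathbb{R}$ such that for all $t>0$, $h\in H$: $T_t(H)\subset H$ and $\|T_th\|_H\le Me^{\omega t}\|h\|_H$; $T_t(H)\subset H_t$ and $\|\beta^{\mu_t}_{T_th}\|_{L^1(X,\mu_t)}\le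 Ce^{\omega t}t^{-\theta}\|h\|_H$. Function spaces. For a Banach space $Y$, $F:X\to Y$ is $H$-Gateaux differentiable at $x$ if $\partial F/\partial h(x)=\lim_{t\to0}(F(x+th)-F(x))/t$ exists for all $h\in H$ and $D_HF(x):h\mapsto\partial F/\partial h(x)$ belongs to $\mathcal{L}(H,Y)$. $\mathcal{L}^n(H)$ is the space of continuous $n$-linear maps $H^n\to\mathbb{R}$ with norm $\|T\|=\sup\{|T(h_1,\dots,h_n)|/(\|h_1\|_H\cdots\|h_n\|_H):h_i\in H\setminus\{0\}\}$, identified with $\mathcal{L}(H,\mathcal{L}^{n-1}(H))$; $D^n_Hf(x)\in\mathcal{L}^n(H)$ is the $H$-Gateaux derivative at $x$ of $D^{n-1}_Hf:X\to\mathcal{L}^{n-1}(H)$. $C^n_H(X)$ ($n\in\mathbb{N}=\{1,2,\dots\}$) is the set of $f\in C_b(X)$ having $H$-Gateaux derivatives up to order $n$ at every point such that $x\mapsto D^k_Hf(x)(h_1,\dots,h_k)$ is continuous and bounded for all $k\le n$ and $h_i\in H$, with norm $\|f\|_\infty+\sum_{k=1}^n\sup_x\|D^k_Hf(x)\|_{\mathcal{L}^k(H)}$. For $\sigma\in(0,1)$ and $F:X\to Y$, $[F]_{C^\sigma_H(X,Y)}=\sup_{x\in X,h\in H\setminus\{0\}}\|F(x+h)-F(x)\|_Y/\|h\|_H^\sigma$. $C^\sigma_H(X)=\{f\in C_b(X):[f]_{C^\sigma_H(X)}<\infty\}$ with norm $\|f\|_\infty+[f]_{C^\sigma_H(X)}$.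 For $n\in\mathbb{N}$, $C^{\sigma+n}_H(X)=\{f\in C^n_H(X):[D^n_Hf]_{C^\sigma_H(X,\mathcal{L}^n(H))}<\infty\}$ with norm $\|f\|_{C^n_H(X)}+[D^n_Hf]_{C^\sigma_H(X,\mathcal{L}^n(H))}$. For $\gamma>0$, $C^{0,\gamma}_H([0,T]\times X)$ is the space of bounded continuous $g:[0,T]\times X\to\mathbb{R}$ such that $g(t,\cdot)\in C^\gamma_H(X)$ for every $t\in[0,T]$, $\|g\|_{C^{0,\gamma}_H([0,T]\times X)}:=\sup_{t\in[0,T]}\|g(t,\cdot)\|_{C^\gamma_H(X)}<\infty$, and, if $\gamma\ge1$, for all $k\le[\gamma]$ and $h_1,\dots,h_k\in H$ the function $(t,x)\mapsto\frac{\partial^kg}{\partial h_1\cdots\partial h_k}(t,x)$ is continuous on $[0,T]\times X$. *)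

theory Defs
  imports "HOL-Probability.Probability"
begin

section \<open>Generalized Mehler semigroups\<close>

definition C0_semigroup :: "(real \<Rightarrow> 'x::banach \<Rightarrow>\<^sub>L 'x) \<Rightarrow> bool" where
  "C0_semigroup S \<longleftrightarrow>
     S 0 = id_blinfun \<and>
     (\<forall>t\<ge>0. \<forall>s\<ge>0. S (t + s) = S t o\<^sub>L S s) \<and>
     (\<forall>x. continuous_on {0..} (\<lambda>t. S t x))"

text \<open>The last conjunct is \<open>\<mu>\<^bsub>t+s\<^esub> = (\<mu>\<^sub>t \<circ> S\<^sub>s\<^sup>-\<^sup>1) * \<mu>\<^sub>s\<close>; the convolution is written out because
  the one of the library is restricted to Euclidean spaces.\<close>

definition mehler_measures ::
    "(real \<Rightarrow> 'x \<Rightarrow>\<^sub>L 'x) \<Rightarrow> (real \<Rightarrow> 'x::{banach, second_countable_topology} measure) \<Rightarrow> bool" where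
  "mehler_measures S \<mu> \<longleftrightarrow>
     (\<forall>t\<ge>0. prob_space (\<mu> t) \<and> sets (\<mu> t) = sets borel) \<and>
     \<mu> 0 = return borel 0 \<and>
     (\<forall>f\<in>bcontfun. continuous_on {0..} (\<lambda>t. LINT x|\<mu> t. (f x :: real))) \<and>
     (\<forall>t>0. \<forall>s>0.
        \<mu> (t + s) = distr (distr (\<mu> t) borel (S s) \<Otimes>\<^sub>M \<mu> s) borel (\<lambda>(x, y). x + y))"

definition mehler ::
    "(real \<Rightarrow> 'x \<Rightarrow>\<^sub>L 'x) \<Rightarrow> (real \<Rightarrow> 'x::{banach, second_countable_topology} measure) \<Rightarrow>
     real \<Rightarrow> ('x \<Rightarrow> real) \<Rightarrow> 'x \<Rightarrow> real" where
  "mehler S \<mu> t f x = (LINT y|\<mu> t. f (S t x + y))"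


section \<open>Fomin differentiability\<close>

definition fomin_differentiable :: "'x::banach measure \<Rightarrow> 'x \<Rightarrow> bool" where
  "fomin_differentiable \<mu> v \<longleftrightarrow>
     (\<forall>A\<in>sets borel. \<exists>l::real.
        ((\<lambda>t. (measure \<mu> ((\<lambda>a. a + t *\<^sub>R v) ` A) - measure \<mu> A) / t) \<longlongrightarrow> l) (at 0))"

text \<open>\<open>\<beta>\<close> is the density \<open>\<beta>\<^sup>\<mu>\<^sub>v\<close> with respect to \<open>\<mu>\<close> of the signed measure \<open>d\<^sub>v\<mu>\<close>; it is unique
  up to \<open>\<mu>\<close>-null sets.\<close>

definition fomin_density :: "'x::banach measure \<Rightarrow> 'x \<Rightarrow> ('x \<Rightarrow> real) \<Rightarrow> bool" where
  "fomin_density \<mu> v \<beta> \<longleftrightarrow>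
     integrable \<mu> \<beta> \<and>
     (\<forall>A\<in>sets borel.
        ((\<lambda>t. (measure \<mu> ((\<lambda>a. a + t *\<^sub>R v) ` A) - measure \<mu> A) / t) \<longlongrightarrow>
           (LINT x:A|\<mu>. \<beta> x)) (at 0))"


section \<open>Continuous multilinear forms\<close>

text \<open>An \<open>n\<close>-linear form on \<open>H\<close> is a function on lists over \<open>H\<close> that vanishes on lists of length
  \<open>\<noteq> n\<close>. The norm takes values in \<^typ>\<open>ennreal\<close>, so that an unbounded form has norm \<open>\<top>\<close> and the
  supremum is \<open>0\<close> if \<open>H = {0}\<close> and \<open>n \<ge> 1\<close>. As for \<^typ>\<open>'a \<Rightarrow>\<^sub>L 'b\<close>, continuity is expressed by
  finiteness of the norm. The space of \<open>0\<close>-linear forms is \<open>\<real>\<close>, with norm \<open>\<bar>T []\<bar>\<close>.\<close>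

definition mlin_norm :: "nat \<Rightarrow> ('h::real_normed_vector list \<Rightarrow> real) \<Rightarrow> ennreal" where
  "mlin_norm n T =
     (SUP hs\<in>{hs. length hs = n \<and> 0 \<notin> set hs}. ennreal (\<bar>T hs\<bar> / prod_list (map norm hs)))"

definition mlin_forms :: "nat \<Rightarrow> ('h::real_normed_vector list \<Rightarrow> real) set" where
  "mlin_forms n =
     {T. (\<forall>hs. length hs \<noteq> n \<longrightarrow> T hs = 0) \<and>
         (\<forall>hs i. length hs = n \<and> i < n \<longrightarrow> linear (\<lambda>h. T (hs[i := h]))) \<and>
         mlin_norm n T < \<top>}"


section \<open>Derivatives along \<open>H\<close>\<close>

text \<open>\<open>H\<close> is given as a Banach space with a continuous embedding \<open>\<iota>\<close> into \<open>X\<close>.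

  \<open>has_H_derivative \<iota> n F D x\<close>: the function \<open>F\<close> from \<open>X\<close> to the space of continuous \<open>n\<close>-linear
  forms is \<open>H\<close>-Gateaux differentiable at \<open>x\<close> with derivative \<open>D\<close>. The operator
  \<open>h \<mapsto> \<partial>F/\<partial>h(x)\<close> is identified with the \<open>(n+1)\<close>-linear form \<open>D\<close> via \<open>\<partial>F/\<partial>h(x)(hs) = D (h # hs)\<close>;
  the limit of the difference quotients is in the norm of \<open>n\<close>-linear forms.\<close>

definition has_H_derivative ::
    "('h::banach \<Rightarrow> 'x::banach) \<Rightarrow> nat \<Rightarrow> ('x \<Rightarrow> 'h list \<Rightarrow> real) \<Rightarrow> ('h list \<Rightarrow> real) \<Rightarrow> 'x \<Rightarrow> bool"
  where
  "has_H_derivative \<iota> n F D x \<longleftrightarrow>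
     D \<in> mlin_forms (Suc n) \<and>
     (\<forall>h. ((\<lambda>t. mlin_norm n (\<lambda>hs. (F (x + t *\<^sub>R \<iota> h) hs - F x hs) / t - D (h # hs))) \<longlongrightarrow> 0) (at 0))"

primrec H_deriv ::
    "('h::banach \<Rightarrow> 'x::banach) \<Rightarrow> nat \<Rightarrow> ('x \<Rightarrow> real) \<Rightarrow> 'x \<Rightarrow> 'h list \<Rightarrow> real" where
  "H_deriv \<iota> 0 f = (\<lambda>x hs. if hs = [] then f x else 0)"
| "H_deriv \<iota> (Suc n) f = (\<lambda>x. THE D. has_H_derivative \<iota> n (H_deriv \<iota> n f) D x)"


section \<open>Function spaces\<close>

definition H_Cn :: "('h::banach \<Rightarrow> 'x::banach) \<Rightarrow> nat \<Rightarrow> ('x \<Rightarrow> real) set" where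
  "H_Cn \<iota> n =
     {f \<in> bcontfun.
        (\<forall>k<n. \<forall>x. \<exists>D. has_H_derivative \<iota> k (H_deriv \<iota> k f) D x) \<and>
        (\<forall>k\<le>n. \<forall>hs. length hs = k \<longrightarrow> (\<lambda>x. H_deriv \<iota> k f x hs) \<in> bcontfun)}"

definition H_Cn_norm :: "('h::banach \<Rightarrow> 'x::banach) \<Rightarrow> nat \<Rightarrow> ('x \<Rightarrow> real) \<Rightarrow> ennreal" where
  "H_Cn_norm \<iota> n f =
     (SUP x. ennreal \<bar>f x\<bar>) + (\<Sum>k = 1..n. SUP x. mlin_norm k (H_deriv \<iota> k f x))"

definition H_Holder_seminorm ::
    "('h::banach \<Rightarrow> 'x::banach) \<Rightarrow> real \<Rightarrow> nat \<Rightarrow> ('x \<Rightarrow> 'h list \<Rightarrow> real) \<Rightarrow> ennreal" where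
  "H_Holder_seminorm \<iota> \<sigma> n F =
     (SUP x. SUP h\<in>-{0}. mlin_norm n (\<lambda>hs. F (x + \<iota> h) hs - F x hs) / ennreal (norm h powr \<sigma>))"

text \<open>For \<open>\<gamma> > 0\<close>, with \<open>n = \<lfloor>\<gamma>\<rfloor>\<close> and \<open>\<sigma> = \<gamma> - n\<close>, the space is \<open>C\<^sup>n\<^sub>H(X)\<close> if \<open>\<sigma> = 0\<close> and
  \<open>C\<^bsup>\<sigma>+n\<^esup>\<^sub>H(X)\<close> otherwise. The case \<open>n = 0\<close> is covered by \<open>H_Cn \<iota> 0 = bcontfun\<close>.\<close>

definition H_C :: "('h::banach \<Rightarrow> 'x::banach) \<Rightarrow> real \<Rightarrow> ('x \<Rightarrow> real) set" where
  "H_C \<iota> \<gamma> =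
     {f \<in> H_Cn \<iota> (nat \<lfloor>\<gamma>\<rfloor>).
        frac \<gamma> \<noteq> 0 \<longrightarrow>
          H_Holder_seminorm \<iota> (frac \<gamma>) (nat \<lfloor>\<gamma>\<rfloor>) (H_deriv \<iota> (nat \<lfloor>\<gamma>\<rfloor>) f) < \<top>}"

definition H_C_norm :: "('h::banach \<Rightarrow> 'x::banach) \<Rightarrow> real \<Rightarrow> ('x \<Rightarrow> real) \<Rightarrow> ennreal" where
  "H_C_norm \<iota> \<gamma> f =
     H_Cn_norm \<iota> (nat \<lfloor>\<gamma>\<rfloor>) f +
     (if frac \<gamma> = 0 then 0
      else H_Holder_seminorm \<iota> (frac \<gamma>) (nat \<lfloor>\<gamma>\<rfloor>) (H_deriv \<iota> (nat \<lfloor>\<gamma>\<rfloor>) f))"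

text \<open>Functions on \<open>[0,T] \<times> X\<close> are curried functions of \<open>(t, x)\<close> whose values for
  \<open>t \<notin> [0,T]\<close> are irrelevant.\<close>

definition Cb_time :: "real \<Rightarrow> (real \<Rightarrow> 'x::banach \<Rightarrow> real) set" where
  "Cb_time T =
     {g. continuous_on ({0..T} \<times> UNIV) (\<lambda>(t, x). g t x) \<and>
         bounded ((\<lambda>(t, x). g t x) ` ({0..T} \<times> UNIV))}"

definition Cb_time_norm :: "real \<Rightarrow> (real \<Rightarrow> 'x::banach \<Rightarrow> real) \<Rightarrow> ennreal" where
  "Cb_time_norm T g = (SUP t\<in>{0..T}. SUP x. ennreal \<bar>g t x\<bar>)"

definition H_C_time_norm ::
    "('h::banach \<Rightarrow> 'x::banach) \<Rightarrow> real \<Rightarrow> real \<Rightarrow> (real \<Rightarrow> 'x \<Rightarrow> real) \<Rightarrow> ennreal" where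
  "H_C_time_norm \<iota> T \<gamma> g = (SUP t\<in>{0..T}. H_C_norm \<iota> \<gamma> (g t))"

definition H_C_time ::
    "('h::banach \<Rightarrow> 'x::banach) \<Rightarrow> real \<Rightarrow> real \<Rightarrow> (real \<Rightarrow> 'x \<Rightarrow> real) set" where
  "H_C_time \<iota> T \<gamma> =
     {g \<in> Cb_time T.
        (\<forall>t\<in>{0..T}. g t \<in> H_C \<iota> \<gamma>) \<and>
        H_C_time_norm \<iota> T \<gamma> g < \<top> \<and>
        (\<gamma> \<ge> 1 \<longrightarrow>
          (\<forall>k \<le> nat \<lfloor>\<gamma>\<rfloor>. \<forall>hs. length hs = k \<longrightarrow>
             continuous_on ({0..T} \<times> UNIV) (\<lambda>(t, x). H_deriv \<iota> k (g t) x hs)))}"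


section \<open>The mild solution\<close>

definition mild_solution ::
    "(real \<Rightarrow> 'x \<Rightarrow>\<^sub>L 'x) \<Rightarrow> (real \<Rightarrow> 'x::{banach, second_countable_topology} measure) \<Rightarrow>
     ('x \<Rightarrow> real) \<Rightarrow> (real \<Rightarrow> 'x \<Rightarrow> real) \<Rightarrow> real \<Rightarrow> 'x \<Rightarrow> real" where
  "mild_solution S \<mu> f g t x =
     mehler S \<mu> t f x + (LINT s:{0..t}|lborel. mehler S \<mu> (t - s) (g s) x)"

end

(*
  Write n = floor gamma for the target exponent gamma = alpha + 1/theta, with alpha = 0 in part (i).

  Fomin differentiability gives ||D_H P_t phi|| <= K t^(-theta) ||phi|| for bounded Borel phi, and
  P_t = P_(t/2) P_(t/2) upgrades this to ||D_H^k P_t phi|| <= C t^(-k theta) ||phi||.  If phi is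
  alpha-Hoelder along H, comparing D_H P_t phi with a difference quotient of step delta t^theta
  gives
    ||D_H P_t phi|| <= C delta^(alpha-1) t^(-(1-alpha) theta) + C delta ||D_H P_(t/2) phi||,
  and iterating with small delta yields the exponent -(k - alpha) theta for all k >= 1; no
  interpolation theory is needed.

  Hence the derivatives up to order n of the convolution integral converge absolutely, and the
  Hoelder bound for the n-th one follows by splitting the integral at s = ||h||^(1/theta), using the
  bound of order n below that point and the one of order n + 1 above it.

  Once D_H^n is Hoelder, difference quotients converge at a uniform rate.  This turns iterated
  directional derivatives into derivatives in operator norm that are linear in each slot, and the
  derivatives inherit the joint continuity of v in (t, x) as uniform limits.
*)

theory Submission
  imports Defs
begin

text \<open>The data are weak: Fomin differentiability only speaks about measures of sets, \<mu> is
  only weakly continuous in time, and g has no regularity along H beyond the exponent \<alpha>.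
  Three choices answer this. All estimates are made for scalar iterated directional derivatives
  \<open>hdd\<close>, which pass under integrals by dominated convergence; multilinear forms enter
  only at the two ends, where the data are read from and the solution is put into the spaces along
  H. The integral is rewritten with integrand P_s g(t - s), so that the singularity sits at s = 0
  for every t. That gamma is not an integer means (n - \<alpha>) \<theta> < 1 < (n + 1 - \<alpha>)
  \<theta>: the bound of order n is then integrable at s = 0 and that of order n + 1 at infinity. It
  also puts the Hoelder exponent gamma - n strictly between 0 and 1, on which the conversion to
  operator norms relies.\<close>

section \<open>Uniform boundedness and weak limits\<close>

text \<open>Banach-Steinhaus through Baire: the closed sets \<open>V n\<close> exhaust the space, so
  one of them has interior. It yields local bounds for the semigroup and, slot by slot, finite norms
  of multilinear forms.\<close>

lemma uniform_boundedness:
  fixes f :: "'i \<Rightarrow> 'a::banach \<Rightarrow> 'b::real_normed_vector"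
  assumes lin: "\<And>i. i \<in> I \<Longrightarrow> bounded_linear (f i)"
    and bdd: "\<And>x. \<exists>B. \<forall>i\<in>I. norm (f i x) \<le> B"
  shows "\<exists>B\<ge>0. \<forall>i\<in>I. \<forall>x. norm (f i x) \<le> B * norm x"
proof -
  define V where "V n = {x. \<forall>i\<in>I. norm (f i x) \<le> real n}" for n :: nat
  have closed_V: "closed (V n)" for n
  proof -
    have "V n = (\<Inter>i\<in>I. {x. norm (f i x) \<le> real n})"
      by (auto simp: V_def)
    moreover have "closed {x. norm (f i x) \<le> real n}" if "i \<in> I" for i
      using lin[OF that]
      by (intro closed_Collect_le continuous_intros bounded_linear.continuous_on[of "f i"])
        auto
    ultimately show ?thesis by auto
  qed
  have "\<exists>n. interior (V n) \<noteq> {}"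
  proof (rule ccontr)
    assume "\<not> ?thesis"
    hence "euclidean interior_of \<Union>(range V) = {}"
      by (intro Baire_category_alt) (auto simp: completely_metrizable_space_euclidean closed_V)
    moreover have "\<Union>(range V) = UNIV"
    proof -
      have "\<exists>n. x \<in> V n" for x
      proof -
        obtain B where B: "\<forall>i\<in>I. norm (f i x) \<le> B"
          using bdd by blast
        obtain n :: nat where "B \<le> real n"
          using real_arch_simple by blast
        hence "x \<in> V n"
          using B by (auto simp: V_def intro: order_trans)
        thus ?thesis ..
      qed
      thus ?thesis by auto
    qed
    ultimately show False by (metis empty_not_UNIV interior_of_topspace topspace_euclidean)
  qed
  then obtain n x0 e where e: "e > 0" "cball x0 e \<subseteq> V n"
    by (metis interior_subset open_contains_cball open_interior subset_trans ex_in_conv)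
  have small: "norm (f i y) \<le> 2 * real n" if "i \<in> I" "norm y \<le> e" for i y
  proof -
    interpret bounded_linear "f i" by (rule lin[OF that(1)])
    have "x0 + y \<in> V n" "x0 \<in> V n"
      using e that by (auto simp: subset_iff dist_norm)
    hence "norm (f i (x0 + y)) \<le> n" "norm (f i x0) \<le> n"
      using that by (auto simp: V_def)
    moreover have "norm (f i y) = norm (f i (x0 + y) - f i x0)" by (simp add: add)
    ultimately show ?thesis
      using norm_triangle_ineq4[of "f i (x0 + y)" "f i x0"] by linarith
  qed
  have "norm (f i x) \<le> 2 * real n / e * norm x" if "i \<in> I" for i x
  proof (cases "x = 0")
    case True
    interpret bounded_linear "f i" by (rule lin[OF that(1)])
    show ?thesis using True by (simp add: zero)
  next
    case False
    interpret bounded_linear "f i" by (rule lin[OF that(1)])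
    have "norm (f i ((e / norm x) *\<^sub>R x)) \<le> 2 * real n"
      using False e(1) by (intro small that) auto
    hence "e / norm x * norm (f i x) \<le> 2 * real n"
      using e(1) by (simp add: scaleR)
    thus ?thesis using False e(1) by (simp add: field_simps)
  qed
  thus ?thesis using e(1)
    by (intro exI[of _ "2 * real n / e"]) (auto intro!: divide_nonneg_nonneg)
qed

text \<open>Strong continuity bounds the orbits on \<open>{0..t+1}\<close>, hence the operators
  uniformly; then \<open>S s y - S t x\<close> splits into \<open>S s (y - x)\<close> and
  \<open>S s x - S t x\<close>.\<close>

lemma C0_semigroup_joint_continuous:
  fixes S :: "real \<Rightarrow> 'x::banach \<Rightarrow>\<^sub>L 'x"
  assumes "C0_semigroup S"
  shows "continuous_on ({0..} \<times> UNIV) (\<lambda>(t, x). S t x)"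
proof -
  have cont: "continuous_on {0..} (\<lambda>t. S t x)" for x
    using assms by (auto simp: C0_semigroup_def)
  have "((\<lambda>(t, x). S t x) \<longlongrightarrow> S t x) (at (t, x) within {0..} \<times> UNIV)" if "t \<ge> 0" for t x
  proof -
    have "\<exists>B. \<forall>s\<in>{0..t+1}. norm (S s y) \<le> B" for y
    proof -
      have "compact ((\<lambda>s. S s y) ` {0..t+1})"
        by (intro compact_continuous_image continuous_on_subset[OF cont]) auto
      from compact_imp_bounded[OF this] show ?thesis
        by (auto simp: bounded_iff)
    qed
    then obtain B where B: "B \<ge> 0" "\<And>s y. s \<in> {0..t+1} \<Longrightarrow> norm (S s y) \<le> B * norm y"
      using uniform_boundedness[of "{0..t+1}" "\<lambda>s. blinfun_apply (S s)"]
      by (metis blinfun.bounded_linear_right)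
    let ?F = "at (t, x) within {0..} \<times> UNIV"
    have tt: "(fst \<longlongrightarrow> t) ?F" "(snd \<longlongrightarrow> x) ?F"
      using tendsto_fst[OF tendsto_ident_at] tendsto_snd[OF tendsto_ident_at]
      by (auto simp: id_def)
    have inF: "\<forall>\<^sub>F z in ?F. fst z \<ge> 0"
      by (auto simp: eventually_at_filter mem_Times_iff)
    have "((\<lambda>z. S (fst z) x) \<longlongrightarrow> S t x) ?F"
    proof -
      have "((\<lambda>s. S s x) \<longlongrightarrow> S t x) (at t within {0..})"
        using cont[of x] that by (auto simp: continuous_on_def)
      moreover have "continuous_on {0..} (\<lambda>s. S s x)" by (rule cont)
      ultimately show ?thesis
        by (intro continuous_on_tendsto_compose[OF cont tt(1)]) (use that inF in auto)
    qed
    moreover have "((\<lambda>z. S (fst z) (snd z) - S (fst z) x) \<longlongrightarrow> 0) ?F"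
    proof (rule Lim_null_comparison)
      have "\<forall>\<^sub>F z in ?F. fst z < t + 1"
        using tt(1) by (rule order_tendstoD) simp
      with inF show "\<forall>\<^sub>F z in ?F. norm (S (fst z) (snd z) - S (fst z) x) \<le> B * norm (snd z - x)"
      proof eventually_elim
        case (elim z)
        thus ?case using B(2)[of "fst z" "snd z - x"] by (simp add: blinfun.diff_right)
      qed
      show "((\<lambda>z. B * norm (snd z - x)) \<longlongrightarrow> 0) ?F"
        using tendsto_mult_left[OF tendsto_norm[OF tendsto_diff[OF tt(2) tendsto_const[of x]]], of B]
        by simp
    qed
    ultimately have "((\<lambda>z. S (fst z) x + (S (fst z) (snd z) - S (fst z) x)) \<longlongrightarrow> S t x + 0) ?F"
      by (rule tendsto_add)
    thus ?thesis by (simp add: case_prod_unfold)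
  qed
  thus ?thesis by (auto simp: continuous_on_def)
qed

text \<open>The sup-convolutions \<open>sup\<^sub>w (G w - k * dist w v)\<close> are Lipschitz and decrease to \<open>G\<close>.\<close>

lemma Lipschitz_majorants:
  fixes G :: "'a::metric_space \<Rightarrow> real"
  assumes cont: "continuous_on UNIV G" and bdd: "\<And>v. \<bar>G v\<bar> \<le> B"
  obtains L where "\<And>k v w. \<bar>L k v - L k w\<bar> \<le> real k * dist v w" "\<And>k v. G v \<le> L k v"
    "\<And>k v. \<bar>L k v\<bar> \<le> B" "\<And>v. (\<lambda>k. L k v) \<longlonglongrightarrow> G v"
proof -
  define L where "L k v = (SUP w. G w - real k * dist w v)" for k :: nat and v
  have up: "G w - real k * dist w v \<le> B" for w v k
  proof -
    have "0 \<le> real k * dist w v" by simp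
    thus ?thesis using bdd[of w] by linarith
  qed
  have bda: "bdd_above (range (\<lambda>w. G w - real k * dist w v))" for k v
    using up by (auto intro!: bdd_aboveI)
  have ge: "G v \<le> L k v" for k v
    unfolding L_def using cSUP_upper[OF UNIV_I bda, of v k v] by simp
  have le: "L k v \<le> B" for k v
    unfolding L_def by (intro cSUP_least up) auto
  have lip1: "L k v \<le> L k w + real k * dist v w" for k v w
    unfolding L_def[of k v]
  proof (rule cSUP_least)
    fix u
    have "G u - real k * dist u w \<le> L k w"
      unfolding L_def by (rule cSUP_upper[OF UNIV_I bda])
    moreover have "real k * dist u w \<le> real k * (dist u v + dist v w)"
      by (intro mult_left_mono dist_triangle) auto
    ultimately show "G u - real k * dist u v \<le> L k w + real k * dist v w"
      by (simp add: algebra_simps)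
  qed auto
  have lip: "\<bar>L k v - L k w\<bar> \<le> real k * dist v w" for k v w
    using lip1[of k v w] lip1[of k w v] by (simp add: dist_commute)
  have bd: "\<bar>L k v\<bar> \<le> B" for k v
    using ge[of v k] le[of k v] bdd[of v] by linarith
  have lim: "(\<lambda>k. L k v) \<longlonglongrightarrow> G v" for v
  proof (rule LIMSEQ_I)
    fix r :: real assume "r > 0"
    then obtain d where d: "d > 0" "\<And>w. dist w v < d \<Longrightarrow> dist (G w) (G v) < r / 2"
      using cont unfolding continuous_on_iff by (metis UNIV_I half_gt_zero)
    \<comment> \<open>At distance at least d from v the penalty is then at least 2 B, which
      dominates the oscillation of \<open>G\<close>, so only points near v matter for the
      supremum.\<close>
    obtain N :: nat where N: "2 * B / d \<le> real N"
      using real_arch_simple by blast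
    have "norm (L k v - G v) < r" if "k \<ge> N" for k
    proof -
      have "L k v \<le> G v + r / 2"
        unfolding L_def
      proof (rule cSUP_least)
        fix w
        show "G w - real k * dist w v \<le> G v + r / 2"
        proof (cases "dist w v < d")
          case True
          have "0 \<le> real k * dist w v" by simp
          moreover have "G w - G v < r / 2"
            using d(2)[OF True] by (simp only: dist_real_def abs_less_iff)
          ultimately show ?thesis by linarith
        next
          case False
          have "2 * B \<le> real N * d"
            using N d(1) by (simp add: field_simps)
          also have "\<dots> \<le> real k * dist w v"
            using False that d(1) by (intro mult_mono) auto
          finally show ?thesis using bdd[of w] bdd[of v] \<open>r > 0\<close> by linarith
        qed
      qed auto
      thus ?thesis using ge[of v k] \<open>r > 0\<close> by simp
    qed
    thus "\<exists>no. \<forall>n\<ge>no. norm (L n v - G v) < r" by blast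
  qed
  show ?thesis by (rule that[OF lip ge bd lim])
qed

lemma Lipschitz_imp_continuous_on:
  fixes f :: "'a::metric_space \<Rightarrow> real"
  assumes "\<And>v w. \<bar>f v - f w\<bar> \<le> K * dist v w"
  shows "continuous_on S f"
proof -
  have "K' -lipschitz_on S f" if "K' = max K 0" for K'
    using assms that
    by (intro lipschitz_onI)
      (auto simp: dist_real_def intro!: order_trans[OF assms mult_right_mono])
  thus ?thesis by (blast intro: lipschitz_on_continuous_on)
qed

lemma bounded_measurable_integrable:
  fixes f :: "'x::topological_space \<Rightarrow> real"
  assumes "prob_space M" "sets M = sets borel" "f \<in> borel_measurable borel" "\<And>x. \<bar>f x\<bar> \<le> B"
  shows "integrable M f"
proof -
  interpret prob_space M by fact
  have "f \<in> borel_measurable M"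
    using assms(2,3) by (simp cong: measurable_cong_sets)
  thus ?thesis
    using assms(4) by (intro integrable_const_bound[where B = B]) auto
qed

lemma bounded_continuous_integrable:
  fixes f :: "'x::topological_space \<Rightarrow> real"
  assumes "prob_space M" "sets M = sets borel" "continuous_on UNIV f" "\<And>x. \<bar>f x\<bar> \<le> B"
  shows "integrable M f"
  by (rule bounded_measurable_integrable[OF assms(1,2) borel_measurable_continuous_onI[OF assms(3)] assms(4)])

text \<open>Weak convergence is stable under continuous convergence of the integrands; the Lipschitz
  majorants replace a tightness argument.\<close>

lemma weak_limit_upper:
  fixes \<mu> :: "'t \<Rightarrow> 'x::metric_space measure" and G :: "'z::metric_space \<Rightarrow> 'x \<Rightarrow> real"
  assumes prob: "\<And>t. t \<in> A \<Longrightarrow> prob_space (\<mu> t) \<and> sets (\<mu> t) = sets borel"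
    and weak: "\<And>f :: 'x \<Rightarrow> real. f \<in> bcontfun \<Longrightarrow> ((\<lambda>n. LINT x|\<mu> (t n). f x) \<longlongrightarrow> (LINT x|\<mu> t0. f x)) F"
    and inA: "\<And>n. t n \<in> A" "t0 \<in> A"
    and z: "(z \<longlongrightarrow> z0) F"
    and cont: "continuous_on UNIV (\<lambda>(z, x). G z x)" and bdd: "\<And>z x. \<bar>G z x\<bar> \<le> B"
    and r: "r > 0"
  shows "\<forall>\<^sub>F n in F. (LINT x|\<mu> (t n). G (z n) x) < (LINT x|\<mu> t0. G z0 x) + r"
proof -
  obtain L where L: "\<And>k v w. \<bar>L k v - L k w\<bar> \<le> real k * dist v w"
    "\<And>k v. (\<lambda>(z, x). G z x) v \<le> L k v"
    "\<And>k v. \<bar>L k v\<bar> \<le> B" "\<And>v. (\<lambda>k. L k v) \<longlonglongrightarrow> (\<lambda>(z, x). G z x) v"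
    using Lipschitz_majorants[OF cont, of B] bdd by (auto split: prod.splits)
  have contL: "continuous_on UNIV (\<lambda>x. L k (z, x))" for k z
    by (rule Lipschitz_imp_continuous_on[of _ "real k"]) (use L(1)[of k "(z, _)" "(z, _)"] in \<open>simp add: dist_Pair_Pair\<close>)
  have contG: "continuous_on UNIV (G z)" for z
    using continuous_on_compose2[OF cont, of UNIV "\<lambda>x. (z, x)"] by (simp add: continuous_on_Pair)
  note intL = bounded_continuous_integrable[OF conjunct1[OF prob] conjunct2[OF prob] contL L(3)]
  note intG = bounded_continuous_integrable[OF conjunct1[OF prob] conjunct2[OF prob] contG bdd]
  have "(\<lambda>k. LINT x|\<mu> t0. L k (z0, x)) \<longlonglongrightarrow> (LINT x|\<mu> t0. G z0 x)"
  proof (rule integral_dominated_convergence[where w = "\<lambda>_. B"])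
    interpret prob_space "\<mu> t0" using prob inA by blast
    show "integrable (\<mu> t0) (\<lambda>_. B)" by simp
    show "AE x in \<mu> t0. (\<lambda>k. L k (z0, x)) \<longlonglongrightarrow> G z0 x"
      using L(4)[of "(z0, _)"] by auto
  qed (use L(3) intL[OF inA(2) inA(2)] intG[OF inA(2) inA(2)] in auto)
  from order_tendstoD(2)[OF this, of "(LINT x|\<mu> t0. G z0 x) + r / 2"] r
  obtain k where k: "(LINT x|\<mu> t0. L k (z0, x)) < (LINT x|\<mu> t0. G z0 x) + r / 2"
    by (auto simp: eventually_sequentially)
  \<comment> \<open>With k fixed, the slice of the majorant at \<open>z0\<close> is one bounded
    continuous function, to which weak convergence applies; its Lipschitz constant pays for
    replacing \<open>z n\<close> by \<open>z0\<close>.\<close>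
  have "(\<lambda>x. L k (z0, x)) \<in> bcontfun"
    using L(3) by (intro bcontfun_normI[OF contL, of _ _ B]) auto
  from tendsto_add[OF weak[OF this] tendsto_mult_left[OF tendsto_dist[OF z tendsto_const[of z0]], of "real k"]]
  have "((\<lambda>n. (LINT x|\<mu> (t n). L k (z0, x)) + real k * dist (z n) z0) \<longlongrightarrow> (LINT x|\<mu> t0. L k (z0, x)) + 0) F"
    by simp
  from order_tendstoD(2)[OF this, of "(LINT x|\<mu> t0. G z0 x) + r"] k r
  have "\<forall>\<^sub>F n in F. (LINT x|\<mu> (t n). L k (z0, x)) + real k * dist (z n) z0 < (LINT x|\<mu> t0. G z0 x) + r"
    by auto
  thus ?thesis
  proof eventually_elim
    case (elim n)
    interpret prob_space "\<mu> (t n)" using prob inA by blast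
    have "(LINT x|\<mu> (t n). G (z n) x) \<le> (LINT x|\<mu> (t n). L k (z0, x) + real k * dist (z n) z0)"
    proof (rule integral_mono)
      fix x
      have "G (z n) x \<le> L k (z n, x)" using L(2)[of "(z n, x)"] by simp
      also have "\<dots> \<le> L k (z0, x) + real k * dist (z n) z0"
        using L(1)[of k "(z n, x)" "(z0, x)"] by (simp add: dist_Pair_Pair)
      finally show "G (z n) x \<le> L k (z0, x) + real k * dist (z n) z0" .
    qed (use inA intG intL in auto)
    also have "\<dots> = (LINT x|\<mu> (t n). L k (z0, x)) + real k * dist (z n) z0"
      using intL[OF inA(1) inA(1)] by (simp add: prob_space)
    finally show ?case using elim by linarith
  qed
qed

text \<open>The one-sided estimate, used for \<open>G\<close> and for \<open>- G\<close>, gives both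
  halves of the limit.\<close>

lemma weak_limit:
  fixes \<mu> :: "'t \<Rightarrow> 'x::metric_space measure" and G :: "'z::metric_space \<Rightarrow> 'x \<Rightarrow> real"
  assumes prob: "\<And>t. t \<in> A \<Longrightarrow> prob_space (\<mu> t) \<and> sets (\<mu> t) = sets borel"
    and weak: "\<And>f :: 'x \<Rightarrow> real. f \<in> bcontfun \<Longrightarrow> ((\<lambda>n. LINT x|\<mu> (t n). f x) \<longlongrightarrow> (LINT x|\<mu> t0. f x)) F"
    and inA: "\<And>n. t n \<in> A" "t0 \<in> A"
    and z: "(z \<longlongrightarrow> z0) F"
    and cont: "continuous_on UNIV (\<lambda>(z, x). G z x)" and bdd: "\<And>z x. \<bar>G z x\<bar> \<le> B"
  shows "((\<lambda>n. LINT x|\<mu> (t n). G (z n) x) \<longlongrightarrow> (LINT x|\<mu> t0. G z0 x)) F"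
proof (rule order_tendstoI)
  fix a assume "a > (LINT x|\<mu> t0. G z0 x)"
  thus "\<forall>\<^sub>F n in F. (LINT x|\<mu> (t n). G (z n) x) < a"
    using weak_limit_upper[OF assms, of "a - (LINT x|\<mu> t0. G z0 x)"] by auto
next
  fix a assume a: "a < (LINT x|\<mu> t0. G z0 x)"
  have cont': "continuous_on UNIV (\<lambda>(z, x). - G z x)"
    using continuous_on_minus[OF cont] by (simp add: case_prod_beta)
  show "\<forall>\<^sub>F n in F. (LINT x|\<mu> (t n). G (z n) x) > a"
    using weak_limit_upper[OF prob weak inA z cont', of B "(LINT x|\<mu> t0. G z0 x) - a"] a bdd
    by (auto elim!: eventually_mono)
qed

section \<open>Differentiation along Fomin directions\<close>

locale fomin =
  fixes \<mu> :: "'x::banach measure" and v :: 'x and \<beta> :: "'x \<Rightarrow> real"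
  assumes prob: "prob_space \<mu>" and sets_eq: "sets \<mu> = sets borel"
    and density: "fomin_density \<mu> v \<beta>"
begin

sublocale prob_space \<mu> by (rule prob)

lemma integrable_density: "integrable \<mu> \<beta>"
  using density by (simp add: fomin_density_def)

lemma borel_imp_measurable: "\<phi> \<in> borel_measurable borel \<Longrightarrow> \<phi> \<in> borel_measurable \<mu>"
  using sets_eq by (simp cong: measurable_cong_sets)

lemmas integrable_bounded = bounded_measurable_integrable[OF prob sets_eq]

lemma integrable_mult_density:
  assumes "\<phi> \<in> borel_measurable borel" "\<And>x. \<bar>\<phi> x\<bar> \<le> B"
  shows "integrable \<mu> (\<lambda>y. \<phi> y * \<beta> y)"
proof (rule Bochner_Integration.integrable_bound[of _ "\<lambda>y. B * \<beta> y"])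
  show "integrable \<mu> (\<lambda>y. B * \<beta> y)" using integrable_density by simp
  show "(\<lambda>y. \<phi> y * \<beta> y) \<in> borel_measurable \<mu>"
    using borel_imp_measurable[OF assms(1)] integrable_density by auto
  show "AE x in \<mu>. norm (\<phi> x * \<beta> x) \<le> norm (B * \<beta> x)"
  proof (rule AE_I2)
    fix x
    have "\<bar>\<phi> x\<bar> \<le> \<bar>B\<bar>" using assms(2)[of x] by linarith
    thus "norm (\<phi> x * \<beta> x) \<le> norm (B * \<beta> x)"
      by (simp add: abs_mult mult_right_mono)
  qed
qed

lemma integral_mult_density_le:
  assumes "\<phi> \<in> borel_measurable borel" "\<And>x. \<bar>\<phi> x\<bar> \<le> B"
  shows "\<bar>LINT y|\<mu>. \<phi> y * \<beta> y\<bar> \<le> B * (LINT y|\<mu>. \<bar>\<beta> y\<bar>)"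
proof -
  have "\<bar>LINT y|\<mu>. \<phi> y * \<beta> y\<bar> \<le> (LINT y|\<mu>. \<bar>\<phi> y * \<beta> y\<bar>)"
    by (rule integral_abs_bound)
  also have "\<dots> \<le> (LINT y|\<mu>. B * \<bar>\<beta> y\<bar>)"
    using integrable_mult_density[OF assms] integrable_density assms(2)
    by (intro integral_mono integrable_abs) (auto simp: abs_mult intro!: mult_right_mono)
  finally show ?thesis by simp
qed

lemma measurable_translate:
  fixes \<phi> :: "'x \<Rightarrow> real"
  shows "\<phi> \<in> borel_measurable borel \<Longrightarrow> (\<lambda>y. \<phi> (y + a)) \<in> borel_measurable borel"
  by (rule measurable_compose[of "\<lambda>y. y + a" borel borel])
    (auto intro!: borel_measurable_continuous_onI continuous_intros)

text \<open>Translating the argument by t v translates the set by - t v; the inner derivative -1 is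
  the minus sign of the integration by parts formula.\<close>

lemma derivative_indicator:
  assumes A: "A \<in> sets borel"
  shows "((\<lambda>t. LINT y|\<mu>. indicator A (y + t *\<^sub>R v)) has_real_derivative
           - (LINT y|\<mu>. indicator A y * \<beta> y)) (at 0)"
proof -
  have img: "(\<lambda>y. indicator A (y + t *\<^sub>R v) :: real) = indicator ((\<lambda>a. a + (- t) *\<^sub>R v) ` A)" for t
  proof
    fix y
    have "y + t *\<^sub>R v \<in> A \<longleftrightarrow> y \<in> (\<lambda>a. a + (- t) *\<^sub>R v) ` A"
      by (auto simp: image_iff algebra_simps)
    thus "indicator A (y + t *\<^sub>R v) = (indicator ((\<lambda>a. a + (- t) *\<^sub>R v) ` A) y :: real)"
      by (simp add: indicator_def)
  qed
  define m where "m t = measure \<mu> ((\<lambda>a. a + t *\<^sub>R v) ` A)" for t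
  have *: "(LINT y|\<mu>. indicator A (y + t *\<^sub>R v)) = m (- t)" for t
  proof -
    have "space \<mu> = UNIV" using sets_eq_imp_space_eq[OF sets_eq] by simp
    thus ?thesis by (simp only: img m_def) (simp add: measure_def)
  qed
  have "((\<lambda>t. (m t - m 0) / t) \<longlongrightarrow> (LINT y:A|\<mu>. \<beta> y)) (at 0)"
    using density A by (simp add: fomin_density_def m_def)
  hence "(m has_real_derivative (LINT y:A|\<mu>. \<beta> y)) (at 0)"
    by (simp add: DERIV_def)
  hence "((\<lambda>t. m (- t)) has_real_derivative (LINT y:A|\<mu>. \<beta> y) * (- 1)) (at 0)"
    by (intro DERIV_chain2[of m _ "\<lambda>t. - t" 0 "-1"]) (auto intro!: derivative_eq_intros)
  thus ?thesis by (simp add: * set_lebesgue_integral_def)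
qed

lemma derivative_simple:
  assumes \<phi>: "\<phi> \<in> borel_measurable borel" and fin: "finite (range \<phi>)"
  shows "((\<lambda>t. LINT y|\<mu>. \<phi> (y + t *\<^sub>R v)) has_real_derivative - (LINT y|\<mu>. \<phi> y * \<beta> y)) (at 0)"
proof -
  define R where "R = range \<phi>"
  define A where "A c = \<phi> -` {c}" for c
  have A: "A c \<in> sets borel" for c
    using measurable_sets[OF \<phi>, of "{c}"] by (simp add: A_def)
  have eq: "\<phi> y = (\<Sum>c\<in>R. c * indicator (A c) y)" for y
  proof -
    have "(\<Sum>c\<in>R. c * indicator (A c) y) = (\<Sum>c\<in>R. if c = \<phi> y then c else 0)"
      by (intro sum.cong) (auto simp: A_def)
    thus ?thesis using fin by (simp add: sum.delta R_def)
  qed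
  have int1: "integrable \<mu> (\<lambda>y. c * indicator (A c) (y + a))" for c a
  proof (rule integrable_bounded[of _ "\<bar>c\<bar>"])
    show "(\<lambda>y. c * indicator (A c) (y + a)) \<in> borel_measurable borel"
      by (rule borel_measurable_times[OF _ measurable_translate]) (use A in auto)
  qed (auto simp: indicator_def)
  have int2: "integrable \<mu> (\<lambda>y. c * indicator (A c) y * \<beta> y)" for c
    using A by (intro integrable_mult_density[of _ "\<bar>c\<bar>"]) (auto simp: indicator_def)
  have lhs: "(LINT y|\<mu>. \<phi> (y + t *\<^sub>R v)) = (\<Sum>c\<in>R. c * (LINT y|\<mu>. indicator (A c) (y + t *\<^sub>R v)))" for t
  proof -
    have "(LINT y|\<mu>. \<phi> (y + t *\<^sub>R v)) = (LINT y|\<mu>. (\<Sum>c\<in>R. c * indicator (A c) (y + t *\<^sub>R v)))"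
      by (simp only: eq[symmetric])
    also have "\<dots> = (\<Sum>c\<in>R. LINT y|\<mu>. c * indicator (A c) (y + t *\<^sub>R v))"
      by (rule Bochner_Integration.integral_sum[OF int1])
    finally show ?thesis by (simp only: integral_mult_right_zero)
  qed
  have rhs: "- (LINT y|\<mu>. \<phi> y * \<beta> y) = (\<Sum>c\<in>R. c * - (LINT y|\<mu>. indicator (A c) y * \<beta> y))"
  proof -
    have "(LINT y|\<mu>. \<phi> y * \<beta> y) = (LINT y|\<mu>. (\<Sum>c\<in>R. c * indicator (A c) y * \<beta> y))"
      by (simp only: eq[symmetric] sum_distrib_right[symmetric])
    also have "\<dots> = (\<Sum>c\<in>R. LINT y|\<mu>. c * indicator (A c) y * \<beta> y)"
      by (rule Bochner_Integration.integral_sum[OF int2])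
    finally show ?thesis
      by (simp only: mult.assoc integral_mult_right_zero sum_negf mult_minus_right)
  qed
  show ?thesis
    unfolding lhs rhs by (intro DERIV_sum DERIV_cmult derivative_indicator A)
qed

text \<open>Translates of a simple function are simple, so \<open>derivative_simple\<close> holds at
  every point of the line, and the mean value inequality applies. The constant sees only the sup
  norm and not the number of values, which lets it survive the limit to bounded Borel
  functions.\<close>

lemma Lipschitz_simple:
  assumes \<phi>: "\<phi> \<in> borel_measurable borel" "finite (range \<phi>)" "\<And>x. \<bar>\<phi> x\<bar> \<le> B"
  shows "\<bar>(LINT y|\<mu>. \<phi> (y + t *\<^sub>R v)) - (LINT y|\<mu>. \<phi> y)\<bar> \<le> B * (LINT y|\<mu>. \<bar>\<beta> y\<bar>) * \<bar>t\<bar>"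
proof -
  have deriv: "((\<lambda>t. LINT y|\<mu>. \<phi> (y + t *\<^sub>R v)) has_real_derivative
          - (LINT y|\<mu>. \<phi> (y + s *\<^sub>R v) * \<beta> y)) (at s)" for s
  proof -
    have "finite (range (\<lambda>y. \<phi> (y + s *\<^sub>R v)))"
      by (rule finite_subset[OF _ \<phi>(2)]) auto
    from derivative_simple[OF measurable_translate[OF \<phi>(1)] this]
    show ?thesis
      using DERIV_shift[of "\<lambda>t. LINT y|\<mu>. \<phi> (y + t *\<^sub>R v)" _ 0 s] by (simp add: algebra_simps)
  qed
  have "norm ((LINT y|\<mu>. \<phi> (y + t *\<^sub>R v)) - (LINT y|\<mu>. \<phi> (y + 0 *\<^sub>R v)))
          \<le> B * (LINT y|\<mu>. \<bar>\<beta> y\<bar>) * norm (t - 0)"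
  proof (rule field_differentiable_bound[of UNIV])
    fix s
    show "norm (- (LINT y|\<mu>. \<phi> (y + s *\<^sub>R v) * \<beta> y)) \<le> B * (LINT y|\<mu>. \<bar>\<beta> y\<bar>)"
      using integral_mult_density_le[OF measurable_translate[OF \<phi>(1)] \<phi>(3)] by simp
  qed (use deriv in auto)
  thus ?thesis by simp
qed

text \<open>Rounding down to a grid approximates uniformly, not just pointwise; the remainder then
  has difference quotients that are small for all t at once.\<close>

definition step :: "('x \<Rightarrow> real) \<Rightarrow> nat \<Rightarrow> 'x \<Rightarrow> real" where
  "step \<phi> k x = of_int \<lfloor>real (Suc k) * \<phi> x\<rfloor> / real (Suc k)"

lemma step_close: "\<bar>\<phi> x - step \<phi> k x\<bar> \<le> 1 / real (Suc k)"
proof -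
  define c where "c = real (Suc k)"
  have c: "c > 0" by (simp add: c_def)
  have "\<phi> x - step \<phi> k x = (c * \<phi> x - of_int \<lfloor>c * \<phi> x\<rfloor>) / c"
    using c unfolding step_def c_def[symmetric] by (simp add: diff_divide_distrib)
  moreover have "\<bar>c * \<phi> x - of_int \<lfloor>c * \<phi> x\<rfloor>\<bar> \<le> 1"
    using floor_correct[of "c * \<phi> x"] by linarith
  ultimately show ?thesis
    using c unfolding c_def[symmetric] by (simp add: abs_divide divide_right_mono)
qed

lemma step_measurable:
  assumes "\<phi> \<in> borel_measurable borel"
  shows "step \<phi> k \<in> borel_measurable borel"
proof -
  have "(\<lambda>r::real. real_of_int \<lfloor>real (Suc k) * r\<rfloor> / real (Suc k)) \<in> borel_measurable borel"
    by measurable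
  from measurable_compose[OF assms this] show ?thesis
    by (simp add: step_def[abs_def])
qed

lemma finite_range_step:
  assumes "\<And>x. \<bar>\<phi> x\<bar> \<le> B"
  shows "finite (range (step \<phi> k))"
proof -
  have "\<lfloor>real (Suc k) * \<phi> x\<rfloor> \<in> {\<lfloor>- (real (Suc k) * B)\<rfloor>..\<lfloor>real (Suc k) * B\<rfloor>}" for x
  proof -
    have "\<bar>real (Suc k) * \<phi> x\<bar> \<le> real (Suc k) * B"
      using assms[of x] by (simp add: abs_mult del: of_nat_Suc)
    thus ?thesis by (simp add: abs_le_iff del: of_nat_Suc) (auto intro!: floor_mono)
  qed
  hence "range (step \<phi> k) \<subseteq> (\<lambda>i. of_int i / real (Suc k)) ` {\<lfloor>- (real (Suc k) * B)\<rfloor>..\<lfloor>real (Suc k) * B\<rfloor>}"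
    unfolding step_def by blast
  thus ?thesis by (rule finite_subset) simp
qed

text \<open>Dominated convergence along \<open>step \<phi> k\<close> on both sides of the bound for
  simple functions.\<close>

lemma Lipschitz:
  assumes \<phi>: "\<phi> \<in> borel_measurable borel" "\<And>x. \<bar>\<phi> x\<bar> \<le> B"
  shows "\<bar>(LINT y|\<mu>. \<phi> (y + t *\<^sub>R v)) - (LINT y|\<mu>. \<phi> y)\<bar> \<le> B * (LINT y|\<mu>. \<bar>\<beta> y\<bar>) * \<bar>t\<bar>"
proof -
  have bd: "\<bar>step \<phi> k x\<bar> \<le> B + 1 / real (Suc k)" for k x
    using step_close[of \<phi> x k] \<phi>(2)[of x] by linarith
  have inv1: "1 / real (Suc k) \<le> 1" for k by simp
  have lim0: "(\<lambda>k. 1 / real (Suc k)) \<longlonglongrightarrow> 0"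
    using LIMSEQ_inverse_real_of_nat by (simp add: inverse_eq_divide)
  have lim: "(\<lambda>k. LINT y|\<mu>. step \<phi> k (y + a)) \<longlonglongrightarrow> (LINT y|\<mu>. \<phi> (y + a))" for a
  proof (rule integral_dominated_convergence[where w = "\<lambda>_. B + 1"])
    show "AE y in \<mu>. (\<lambda>k. step \<phi> k (y + a)) \<longlonglongrightarrow> \<phi> (y + a)"
    proof (rule AE_I2)
      fix y
      have "(\<lambda>k. \<phi> (y + a) - step \<phi> k (y + a)) \<longlonglongrightarrow> 0"
        by (rule Lim_null_comparison[OF _ lim0]) (simp add: step_close del: of_nat_Suc)
      from tendsto_diff[OF tendsto_const this, of "\<phi> (y + a)"]
      show "(\<lambda>k. step \<phi> k (y + a)) \<longlonglongrightarrow> \<phi> (y + a)" by simp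
    qed
    show "AE y in \<mu>. norm (step \<phi> k (y + a)) \<le> B + 1" for k
    proof (rule AE_I2)
      fix y
      show "norm (step \<phi> k (y + a)) \<le> B + 1"
        using bd[of k "y + a"] inv1[of k] unfolding real_norm_def by linarith
    qed
    show "(\<lambda>y. step \<phi> k (y + a)) \<in> borel_measurable \<mu>" for k
      by (rule borel_imp_measurable[OF measurable_translate[OF step_measurable[OF \<phi>(1)]]])
    show "(\<lambda>y. \<phi> (y + a)) \<in> borel_measurable \<mu>"
      by (rule borel_imp_measurable[OF measurable_translate[OF \<phi>(1)]])
  qed simp
  show ?thesis
  proof (rule LIMSEQ_le)
    show "(\<lambda>k. \<bar>(LINT y|\<mu>. step \<phi> k (y + t *\<^sub>R v)) - (LINT y|\<mu>. step \<phi> k y)\<bar>)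
            \<longlonglongrightarrow> \<bar>(LINT y|\<mu>. \<phi> (y + t *\<^sub>R v)) - (LINT y|\<mu>. \<phi> y)\<bar>"
      using lim[of "t *\<^sub>R v"] lim[of 0] by (auto intro!: tendsto_intros)
    have "(\<lambda>k. (B + 1 / real (Suc k)) * (LINT y|\<mu>. \<bar>\<beta> y\<bar>) * \<bar>t\<bar>)
            \<longlonglongrightarrow> (B + 0) * (LINT y|\<mu>. \<bar>\<beta> y\<bar>) * \<bar>t\<bar>"
      by (intro tendsto_intros lim0)
    thus "(\<lambda>k. (B + 1 / real (Suc k)) * (LINT y|\<mu>. \<bar>\<beta> y\<bar>) * \<bar>t\<bar>)
            \<longlonglongrightarrow> B * (LINT y|\<mu>. \<bar>\<beta> y\<bar>) * \<bar>t\<bar>" by simp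
    show "\<exists>N. \<forall>k\<ge>N. \<bar>(LINT y|\<mu>. step \<phi> k (y + t *\<^sub>R v)) - (LINT y|\<mu>. step \<phi> k y)\<bar>
            \<le> (B + 1 / real (Suc k)) * (LINT y|\<mu>. \<bar>\<beta> y\<bar>) * \<bar>t\<bar>"
      using Lipschitz_simple[OF step_measurable[OF \<phi>(1)] finite_range_step[OF \<phi>(2)] bd] by blast
  qed
qed

text \<open>Write \<phi> as a simple function plus a uniformly small remainder: the first part is
  differentiable, and \<open>Lipschitz\<close> makes the quotients of the second at most e / 3
  uniformly in t, so limit and approximation may be exchanged.\<close>

lemma derivative_bounded_measurable:
  assumes \<phi>: "\<phi> \<in> borel_measurable borel" "\<And>x. \<bar>\<phi> x\<bar> \<le> B"
  shows "((\<lambda>t. LINT y|\<mu>. \<phi> (y + t *\<^sub>R v)) has_real_derivative - (LINT y|\<mu>. \<phi> y * \<beta> y)) (at 0)"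
proof -
  define b where "b = (LINT y|\<mu>. \<bar>\<beta> y\<bar>)"
  define Q where "Q \<phi> t = ((LINT y|\<mu>. \<phi> (y + t *\<^sub>R v)) - (LINT y|\<mu>. \<phi> y)) / t" for \<phi> t
  have "(Q \<phi> \<longlongrightarrow> - (LINT y|\<mu>. \<phi> y * \<beta> y)) (at 0)"
  proof (rule tendstoI)
    fix e :: real assume "e > 0"
    have b0: "b \<ge> 0" by (simp add: b_def)
    obtain k :: nat where k: "(b + 1) / e * 3 < real k"
      using reals_Archimedean2 by blast
    hence bk: "b / real (Suc k) < e / 3"
      using b0 \<open>e > 0\<close> by (simp add: field_simps)
    define s where "s = step \<phi> k"
    define d where "d x = \<phi> x - s x" for x
    have s: "s \<in> borel_measurable borel" "finite (range s)"
      using step_measurable[OF \<phi>(1)] finite_range_step[OF \<phi>(2)] by (auto simp: s_def)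
    have d: "d \<in> borel_measurable borel" "\<And>x. \<bar>d x\<bar> \<le> 1 / real (Suc k)"
      using s(1) \<phi>(1) step_close[of \<phi> _ k] by (auto simp: d_def[abs_def] s_def)
    obtain B' where B': "\<And>x. \<bar>s x\<bar> \<le> B'"
      using finite_imp_bounded[OF s(2)] by (auto simp: bounded_iff)
    have tr: "integrable \<mu> (\<lambda>y. \<psi> (y + a))" if "\<psi> \<in> borel_measurable borel" "\<And>x. \<bar>\<psi> x\<bar> \<le> C" for \<psi> :: "'x \<Rightarrow> real" and a C
      using that by (intro integrable_bounded[OF measurable_translate, of _ _ C])
    have \<phi>_eq: "\<phi> y = s y + d y" for y by (simp add: d_def)
    have Q_eq: "Q \<phi> t = Q s t + Q d t" for t
    proof -
      have "(LINT y|\<mu>. \<phi> (y + a)) = (LINT y|\<mu>. s (y + a)) + (LINT y|\<mu>. d (y + a))" for a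
        unfolding \<phi>_eq by (intro Bochner_Integration.integral_add tr[OF s(1) B'] tr[OF d])
      from this[of "t *\<^sub>R v"] this[of 0] show ?thesis
        by (simp add: Q_def diff_divide_distrib add_divide_distrib)
    qed
    have Qd: "\<bar>Q d t\<bar> \<le> b / real (Suc k)" if "t \<noteq> 0" for t
    proof -
      have "\<bar>(LINT y|\<mu>. d (y + t *\<^sub>R v)) - (LINT y|\<mu>. d y)\<bar> \<le> b / real (Suc k) * \<bar>t\<bar>"
        using Lipschitz[OF d] by (simp add: b_def)
      thus ?thesis using that by (simp add: Q_def abs_divide divide_le_eq)
    qed
    have int_eq: "(LINT y|\<mu>. \<phi> y * \<beta> y) = (LINT y|\<mu>. s y * \<beta> y) + (LINT y|\<mu>. d y * \<beta> y)"
      unfolding \<phi>_eq distrib_right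
      by (intro Bochner_Integration.integral_add integrable_mult_density[OF s(1) B']
            integrable_mult_density[OF d])
    have dle: "\<bar>LINT y|\<mu>. d y * \<beta> y\<bar> \<le> b / real (Suc k)"
      using integral_mult_density_le[OF d] by (simp add: b_def)
    have "(Q s \<longlongrightarrow> - (LINT y|\<mu>. s y * \<beta> y)) (at 0)"
      using derivative_simple[OF s] by (simp add: DERIV_def Q_def[abs_def])
    from tendstoD[OF this, of "e / 3"] \<open>e > 0\<close>
    have "\<forall>\<^sub>F t in at 0. dist (Q s t) (- (LINT y|\<mu>. s y * \<beta> y)) < e / 3" by simp
    moreover have "\<forall>\<^sub>F t in at 0. t \<noteq> (0::real)"
      by (simp add: eventually_at_filter)
    ultimately show "\<forall>\<^sub>F t in at 0. dist (Q \<phi> t) (- (LINT y|\<mu>. \<phi> y * \<beta> y)) < e"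
    proof eventually_elim
      case (elim t)
      show ?case
        using elim(1) Qd[OF elim(2)] dle bk unfolding dist_real_def Q_eq int_eq by linarith
    qed
  qed
  thus ?thesis by (simp add: DERIV_def Q_def[abs_def])
qed

end

section \<open>Iterated directional derivatives\<close>

abbreviation nprod :: "'h::real_normed_vector list \<Rightarrow> real" where
  "nprod hs \<equiv> prod_list (map norm hs)"

lemma nprod_nonneg: "nprod hs \<ge> 0"
  by (induction hs) auto

lemma nprod_map_le:
  assumes "\<And>h. norm (f h) \<le> M * norm h" "M \<ge> 0"
  shows "nprod (map f hs) \<le> M ^ length hs * nprod hs"
proof (induction hs)
  case (Cons h hs)
  have "norm (f h) * nprod (map f hs) \<le> (M * norm h) * (M ^ length hs * nprod hs)"
    using assms nprod_nonneg[of "map f hs"] by (intro mult_mono Cons assms) auto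
  thus ?case by (simp add: mult_ac)
qed simp

text \<open>Only real derivatives of real functions occur, so that each one can be taken under an
  integral. The head of the list is the direction differentiated last, in agreement with
  \<open>D (h # hs)\<close> in \<open>has_H_derivative\<close>. The value is meaningful only under
  \<open>H_diff\<close>.\<close>

primrec hdd :: "('h \<Rightarrow> 'x::real_vector) \<Rightarrow> 'h list \<Rightarrow> ('x \<Rightarrow> real) \<Rightarrow> 'x \<Rightarrow> real" where
  "hdd \<iota> [] u = u"
| "hdd \<iota> (h # hs) u = (\<lambda>x. deriv (\<lambda>t. hdd \<iota> hs u (x + t *\<^sub>R \<iota> h)) 0)"

text \<open>Neither linearity in the directions nor any continuity is demanded; both are recovered
  later from a Hoelder bound at the top order.\<close>

definition H_diff :: "('h \<Rightarrow> 'x::real_vector) \<Rightarrow> nat \<Rightarrow> ('x \<Rightarrow> real) \<Rightarrow> bool" where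
  "H_diff \<iota> n u \<longleftrightarrow>
     (\<forall>hs h x. length hs < n \<longrightarrow> (\<lambda>t. hdd \<iota> hs u (x + t *\<^sub>R \<iota> h)) field_differentiable (at 0))"

definition H_bound ::
    "('h::real_normed_vector \<Rightarrow> 'x::real_vector) \<Rightarrow> nat \<Rightarrow> ('x \<Rightarrow> real) \<Rightarrow> real \<Rightarrow> bool" where
  "H_bound \<iota> k u B \<longleftrightarrow> (\<forall>hs x. length hs = k \<longrightarrow> \<bar>hdd \<iota> hs u x\<bar> \<le> B * nprod hs)"

lemma H_boundD: "H_bound \<iota> k u B \<Longrightarrow> length hs = k \<Longrightarrow> \<bar>hdd \<iota> hs u x\<bar> \<le> B * nprod hs"
  by (simp add: H_bound_def)

lemma H_bound_mono: "H_bound \<iota> k u B \<Longrightarrow> B \<le> B' \<Longrightarrow> H_bound \<iota> k u B'"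
  unfolding H_bound_def using mult_right_mono[OF _ nprod_nonneg, of B B'] by (blast intro: order_trans)

lemma H_diff_0: "H_diff \<iota> 0 u"
  by (simp add: H_diff_def)

lemma hdd_deriv:
  assumes "H_diff \<iota> n u" "length hs < n"
  shows "((\<lambda>t. hdd \<iota> hs u (x + t *\<^sub>R \<iota> h)) has_real_derivative hdd \<iota> (h # hs) u (x + s *\<^sub>R \<iota> h)) (at s)"
proof -
  have "((\<lambda>t. hdd \<iota> hs u (x + s *\<^sub>R \<iota> h + t *\<^sub>R \<iota> h)) has_real_derivative
          hdd \<iota> (h # hs) u (x + s *\<^sub>R \<iota> h)) (at 0)"
    using assms by (auto simp: H_diff_def field_differentiable_derivI)
  thus ?thesis
    using DERIV_shift[of "\<lambda>t. hdd \<iota> hs u (x + t *\<^sub>R \<iota> h)" _ 0 s]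
    by (simp add: algebra_simps)
qed

text \<open>Guess and verify: a family indexed by lists that starts at u and is closed under
  differentiation must be \<open>hdd\<close>. All computations of iterated derivatives below exhibit
  such a family.\<close>

lemma H_diffI:
  assumes D0: "D [] = u"
    and D: "\<And>hs h x. length hs < n \<Longrightarrow>
      ((\<lambda>t. D hs (x + t *\<^sub>R \<iota> h)) has_real_derivative D (h # hs) x) (at 0)"
  shows "H_diff \<iota> n u" and "length hs \<le> n \<Longrightarrow> hdd \<iota> hs u = D hs"
proof -
  show *: "hdd \<iota> hs u = D hs" if "length hs \<le> n" for hs
    using that
  proof (induction hs)
    case Nil
    show ?case using D0 by simp
  next
    case (Cons h hs)
    thus ?case using DERIV_imp_deriv[OF D, of hs] by simp
  qed
  show "H_diff \<iota> n u"
    using D * by (auto simp: H_diff_def field_differentiable_def)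
qed

lemma hdd_Lipschitz:
  assumes "H_diff \<iota> n u" "length hs < n" "\<And>x. \<bar>hdd \<iota> (h # hs) u x\<bar> \<le> c"
  shows "\<bar>hdd \<iota> hs u (x + t *\<^sub>R \<iota> h) - hdd \<iota> hs u x\<bar> \<le> c * \<bar>t\<bar>"
proof -
  have "norm (hdd \<iota> hs u (x + t *\<^sub>R \<iota> h) - hdd \<iota> hs u (x + 0 *\<^sub>R \<iota> h)) \<le> c * norm (t - 0)"
    by (rule field_differentiable_bound[of UNIV, OF _ hdd_deriv[OF assms(1,2)]])
      (use assms(3) in auto)
  thus ?thesis by simp
qed

lemma hdd_mean_value:
  assumes "H_diff \<iota> n u" "length hs < n" "t > 0"
  obtains r where "0 < r" "r < t"
    "hdd \<iota> hs u (x + t *\<^sub>R \<iota> h) - hdd \<iota> hs u x = t * hdd \<iota> (h # hs) u (x + r *\<^sub>R \<iota> h)"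
  using MVT2[of 0 t "\<lambda>t. hdd \<iota> hs u (x + t *\<^sub>R \<iota> h)", OF assms(3) hdd_deriv[OF assms(1,2)]]
  by auto

text \<open>A sequence of difference quotients, rather than a limit over all real t, makes
  derivatives measurable both in the point and in a parameter.\<close>

lemma hdd_as_limit:
  assumes "H_diff \<iota> n u" "length hs < n"
  shows "(\<lambda>j. real (Suc j) * (hdd \<iota> hs u (x + (1 / real (Suc j)) *\<^sub>R \<iota> h) - hdd \<iota> hs u x))
           \<longlonglongrightarrow> hdd \<iota> (h # hs) u x"
proof -
  have "((\<lambda>t. (hdd \<iota> hs u (x + t *\<^sub>R \<iota> h) - hdd \<iota> hs u x) / t) \<longlongrightarrow> hdd \<iota> (h # hs) u x) (at 0)"
    using hdd_deriv[OF assms, of x h 0] by (simp add: DERIV_def del: hdd.simps)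
  moreover have "filterlim (\<lambda>j. 1 / real (Suc j)) (at 0) sequentially"
    using LIMSEQ_inverse_real_of_nat
    by (auto simp: filterlim_at inverse_eq_divide)
  ultimately have "(\<lambda>j. (hdd \<iota> hs u (x + (1 / real (Suc j)) *\<^sub>R \<iota> h) - hdd \<iota> hs u x) / (1 / real (Suc j)))
      \<longlonglongrightarrow> hdd \<iota> (h # hs) u x"
    by (rule filterlim_compose)
  thus ?thesis by (simp add: mult.commute del: hdd.simps of_nat_Suc)
qed

lemma hdd_measurable:
  fixes \<iota> :: "'h \<Rightarrow> 'x::real_normed_vector"
  assumes "H_diff \<iota> n u" "u \<in> borel_measurable borel" "length hs \<le> n"
  shows "hdd \<iota> hs u \<in> borel_measurable borel"
  using assms(3)
proof (induction hs)
  case Nil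
  show ?case using assms by simp
next
  case (Cons h hs)
  hence meas: "hdd \<iota> hs u \<in> borel_measurable borel" by simp
  have tr: "(\<lambda>x. hdd \<iota> hs u (x + a)) \<in> borel_measurable borel" for a :: 'x
    by (rule measurable_compose[OF _ meas])
      (auto intro!: borel_measurable_continuous_onI continuous_intros)
  show ?case
    by (rule borel_measurable_LIMSEQ_real[OF hdd_as_limit[OF assms(1)]])
      (use Cons.prems meas tr in auto)
qed

lemma hdd_add:
  assumes "H_diff \<iota> n u" "H_diff \<iota> n w"
  shows "H_diff \<iota> n (\<lambda>x. u x + w x)"
    and "length hs \<le> n \<Longrightarrow> hdd \<iota> hs (\<lambda>x. u x + w x) = (\<lambda>x. hdd \<iota> hs u x + hdd \<iota> hs w x)"
proof -
  have D: "((\<lambda>t. hdd \<iota> hs u (x + t *\<^sub>R \<iota> h) + hdd \<iota> hs w (x + t *\<^sub>R \<iota> h)) has_real_derivative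
          hdd \<iota> (h # hs) u x + hdd \<iota> (h # hs) w x) (at 0)" if "length hs < n" for hs h x
    using DERIV_add[OF hdd_deriv[OF assms(1) that, of x h 0] hdd_deriv[OF assms(2) that, of x h 0]]
    by simp
  show "H_diff \<iota> n (\<lambda>x. u x + w x)"
    by (rule H_diffI(1)[of "\<lambda>hs x. hdd \<iota> hs u x + hdd \<iota> hs w x"]) (use D in auto)
  show "length hs \<le> n \<Longrightarrow> hdd \<iota> hs (\<lambda>x. u x + w x) = (\<lambda>x. hdd \<iota> hs u x + hdd \<iota> hs w x)"
    by (rule H_diffI(2)[of "\<lambda>hs x. hdd \<iota> hs u x + hdd \<iota> hs w x"]) (use D in auto)
qed

text \<open>By the mean value inequality the bound w on \<open>F'\<close> also dominates every
  difference quotient, so dominated convergence applies.\<close>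

lemma derivative_under_integral:
  fixes F F' :: "real \<Rightarrow> 'a \<Rightarrow> real"
  assumes deriv: "\<And>t y. y \<in> space N \<Longrightarrow> ((\<lambda>t. F t y) has_real_derivative F' t y) (at t)"
    and int: "\<And>t. integrable N (F t)"
    and bound: "\<And>t y. y \<in> space N \<Longrightarrow> \<bar>F' t y\<bar> \<le> w y" and w: "integrable N w"
    and meas: "F' 0 \<in> borel_measurable N"
  shows "((\<lambda>t. LINT y|N. F t y) has_real_derivative (LINT y|N. F' 0 y)) (at 0)"
  unfolding DERIV_def tendsto_at_iff_sequentially o_def
proof (intro allI impI)
  fix X :: "nat \<Rightarrow> real" assume X0: "\<forall>i. X i \<in> UNIV - {0}" and X: "X \<longlonglongrightarrow> 0"
  have eq: "((LINT y|N. F (0 + X i) y) - (LINT y|N. F 0 y)) / X i = (LINT y|N. (F (X i) y - F 0 y) / X i)" for i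
    using int by simp
  have "(\<lambda>i. LINT y|N. (F (X i) y - F 0 y) / X i) \<longlonglongrightarrow> (LINT y|N. F' 0 y)"
  proof (rule integral_dominated_convergence[where w = w])
    show "AE y in N. (\<lambda>i. (F (X i) y - F 0 y) / X i) \<longlonglongrightarrow> F' 0 y"
    proof (rule AE_I2)
      fix y assume "y \<in> space N"
      from deriv[OF this, of 0] show "(\<lambda>i. (F (X i) y - F 0 y) / X i) \<longlonglongrightarrow> F' 0 y"
        using X X0 unfolding DERIV_def tendsto_at_iff_sequentially o_def by simp
    qed
    show "AE y in N. norm ((F (X i) y - F 0 y) / X i) \<le> w y" for i
    proof (rule AE_I2)
      fix y assume y: "y \<in> space N"
      have "norm (F (X i) y - F 0 y) \<le> w y * norm (X i - 0)"
        by (rule field_differentiable_bound[of UNIV, OF _ deriv[OF y]]) (use bound[OF y] in auto)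
      thus "norm ((F (X i) y - F 0 y) / X i) \<le> w y"
        using X0 by (simp add: norm_divide divide_le_eq)
    qed
    show "(\<lambda>y. (F (X i) y - F 0 y) / X i) \<in> borel_measurable N" for i
      using borel_measurable_integrable[OF int] by simp
  qed (use w meas in auto)
  thus "(\<lambda>i. ((LINT y|N. F (0 + X i) y) - (LINT y|N. F 0 y)) / X i) \<longlonglongrightarrow> (LINT y|N. F' 0 y)"
    by (simp only: eq)
qed

section \<open>Smoothing by the Mehler semigroup\<close>

text \<open>The standing hypotheses on the bounded interval from 0 to T, with the exponential
  factors absorbed into M and K. \<open>V t\<close> is \<open>S t\<close> read as a map of H; M
  \<ge> 1 makes powers of M monotone in the exponent.\<close>

locale mehler_H =
  fixes S :: "real \<Rightarrow> 'x::{banach, second_countable_topology} \<Rightarrow>\<^sub>L 'x"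
    and \<mu> :: "real \<Rightarrow> 'x measure"
    and \<iota> :: "'h::banach \<Rightarrow> 'x"
    and V :: "real \<Rightarrow> 'h \<Rightarrow> 'h"
    and M K \<theta> T :: real
  assumes semigroup: "C0_semigroup S"
    and measures: "mehler_measures S \<mu>"
    and embedding: "bounded_linear \<iota>"
    and M: "M \<ge> 1" and K: "K > 0" and \<theta>: "\<theta> > 0" and T: "T > 0"
    and S_V: "\<And>t h. 0 \<le> t \<Longrightarrow> t \<le> T \<Longrightarrow> S t (\<iota> h) = \<iota> (V t h)"
    and norm_V: "\<And>t h. 0 \<le> t \<Longrightarrow> t \<le> T \<Longrightarrow> norm (V t h) \<le> M * norm h"
    and density: "\<And>t h. 0 < t \<Longrightarrow> t \<le> T \<Longrightarrow>
          \<exists>\<beta>. fomin_density (\<mu> t) (S t (\<iota> h)) \<beta> \<and>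
              (LINT x|\<mu> t. \<bar>\<beta> x\<bar>) \<le> K * t powr (- \<theta>) * norm h"
begin

abbreviation P :: "real \<Rightarrow> ('x \<Rightarrow> real) \<Rightarrow> 'x \<Rightarrow> real" where
  "P \<equiv> mehler S \<mu>"

lemma prob: "t \<ge> 0 \<Longrightarrow> prob_space (\<mu> t)"
  and sets_\<mu>: "t \<ge> 0 \<Longrightarrow> sets (\<mu> t) = sets borel"
  using measures unfolding mehler_measures_def by blast+

lemma weak: "f \<in> bcontfun \<Longrightarrow> continuous_on {0..} (\<lambda>t. LINT x|\<mu> t. (f x :: real))"
  using measures unfolding mehler_measures_def by blast

lemma \<mu>_add: "t > 0 \<Longrightarrow> s > 0 \<Longrightarrow>
    \<mu> (t + s) = distr (distr (\<mu> t) borel (S s) \<Otimes>\<^sub>M \<mu> s) borel (\<lambda>(x, y). x + y)"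
  using measures unfolding mehler_measures_def by blast

lemma S_add: "t \<ge> 0 \<Longrightarrow> s \<ge> 0 \<Longrightarrow> S (t + s) = S t o\<^sub>L S s"
  using semigroup unfolding C0_semigroup_def by auto

lemma borel_imp_measurable_\<mu>:
  "t \<ge> 0 \<Longrightarrow> f \<in> borel_measurable borel \<Longrightarrow> f \<in> borel_measurable (\<mu> t)"
  using sets_\<mu> by (simp cong: measurable_cong_sets)

lemma measurable_translate_left:
  fixes \<phi> :: "'x \<Rightarrow> real"
  shows "\<phi> \<in> borel_measurable borel \<Longrightarrow> (\<lambda>y. \<phi> (a + y)) \<in> borel_measurable borel"
  by (rule measurable_compose[of "\<lambda>y. a + y" borel borel]) auto

lemma measurable_translate_right:
  fixes \<phi> :: "'x \<Rightarrow> real"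
  shows "\<phi> \<in> borel_measurable borel \<Longrightarrow> (\<lambda>y. \<phi> (y + a)) \<in> borel_measurable borel"
  by (rule measurable_compose[of "\<lambda>y. y + a" borel borel]) auto

lemma integrable_translate:
  fixes \<phi> :: "'x \<Rightarrow> real"
  assumes "t \<ge> 0" "\<phi> \<in> borel_measurable borel" "\<And>x. \<bar>\<phi> x\<bar> \<le> B"
  shows "integrable (\<mu> t) (\<lambda>y. \<phi> (a + y))"
  by (rule bounded_measurable_integrable[OF prob[OF assms(1)] sets_\<mu>[OF assms(1)]
        measurable_translate_left[OF assms(2)] assms(3)])

lemma S_measurable: "blinfun_apply (S t) \<in> borel_measurable borel"
  by (intro borel_measurable_continuous_onI continuous_intros)

lemma P_measurable:
  assumes "t \<ge> 0" "\<phi> \<in> borel_measurable borel"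
  shows "P t \<phi> \<in> borel_measurable borel"
proof -
  interpret prob_space "\<mu> t" by (rule prob) fact
  note sets_\<mu>[OF assms(1), measurable_cong] S_measurable[measurable] assms(2)[measurable]
  have "(\<lambda>(x, y). \<phi> (S t x + y)) \<in> borel_measurable (borel \<Otimes>\<^sub>M \<mu> t)"
    by measurable
  hence "(\<lambda>x. LINT y|\<mu> t. \<phi> (S t x + y)) \<in> borel_measurable borel"
    by (rule borel_measurable_lebesgue_integral)
  thus ?thesis by (simp add: mehler_def[abs_def])
qed

lemma P_le:
  assumes "t \<ge> 0" "\<phi> \<in> borel_measurable borel" "\<And>x. \<bar>\<phi> x\<bar> \<le> B"
  shows "\<bar>P t \<phi> x\<bar> \<le> B"
proof -
  interpret prob_space "\<mu> t" by (rule prob) fact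
  note int = integrable_translate[OF assms, of "S t x"]
  have "\<bar>P t \<phi> x\<bar> \<le> (LINT y|\<mu> t. \<bar>\<phi> (S t x + y)\<bar>)"
    unfolding mehler_def by (rule integral_abs_bound)
  also have "\<dots> \<le> (LINT y|\<mu> t. B)"
    using int assms(3) by (intro integral_mono integrable_abs) auto
  finally show ?thesis by (simp add: prob_space)
qed

lemma P_diff:
  assumes "t \<ge> 0" "\<phi> \<in> borel_measurable borel" "\<And>x. \<bar>\<phi> x\<bar> \<le> B"
    "\<psi> \<in> borel_measurable borel" "\<And>x. \<bar>\<psi> x\<bar> \<le> B'"
  shows "P t \<phi> x - P t \<psi> x = P t (\<lambda>x. \<phi> x - \<psi> x) x"
  unfolding mehler_def using integrable_translate[OF assms(1-3)] integrable_translate[OF assms(1,4,5)]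
  by simp

text \<open>A shift of the point along h is a shift of the integrand along \<open>V t h\<close>:
  this is how regularity along H passes through \<open>P t\<close>.\<close>

lemma P_shift:
  assumes "0 \<le> t" "t \<le> T"
  shows "P t \<phi> (x + r *\<^sub>R \<iota> h) = (LINT y|\<mu> t. \<phi> (S t x + y + r *\<^sub>R \<iota> (V t h)))"
  unfolding mehler_def using S_V[OF assms]
  by (simp add: blinfun.add_right blinfun.scaleR_right add_ac)

lemma P_shift_eq:
  assumes "0 \<le> t" "t \<le> T"
  shows "P t \<phi> (x + \<iota> h) = P t (\<lambda>z. \<phi> (z + \<iota> (V t h))) x"
  using P_shift[OF assms, of \<phi> x 1 h] by (simp add: mehler_def)

text \<open>The convolution identity decomposes the noise of time t + s into the image under
  \<open>S s\<close> of the noise of time t and an independent part of time s; Fubini separates the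
  two.\<close>

lemma P_semigroup:
  assumes t: "t > 0" and s: "s > 0"
    and \<phi>: "\<phi> \<in> borel_measurable borel" "\<And>x. \<bar>\<phi> x\<bar> \<le> B"
  shows "P (t + s) \<phi> x = P t (P s \<phi>) x"
proof -
  interpret t: prob_space "\<mu> t" using prob t by simp
  interpret s: prob_space "\<mu> s" using prob s by simp
  define N where "N = distr (\<mu> t) borel (S s)"
  have St: "blinfun_apply (S s) \<in> measurable (\<mu> t) borel"
    using S_measurable sets_\<mu>[of t] t by (simp cong: measurable_cong_sets)
  interpret N: prob_space N
    unfolding N_def by (rule t.prob_space_distr[OF St])
  interpret Ns: pair_prob_space N "\<mu> s" ..
  have [measurable_cong]: "sets N = sets borel" "sets (\<mu> s) = sets borel"
    using sets_\<mu>[of s] s by (auto simp: N_def)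
  note \<phi>(1)[measurable]
  have meas1: "(\<lambda>(a, b). a + b) \<in> measurable (N \<Otimes>\<^sub>M \<mu> s) (borel :: 'x measure)"
    by measurable
  have meas2: "(\<lambda>(a, b). \<phi> (S (t + s) x + (a + b))) \<in> borel_measurable (N \<Otimes>\<^sub>M \<mu> s)"
    by measurable
  have int: "integrable (N \<Otimes>\<^sub>M \<mu> s) (\<lambda>(a, b). \<phi> (S (t + s) x + (a + b)))"
    using meas2 \<phi>(2) by (intro Ns.P.integrable_const_bound[where B = B]) auto
  have "P (t + s) \<phi> x = (LINT z|(distr (N \<Otimes>\<^sub>M \<mu> s) borel (\<lambda>(a, b). a + b)). \<phi> (S (t + s) x + z))"
    using \<mu>_add[OF t s] by (simp add: mehler_def N_def)
  also have "\<dots> = (LINT p|(N \<Otimes>\<^sub>M \<mu> s). \<phi> (S (t + s) x + (case p of (a, b) \<Rightarrow> a + b)))"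
    by (rule integral_distr[OF meas1 measurable_translate_left[OF \<phi>(1)]])
  also have "\<dots> = (LINT p|(N \<Otimes>\<^sub>M \<mu> s). (case p of (a, b) \<Rightarrow> \<phi> (S (t + s) x + (a + b))))"
    by (simp add: case_prod_unfold)
  also have "\<dots> = (LINT a|N. LINT b|\<mu> s. \<phi> (S (t + s) x + (a + b)))"
    using Ns.integral_fst'[OF int] by simp
  also have "\<dots> = (LINT y|\<mu> t. LINT b|\<mu> s. \<phi> (S (t + s) x + (S s y + b)))"
    unfolding N_def
  proof (rule integral_distr[OF St])
    show "(\<lambda>a. LINT b|\<mu> s. \<phi> (S (t + s) x + (a + b))) \<in> borel_measurable borel"
      by (rule s.borel_measurable_lebesgue_integral) measurable
  qed
  also have "\<dots> = P t (P s \<phi>) x"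
    \<comment> \<open>\<open>S (t + s)\<close> factors with \<open>S s\<close> on the outside, so
      the argument of \<phi> becomes \<open>S s (S t x + y) + b\<close>.\<close>
    unfolding mehler_def using S_add[of s t] t s
    by (simp add: blinfun.add_right add_ac)
  finally show ?thesis .
qed

lemma P_half:
  assumes "t > 0" "\<phi> \<in> borel_measurable borel" "\<And>x. \<bar>\<phi> x\<bar> \<le> B"
  shows "P t \<phi> = P (t / 2) (P (t / 2) \<phi>)"
  using P_semigroup[OF _ _ assms(2,3), of "t / 2" "t / 2"] assms(1) by (simp add: fun_eq_iff)

text \<open>Here the derivatives fall on u, not on the measure: by \<open>P_shift\<close> each
  direction is transported by \<open>V t\<close>, and the bounds on u allow differentiation under
  the integral. No singularity in t arises.\<close>

lemma P_hdd:
  assumes t: "0 \<le> t" "t \<le> T" and u: "u \<in> borel_measurable borel" "H_diff \<iota> n u"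
    and bd: "\<And>k. k \<le> n \<Longrightarrow> H_bound \<iota> k u (C k)"
  shows "H_diff \<iota> n (P t u)"
    and "length hs \<le> n \<Longrightarrow> hdd \<iota> hs (P t u) = P t (hdd \<iota> (map (V t) hs) u)"
proof -
  define D where "D hs = P t (hdd \<iota> (map (V t) hs) u)" for hs
  have D: "((\<lambda>r. D hs (x + r *\<^sub>R \<iota> h)) has_real_derivative D (h # hs) x) (at 0)"
    if "length hs < n" for hs h x
  proof -
    define ks where "ks = map (V t) hs"
    have ks: "length ks < n" using that by (simp add: ks_def)
    define c where "c = C (Suc (length ks)) * nprod (V t h # ks)"
    have meas: "hdd \<iota> hs' u \<in> borel_measurable borel" if "length hs' \<le> n" for hs'
      by (rule hdd_measurable[OF u(2,1) that])
    have bd1: "\<bar>hdd \<iota> ks u x\<bar> \<le> C (length ks) * nprod ks" for x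
      using H_boundD[OF bd, of "length ks" ks] ks by simp
    have bd2: "\<bar>hdd \<iota> (V t h # ks) u x\<bar> \<le> c" for x
      using H_boundD[OF bd, of "Suc (length ks)" "V t h # ks"] ks by (simp add: c_def)
    have "((\<lambda>r. LINT y|\<mu> t. hdd \<iota> ks u (S t x + y + r *\<^sub>R \<iota> (V t h))) has_real_derivative
            (LINT y|\<mu> t. hdd \<iota> (V t h # ks) u (S t x + y + 0 *\<^sub>R \<iota> (V t h)))) (at 0)"
    proof (rule derivative_under_integral[where w = "\<lambda>_. c"])
      show "integrable (\<mu> t) (\<lambda>y. hdd \<iota> ks u (S t x + y + r *\<^sub>R \<iota> (V t h)))" for r
        using integrable_translate[OF t(1) meas bd1, of "S t x + r *\<^sub>R \<iota> (V t h)"] ks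
        by (simp add: add_ac)
      show "(\<lambda>y. hdd \<iota> (V t h # ks) u (S t x + y + 0 *\<^sub>R \<iota> (V t h))) \<in> borel_measurable (\<mu> t)"
        using measurable_translate_left[OF meas[of "V t h # ks"], of "S t x"] ks
        by (intro borel_imp_measurable_\<mu>[OF t(1)]) simp
      show "integrable (\<mu> t) (\<lambda>_. c)"
      proof -
        interpret prob_space "\<mu> t" by (rule prob[OF t(1)])
        show ?thesis by simp
      qed
    qed (use hdd_deriv[OF u(2) ks] bd2 in auto)
    moreover have "D hs (x + r *\<^sub>R \<iota> h) = (LINT y|\<mu> t. hdd \<iota> ks u (S t x + y + r *\<^sub>R \<iota> (V t h)))" for r
      by (simp only: D_def P_shift[OF t] ks_def)
    moreover have "D (h # hs) x = (LINT y|\<mu> t. hdd \<iota> (V t h # ks) u (S t x + y + 0 *\<^sub>R \<iota> (V t h)))"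
      by (simp add: D_def ks_def mehler_def del: hdd.simps)
    ultimately show ?thesis by (simp only:)
  qed
  have D0: "D [] = P t u" by (simp add: D_def)
  show "H_diff \<iota> n (P t u)" by (rule H_diffI(1)[of D, OF D0 D])
  show "length hs \<le> n \<Longrightarrow> hdd \<iota> hs (P t u) = P t (hdd \<iota> (map (V t) hs) u)"
    using H_diffI(2)[of D, OF D0 D] by (simp add: D_def)
qed

text \<open>Here the derivative falls on the measure: a shift of the point along h shifts
  \<open>\<mu> t\<close> along \<open>S t (\<iota> h)\<close>, a Fomin direction, so \<phi> may be
  any bounded Borel function. The price is the singular factor in t.\<close>

lemma P_smoothing:
  assumes t: "0 < t" "t \<le> T" and \<phi>: "\<phi> \<in> borel_measurable borel" "\<And>x. \<bar>\<phi> x\<bar> \<le> B"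
  obtains d where "((\<lambda>r. P t \<phi> (x + r *\<^sub>R \<iota> h)) has_real_derivative d) (at 0)"
    "\<bar>d\<bar> \<le> K * t powr (- \<theta>) * B * norm h"
proof -
  obtain \<beta> where \<beta>: "fomin_density (\<mu> t) (S t (\<iota> h)) \<beta>"
    "(LINT x|\<mu> t. \<bar>\<beta> x\<bar>) \<le> K * t powr (- \<theta>) * norm h"
    using density[OF t] by blast
  interpret fomin "\<mu> t" "S t (\<iota> h)" \<beta>
    by (rule fomin.intro[OF prob sets_\<mu> \<beta>(1)]) (use t in simp_all)
  let ?\<phi> = "\<lambda>y. \<phi> (S t x + y)"
  have meas: "?\<phi> \<in> borel_measurable borel"
    by (rule measurable_translate_left[OF \<phi>(1)])
  show ?thesis
  proof (rule that)
    show "((\<lambda>r. P t \<phi> (x + r *\<^sub>R \<iota> h)) has_real_derivative - (LINT y|\<mu> t. ?\<phi> y * \<beta> y)) (at 0)"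
    proof -
      have "P t \<phi> (x + r *\<^sub>R \<iota> h) = (LINT y|\<mu> t. ?\<phi> (y + r *\<^sub>R S t (\<iota> h)))" for r
        using P_shift[of t \<phi> x r h] S_V[of t h] t by (simp only: add.assoc less_imp_le)
      thus ?thesis
        by (simp only: derivative_bounded_measurable[OF meas \<phi>(2)])
    qed
    have "\<bar>- (LINT y|\<mu> t. ?\<phi> y * \<beta> y)\<bar> \<le> B * (LINT y|\<mu> t. \<bar>\<beta> y\<bar>)"
      using integral_mult_density_le[OF meas \<phi>(2)] by simp
    also have "\<dots> \<le> B * (K * t powr (- \<theta>) * norm h)"
    proof (rule mult_left_mono[OF \<beta>(2)])
      show "B \<ge> 0" using \<phi>(2)[of undefined] by linarith
    qed
    finally show "\<bar>- (LINT y|\<mu> t. ?\<phi> y * \<beta> y)\<bar> \<le> K * t powr (- \<theta>) * B * norm h"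
      by (simp add: mult_ac)
  qed
qed

lemma nprod_V_le:
  assumes "0 \<le> t" "t \<le> T"
  shows "nprod (map (V t) hs) \<le> M ^ length hs * nprod hs"
  by (rule nprod_map_le[OF norm_V[OF assms]]) (use M in simp)

text \<open>One order is gained by letting the derivatives along hs fall on u through
  \<open>P_hdd\<close> and the last one on the measure through \<open>P_smoothing\<close>;
  \<open>M ^ k\<close> comes from transporting the k directions.\<close>

lemma P_H_bound_Suc:
  assumes t: "0 < t" "t \<le> T" and u: "u \<in> borel_measurable borel" "H_diff \<iota> n u"
    and bd: "\<And>k. k \<le> n \<Longrightarrow> H_bound \<iota> k u (C k)"
  shows "H_diff \<iota> (Suc n) (P t u)"
    and "k \<le> n \<Longrightarrow> H_bound \<iota> k u c \<Longrightarrow> H_bound \<iota> (Suc k) (P t u) (K * t powr (- \<theta>) * M ^ k * c)"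
proof -
  have t': "0 \<le> t" using t by simp
  have *: "\<exists>d. ((\<lambda>r. hdd \<iota> hs (P t u) (x + r *\<^sub>R \<iota> h)) has_real_derivative d) (at 0) \<and>
              \<bar>d\<bar> \<le> K * t powr (- \<theta>) * (M ^ length hs * c * nprod hs) * norm h"
    if "length hs \<le> n" "H_bound \<iota> (length hs) u c" for hs x h c
  proof -
    define ks where "ks = map (V t) hs"
    have ks: "length ks = length hs" by (simp add: ks_def)
    have eq: "hdd \<iota> hs (P t u) = P t (hdd \<iota> ks u)"
      using P_hdd(2)[OF t' t(2) u bd that(1)] by (simp add: ks_def)
    have "hdd \<iota> ks u \<in> borel_measurable borel"
      using hdd_measurable[OF u(2,1)] that ks by simp
    moreover have "\<bar>hdd \<iota> ks u x\<bar> \<le> M ^ length hs * \<bar>c\<bar> * nprod hs" for x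
    proof -
      have "\<bar>hdd \<iota> ks u x\<bar> \<le> c * nprod ks" using that(2) ks by (simp add: H_bound_def)
      also have "\<dots> \<le> \<bar>c\<bar> * nprod ks"
        by (intro mult_right_mono) (auto simp: nprod_nonneg)
      also have "\<dots> \<le> \<bar>c\<bar> * (M ^ length hs * nprod hs)"
        using nprod_V_le[OF t' t(2), of hs] by (intro mult_left_mono) (auto simp: ks_def)
      finally show ?thesis by (simp add: mult_ac)
    qed
    ultimately obtain d where d: "((\<lambda>r. hdd \<iota> hs (P t u) (x + r *\<^sub>R \<iota> h)) has_real_derivative d) (at 0)"
      "\<bar>d\<bar> \<le> K * t powr (- \<theta>) * (M ^ length hs * \<bar>c\<bar> * nprod hs) * norm h"
      using P_smoothing[OF t] unfolding eq by metis
    \<comment> \<open>\<open>H_bound\<close> with a negative constant is possible only when every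
      product of norms vanishes, so the absolute value can be removed after multiplication.\<close>
    have "\<bar>c\<bar> * nprod hs = c * nprod hs"
    proof (cases "nprod hs = 0")
      case False
      have "0 \<le> c * nprod hs"
        using that(2) abs_ge_zero order_trans unfolding H_bound_def by blast
      hence "c \<ge> 0"
        using False nprod_nonneg[of hs] by (simp add: zero_le_mult_iff)
      thus ?thesis by simp
    qed simp
    thus ?thesis using d by (auto simp: mult.assoc)
  qed
  show diff: "H_diff \<iota> (Suc n) (P t u)"
    unfolding H_diff_def field_differentiable_def using * bd by (meson less_Suc_eq_le)
  assume k: "k \<le> n" "H_bound \<iota> k u c"
  show "H_bound \<iota> (Suc k) (P t u) (K * t powr (- \<theta>) * M ^ k * c)"
    unfolding H_bound_def
  proof (intro allI impI)
    fix hs' :: "'h list" and x assume "length hs' = Suc k"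
    then obtain h hs where hs: "hs' = h # hs" "length hs = k"
      by (auto simp: length_Suc_conv)
    obtain d where d: "((\<lambda>r. hdd \<iota> hs (P t u) (x + r *\<^sub>R \<iota> h)) has_real_derivative d) (at 0)"
        "\<bar>d\<bar> \<le> K * t powr (- \<theta>) * (M ^ length hs * c * nprod hs) * norm h"
      using *[of hs c x h] k hs by auto
    have "d = hdd \<iota> hs' (P t u) x"
      using DERIV_imp_deriv[OF d(1)] by (simp add: hs)
    thus "\<bar>hdd \<iota> hs' (P t u) x\<bar> \<le> K * t powr (- \<theta>) * M ^ k * c * nprod hs'"
      using d(2) hs by (simp add: mult_ac)
  qed
qed

text \<open>A purely qualitative statement: each halving of the time gains one order, and the
  constants are left untracked. It supplies the finite bounds that differentiation under the
  integral requires as input.\<close>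

lemma P_smooth:
  assumes \<phi>: "\<phi> \<in> borel_measurable borel" "\<And>x. \<bar>\<phi> x\<bar> \<le> B"
    and t: "0 < t" "t \<le> T"
  shows "H_diff \<iota> n (P t \<phi>) \<and> (\<forall>k\<le>n. \<exists>C. H_bound \<iota> k (P t \<phi>) C)"
  using t
proof (induction n arbitrary: t)
  case 0
  have "H_bound \<iota> 0 (P t \<phi>) B"
    using P_le[OF _ \<phi>, of t] 0 by (auto simp: H_bound_def)
  thus ?case by (auto simp: H_diff_0)
next
  case (Suc n)
  let ?w = "P (t / 2) \<phi>"
  have t2: "0 < t / 2" "t / 2 \<le> T" using Suc.prems by auto
  from Suc.IH[OF t2] obtain C where w: "H_diff \<iota> n ?w" "\<And>k. k \<le> n \<Longrightarrow> H_bound \<iota> k ?w (C k)"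
    by metis
  have meas: "?w \<in> borel_measurable borel" using t2 by (intro P_measurable \<phi>) auto
  have eq: "P t \<phi> = P (t / 2) ?w" using P_half[OF _ \<phi>] Suc.prems by blast
  have "\<exists>C. H_bound \<iota> k (P t \<phi>) C" if "k \<le> Suc n" for k
  proof (cases k)
    case 0
    have "H_bound \<iota> 0 (P t \<phi>) B"
      using P_le[OF _ \<phi>, of t] Suc.prems by (auto simp: H_bound_def)
    thus ?thesis using 0 by auto
  next
    case (Suc j)
    thus ?thesis using P_H_bound_Suc(2)[OF t2 meas w, of j "C j"] w that by (auto simp: eq)
  qed
  moreover have "H_diff \<iota> (Suc n) (P t \<phi>)"
    unfolding eq by (rule P_H_bound_Suc(1)[OF t2 meas w])
  ultimately show ?case by blast
qed

lemma P_H_diff: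
  assumes "\<phi> \<in> borel_measurable borel" "\<And>x. \<bar>\<phi> x\<bar> \<le> B" "0 < t" "t \<le> T"
  shows "H_diff \<iota> n (P t \<phi>)"
  using P_smooth[OF assms] by blast

text \<open>The quantitative recursion: \<open>P_smooth\<close> takes care of the side conditions,
  so that only the bound of order k at time t / 2 enters the constant.\<close>

lemma P_H_bound_half:
  assumes \<phi>: "\<phi> \<in> borel_measurable borel" "\<And>x. \<bar>\<phi> x\<bar> \<le> B" and t: "0 < t" "t \<le> T"
    and bd: "H_bound \<iota> k (P (t / 2) \<phi>) c"
  shows "H_bound \<iota> (Suc k) (P t \<phi>) (K * (t / 2) powr (- \<theta>) * M ^ k * c)"
proof -
  let ?w = "P (t / 2) \<phi>"
  have t2: "0 < t / 2" "t / 2 \<le> T" using t by auto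
  from P_smooth[OF \<phi> t2, of k] obtain C where w: "H_diff \<iota> k ?w" "\<And>j. j \<le> k \<Longrightarrow> H_bound \<iota> j ?w (C j)"
    by metis
  have meas: "?w \<in> borel_measurable borel" using t2 by (intro P_measurable \<phi>) auto
  have eq: "P t \<phi> = P (t / 2) ?w" using P_half[OF _ \<phi>] t by blast
  show ?thesis unfolding eq by (rule P_H_bound_Suc(2)[OF t2 meas w]) (use bd in auto)
qed

end

section \<open>Derivative bounds for functions that are Hoelder along H\<close>

context mehler_H
begin

text \<open>One constant bounds the sup norm and the seminorm. For \<alpha> = 0 the condition covers
  bounded functions, with G twice the sup norm; at h = 0 it is consistent with
  \<open>0 powr 0 = 0\<close> because the increment vanishes.\<close>

definition Hol :: "real \<Rightarrow> ('x \<Rightarrow> real) \<Rightarrow> real \<Rightarrow> bool" where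
  "Hol \<alpha> \<phi> G \<longleftrightarrow> \<phi> \<in> borel_measurable borel \<and> (\<forall>x. \<bar>\<phi> x\<bar> \<le> G) \<and>
     (\<forall>x h. \<bar>\<phi> (x + \<iota> h) - \<phi> x\<bar> \<le> G * norm h powr \<alpha>)"

lemma HolD:
  assumes "Hol \<alpha> \<phi> G"
  shows "\<phi> \<in> borel_measurable borel" "\<bar>\<phi> x\<bar> \<le> G" "\<bar>\<phi> (x + \<iota> h) - \<phi> x\<bar> \<le> G * norm h powr \<alpha>" "G \<ge> 0"
proof -
  show "\<bar>\<phi> x\<bar> \<le> G" for x using assms by (simp add: Hol_def)
  from this[of undefined] show "G \<ge> 0" by linarith
qed (use assms in \<open>simp_all add: Hol_def\<close>)

lemma norm_V_powr_le:
  assumes "0 \<le> \<alpha>" "\<alpha> \<le> 1" "0 \<le> t" "t \<le> T"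
  shows "norm (V t h) powr \<alpha> \<le> M * norm h powr \<alpha>"
proof -
  have "norm (V t h) powr \<alpha> \<le> (M * norm h) powr \<alpha>"
    using assms by (intro powr_mono2 norm_V) auto
  also have "\<dots> = M powr \<alpha> * norm h powr \<alpha>"
    using M by (simp add: powr_mult)
  also have "\<dots> \<le> M powr 1 * norm h powr \<alpha>"
    using M assms by (intro mult_right_mono powr_mono) auto
  finally show ?thesis using M by simp
qed

lemma P_Holder:
  assumes \<alpha>: "0 \<le> \<alpha>" "\<alpha> \<le> 1" and \<phi>: "Hol \<alpha> \<phi> G" and t: "0 \<le> t" "t \<le> T"
  shows "\<bar>P t \<phi> (x + \<iota> h) - P t \<phi> x\<bar> \<le> G * M * norm h powr \<alpha>"
proof -
  have meas: "(\<lambda>z. \<phi> (z + \<iota> (V t h))) \<in> borel_measurable borel"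
    by (rule measurable_translate_right[OF HolD(1)[OF \<phi>]])
  have "P t \<phi> (x + \<iota> h) - P t \<phi> x = P t (\<lambda>z. \<phi> (z + \<iota> (V t h)) - \<phi> z) x"
    unfolding P_shift_eq[OF t]
    by (rule P_diff[OF t(1) meas HolD(2)[OF \<phi>] HolD(1)[OF \<phi>] HolD(2)[OF \<phi>]])
  also have "\<bar>\<dots>\<bar> \<le> G * norm (V t h) powr \<alpha>"
    by (rule P_le[OF t(1)]) (use meas HolD(1,3)[OF \<phi>] in auto)
  also have "\<dots> \<le> G * (M * norm h powr \<alpha>)"
    by (intro mult_left_mono norm_V_powr_le \<alpha> t HolD(4)[OF \<phi>])
  finally show ?thesis by (simp add: mult.assoc)
qed

text \<open>The mean value theorem finds the gradient at an intermediate point as a quotient of a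
  Hoelder increment. Moving back to x costs the second derivative, which
  \<open>P_H_bound_half\<close> expresses through the gradient at time t / 2.\<close>

lemma P_interpolation:
  assumes \<alpha>: "0 \<le> \<alpha>" "\<alpha> < 1" and \<phi>: "Hol \<alpha> \<phi> G" and t: "0 < t" "t \<le> T"
    and \<delta>: "\<delta> > 0" and bd: "H_bound \<iota> 1 (P (t / 2) \<phi>) c"
  shows "H_bound \<iota> 1 (P t \<phi>)
           (G * M * \<delta> powr (\<alpha> - 1) * t powr (- ((1 - \<alpha>) * \<theta>)) + \<delta> * (K * 2 powr \<theta> * M) * c)"
  unfolding H_bound_def
proof (intro allI impI)
  fix hs :: "'h list" and x assume "length hs = 1"
  then obtain h where hs: "hs = [h]" by (cases hs) auto
  define u where "u = P t \<phi>"
  note diff = P_H_diff[OF HolD(1,2)[OF \<phi>] t, of 2, folded u_def]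
  have bd2: "H_bound \<iota> 2 u (K * (t / 2) powr (- \<theta>) * M * c)"
    using P_H_bound_half[OF HolD(1,2)[OF \<phi>] t bd] by (simp add: u_def numeral_2_eq_2)
  let ?d = "\<lambda>y. hdd \<iota> [h] u y"
  define c' where "c' = K * (t / 2) powr (- \<theta>) * M * c"
  have "\<bar>?d x\<bar> \<le> (G * M * \<delta> powr (\<alpha> - 1) * t powr (- ((1 - \<alpha>) * \<theta>)) + \<delta> * (K * 2 powr \<theta> * M) * c) * norm h"
  proof (cases "h = 0")
    case True
    have "\<iota> 0 = 0" using embedding by (rule linear_0[OF bounded_linear.linear])
    hence "?d x = 0" using True by simp
    thus ?thesis using True by simp
  next
    case False
    \<comment> \<open>The increment e h has length \<delta> t^\<theta>; the factor t^\<theta>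
      cancels the singularity (t / 2)^(-\<theta>) of the second derivative and leaves
      2^\<theta>.\<close>
    define e where "e = \<delta> * t powr \<theta> / norm h"
    have e: "e > 0" using False \<delta> t by (simp add: e_def)
    obtain r where r: "0 < r" "r < e" "u (x + e *\<^sub>R \<iota> h) - u x = e * ?d (x + r *\<^sub>R \<iota> h)"
      using hdd_mean_value[OF diff _ e, where hs = "[]" and x = x and h = h] by auto
    have "\<bar>?d (x + r *\<^sub>R \<iota> h) - ?d x\<bar> \<le> c' * (norm h * norm h) * \<bar>r\<bar>"
    proof (rule hdd_Lipschitz[OF diff])
      show "\<bar>hdd \<iota> [h, h] u y\<bar> \<le> c' * (norm h * norm h)" for y
        using H_boundD[OF bd2, of "[h, h]" y] by (simp add: c'_def)
    qed auto
    also have "\<dots> \<le> c' * (norm h * norm h) * e"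
    proof (rule mult_left_mono)
      show "c' * (norm h * norm h) \<ge> 0"
        using H_boundD[OF bd2, of "[h, h]" x] by (simp add: c'_def)
    qed (use r in auto)
    finally have 1: "\<bar>?d x\<bar> \<le> \<bar>?d (x + r *\<^sub>R \<iota> h)\<bar> + c' * (norm h * norm h) * e"
      by linarith
    have lin: "e *\<^sub>R \<iota> h = \<iota> (e *\<^sub>R h)"
      using embedding by (simp add: linear_scale[OF bounded_linear.linear])
    have "e * \<bar>?d (x + r *\<^sub>R \<iota> h)\<bar> = \<bar>u (x + \<iota> (e *\<^sub>R h)) - u x\<bar>"
      using r(3) e by (simp add: lin abs_mult)
    also have "\<dots> \<le> G * M * norm (e *\<^sub>R h) powr \<alpha>"
      unfolding u_def using \<alpha> t by (intro P_Holder \<phi>) auto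
    also have "norm (e *\<^sub>R h) = \<delta> * t powr \<theta>"
      using False e \<delta> t by (simp add: e_def)
    finally have "\<bar>?d (x + r *\<^sub>R \<iota> h)\<bar> \<le> G * M * (\<delta> * t powr \<theta>) powr \<alpha> / e"
      using e by (simp add: pos_le_divide_eq mult.commute)
    also have "\<dots> = G * M * (\<delta> * t powr \<theta>) powr \<alpha> * (\<delta> * t powr \<theta>) powr (-1) * norm h"
      using \<delta> t by (simp add: e_def powr_minus divide_simps)
    also have "\<dots> = G * M * (\<delta> * t powr \<theta>) powr (\<alpha> - 1) * norm h"
      using \<delta> t by (simp add: powr_diff)
    also have "(\<delta> * t powr \<theta>) powr (\<alpha> - 1) = \<delta> powr (\<alpha> - 1) * t powr (- ((1 - \<alpha>) * \<theta>))"
      using \<delta> t by (simp add: powr_mult powr_powr algebra_simps)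
    finally have 2: "\<bar>?d (x + r *\<^sub>R \<iota> h)\<bar> \<le> G * M * \<delta> powr (\<alpha> - 1) * t powr (- ((1 - \<alpha>) * \<theta>)) * norm h"
      by (simp add: mult.assoc)
    have "(t / 2) powr (- \<theta>) * t powr \<theta> = 2 powr \<theta>"
      using t by (simp add: powr_divide powr_minus field_simps)
    hence 3: "c' * (norm h * norm h) * e = \<delta> * (K * 2 powr \<theta> * M) * c * norm h"
      using False by (simp add: c'_def e_def mult_ac)
    show ?thesis using 1 2 unfolding 3 distrib_right by linarith
  qed
  thus "\<bar>hdd \<iota> hs (P t \<phi>) x\<bar> \<le> (G * M * \<delta> powr (\<alpha> - 1) * t powr (- ((1 - \<alpha>) * \<theta>)) +
      \<delta> * (K * 2 powr \<theta> * M) * c) * nprod hs"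
    by (simp add: u_def hs)
qed

lemma H_bound_limit:
  assumes "\<And>j. H_bound \<iota> k u (c j)" "c \<longlonglongrightarrow> c0"
  shows "H_bound \<iota> k u c0"
  unfolding H_bound_def
proof (intro allI impI)
  fix hs :: "'h list" and x assume "length hs = k"
  hence "\<bar>hdd \<iota> hs u x\<bar> \<le> c j * nprod hs" for j using assms(1) by (simp add: H_bound_def)
  moreover have "(\<lambda>j. c j * nprod hs) \<longlonglongrightarrow> c0 * nprod hs"
    by (intro tendsto_intros assms)
  ultimately show "\<bar>hdd \<iota> hs u x\<bar> \<le> c0 * nprod hs"
    by (intro LIMSEQ_le_const) auto
qed

text \<open>Iterating the interpolation inequality with a small \<open>\<delta>\<close> absorbs the a priori singularity
  \<open>t powr (- \<theta>)\<close>, whose coefficient is halved in each step.\<close>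

lemma P_gradient_bound:
  assumes \<alpha>: "0 \<le> \<alpha>" "\<alpha> < 1"
  shows "\<exists>A>0. \<forall>\<phi> G t. Hol \<alpha> \<phi> G \<longrightarrow> 0 < t \<longrightarrow> t \<le> T \<longrightarrow>
           H_bound \<iota> 1 (P t \<phi>) (A * G * t powr (- ((1 - \<alpha>) * \<theta>)))"
proof -
  define k where "k = K * 2 powr \<theta>"
  define \<rho> where "\<rho> = (1 - \<alpha>) * \<theta>"
  \<comment> \<open>The factor 2^\<theta> compensates the passage from t to t / 2, in both powers
    since \<rho> \<le> \<theta>; the factor 2 produces the halving.\<close>
  define \<delta> where "\<delta> = 1 / (2 * 2 powr \<theta> * (k * M))"
  define A where "A = M * \<delta> powr (\<alpha> - 1)"
  have kM: "k > 0" "k * M > 0" using K M by (auto simp: k_def)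
  hence \<delta>: "\<delta> > 0" by (simp add: \<delta>_def)
  have A: "A > 0" using M \<delta> by (simp add: A_def)
  have \<delta>k: "\<delta> * (k * M) = 1 / (2 * 2 powr \<theta>)"
    using kM M by (simp add: \<delta>_def)
  have \<rho>: "\<rho> \<le> \<theta>" using \<alpha> \<theta> by (simp add: \<rho>_def algebra_simps)
  have half: "(t / 2) powr (- r) = 2 powr r * t powr (- r)" if "t > 0" for t r :: real
    using that by (simp add: powr_divide powr_minus field_simps)
  \<comment> \<open>\<open>2 * A\<close> is the fixed point of a = A + a / 2, the recursion for the
    first coefficient; the second term starts from the plain smoothing bound for bounded
    functions.\<close>
  have iter: "H_bound \<iota> 1 (P t \<phi>) (2 * A * G * t powr (- \<rho>) + (1 / 2) ^ j * (k * G * t powr (- \<theta>)))"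
    if "Hol \<alpha> \<phi> G" "0 < t" "t \<le> T" for \<phi> G j t
    using that(2,3)
  proof (induction j arbitrary: t)
    case 0
    have "H_bound \<iota> 0 (P (t / 2) \<phi>) G"
      using P_le[OF _ HolD(1,2)[OF that(1)], of "t / 2"] 0 by (simp add: H_bound_def)
    from P_H_bound_half[OF HolD(1,2)[OF that(1)] 0 this]
    have "H_bound \<iota> 1 (P t \<phi>) (K * (t / 2) powr (- \<theta>) * G)" by simp
    moreover have "K * (t / 2) powr (- \<theta>) * G = k * G * t powr (- \<theta>)"
      using half[OF 0(1), of \<theta>] by (simp add: k_def)
    moreover have "0 \<le> 2 * A * G * t powr (- \<rho>)"
      using A HolD(4)[OF that(1)] by simp
    ultimately show ?case by (auto elim: H_bound_mono)
  next
    case (Suc j)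
    have G: "G \<ge> 0" by (rule HolD(4)[OF that(1)])
    define c where "c = 2 * A * G * (t / 2) powr (- \<rho>) + (1 / 2) ^ j * (k * G * (t / 2) powr (- \<theta>))"
    have c: "H_bound \<iota> 1 (P (t / 2) \<phi>) c"
      unfolding c_def using Suc.prems by (intro Suc.IH) auto
    have 1: "H_bound \<iota> 1 (P t \<phi>) (A * G * t powr (- \<rho>) + c / (2 * 2 powr \<theta>))"
    proof -
      have "\<delta> * (K * 2 powr \<theta> * M) * c = c / (2 * 2 powr \<theta>)"
        using \<delta>k by (simp add: k_def)
      moreover have "G * M * \<delta> powr (\<alpha> - 1) * t powr (- ((1 - \<alpha>) * \<theta>)) = A * G * t powr (- \<rho>)"
        by (simp add: A_def \<rho>_def mult_ac)
      ultimately show ?thesis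
        using P_interpolation[OF \<alpha> that(1) Suc.prems \<delta> c] by (simp only:)
    qed
    have "c = 2 powr \<rho> * (2 * A * G * t powr (- \<rho>)) + 2 powr \<theta> * ((1 / 2) ^ j * (k * G * t powr (- \<theta>)))"
      using Suc.prems by (simp add: c_def half)
    also have "\<dots> \<le> 2 powr \<theta> * (2 * A * G * t powr (- \<rho>)) + 2 powr \<theta> * ((1 / 2) ^ j * (k * G * t powr (- \<theta>)))"
      using A G \<rho> by (intro add_right_mono mult_right_mono powr_mono) auto
    finally have "c / (2 * 2 powr \<theta>) \<le> A * G * t powr (- \<rho>) + (1 / 2) ^ Suc j * (k * G * t powr (- \<theta>))"
      by (simp add: field_simps)
    thus ?case by (intro H_bound_mono[OF 1]) simp
  qed
  have "H_bound \<iota> 1 (P t \<phi>) (2 * A * G * t powr (- \<rho>))" if "Hol \<alpha> \<phi> G" "0 < t" "t \<le> T" for \<phi> G t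
  proof (rule H_bound_limit[OF iter[OF that]])
    have "(\<lambda>j. 2 * A * G * t powr (- \<rho>) + (1 / 2) ^ j * (k * G * t powr (- \<theta>)))
        \<longlonglongrightarrow> 2 * A * G * t powr (- \<rho>) + 0 * (k * G * t powr (- \<theta>))"
      by (intro tendsto_intros LIMSEQ_realpow_zero) auto
    thus "(\<lambda>j. 2 * A * G * t powr (- \<rho>) + (1 / 2) ^ j * (k * G * t powr (- \<theta>)))
        \<longlonglongrightarrow> 2 * A * G * t powr (- \<rho>)" by simp
  qed
  thus ?thesis using A unfolding \<rho>_def by (intro exI[of _ "2 * A"]) auto
qed

text \<open>Only the first derivative uses the Hoelder condition. Every further order is bought at
  the full price \<theta> by halving the time, which is why \<alpha> is subtracted just once in the
  exponent.\<close>

lemma P_derivative_bound: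
  assumes \<alpha>: "0 \<le> \<alpha>" "\<alpha> < 1"
  shows "\<exists>A>0. \<forall>\<phi> G t. Hol \<alpha> \<phi> G \<longrightarrow> 0 < t \<longrightarrow> t \<le> T \<longrightarrow>
           H_bound \<iota> (Suc k) (P t \<phi>) (A * G * t powr (- ((real (Suc k) - \<alpha>) * \<theta>)))"
proof (induction k)
  case 0
  thus ?case using P_gradient_bound[OF \<alpha>] by simp
next
  case (Suc k)
  then obtain A where A: "A > 0" and bd: "\<And>\<phi> G t. Hol \<alpha> \<phi> G \<Longrightarrow> 0 < t \<Longrightarrow> t \<le> T \<Longrightarrow>
           H_bound \<iota> (Suc k) (P t \<phi>) (A * G * t powr (- ((real (Suc k) - \<alpha>) * \<theta>)))"
    by blast
  define \<rho> where "\<rho> = (real (Suc (Suc k)) - \<alpha>) * \<theta>"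
  define A' where "A' = K * M ^ Suc k * A * 2 powr \<rho>"
  have "H_bound \<iota> (Suc (Suc k)) (P t \<phi>) (A' * G * t powr (- \<rho>))"
    if "Hol \<alpha> \<phi> G" "0 < t" "t \<le> T" for \<phi> G t
  proof -
    have "H_bound \<iota> (Suc k) (P (t / 2) \<phi>) (A * G * (t / 2) powr (- ((real (Suc k) - \<alpha>) * \<theta>)))"
      using that by (intro bd) auto
    from P_H_bound_half[OF HolD(1,2)[OF that(1)] that(2,3) this]
    have "H_bound \<iota> (Suc (Suc k)) (P t \<phi>)
      (K * (t / 2) powr (- \<theta>) * M ^ Suc k * (A * G * (t / 2) powr (- ((real (Suc k) - \<alpha>) * \<theta>))))" .
    moreover have "(t / 2) powr (- \<theta>) * (t / 2) powr (- ((real (Suc k) - \<alpha>) * \<theta>)) = (t / 2) powr (- \<rho>)"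
      by (simp add: powr_add[symmetric] \<rho>_def algebra_simps)
    moreover have "(t / 2) powr (- \<rho>) = 2 powr \<rho> * t powr (- \<rho>)"
      using that by (simp add: powr_divide powr_minus field_simps)
    ultimately show ?thesis by (simp add: A'_def mult_ac)
  qed
  moreover have "A' > 0" using K M A by (simp add: A'_def)
  ultimately show ?case unfolding \<rho>_def by blast
qed

end

section \<open>Convolution in time\<close>

text \<open>Nonnegativity makes a gauge integral absolutely convergent, so the known power integrals
  can be used with the Lebesgue measure.\<close>

lemma has_bochner_integral_of_has_integral:
  fixes f :: "real \<Rightarrow> real"
  assumes "(f has_integral I) A" "\<And>x. x \<in> A \<Longrightarrow> 0 \<le> f x" "f \<in> borel_measurable borel" "A \<in> sets borel"
  shows "has_bochner_integral lborel (\<lambda>x. indicator A x * f x) I"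
proof (rule has_bochner_integral_nn_integral)
  show "0 \<le> I" by (rule has_integral_nonneg[OF assms(1,2)])
  show "(\<integral>\<^sup>+x. ennreal (indicator A x * f x) \<partial>lborel) = ennreal I"
    by (rule nn_integral_has_integral_lebesgue[OF assms(2,1)])
  show "AE x in lborel. 0 \<le> indicator A x * f x"
    using assms(2) by (auto simp: indicator_def)
qed (use assms in auto)

lemma has_bochner_integral_powr_from_0:
  assumes "\<rho> < 1" "a \<ge> 0"
  shows "has_bochner_integral lborel (\<lambda>s::real. indicator {0..a} s * s powr (- \<rho>)) (a powr (1 - \<rho>) / (1 - \<rho>))"
  using has_bochner_integral_of_has_integral[OF has_integral_powr_from_0[of "- \<rho>" a]] assms by simp

lemma has_bochner_integral_powr_to_inf:
  assumes "\<rho> > 1" "a > 0"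
  shows "has_bochner_integral lborel (\<lambda>s::real. indicator {a..} s * s powr (- \<rho>)) (a powr (1 - \<rho>) / (\<rho> - 1))"
proof -
  have "- (a powr (- \<rho> + 1)) / (- \<rho> + 1) = a powr (1 - \<rho>) / (\<rho> - 1)"
    using assms by (simp add: field_simps)
  with has_integral_powr_to_inf[of "- \<rho>" a] assms
  have "((\<lambda>s. s powr (- \<rho>)) has_integral a powr (1 - \<rho>) / (\<rho> - 1)) {a..}" by simp
  from has_bochner_integral_of_has_integral[OF this] show ?thesis by simp
qed

text \<open>The left end is excluded because the smoothing bounds hold for s > 0 only; the point s =
  0 has measure zero.\<close>

abbreviation interval_measure :: "real \<Rightarrow> real measure" where
  "interval_measure t \<equiv> restrict_space lborel {0<..t}"

lemma integral_interval_measure: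
  fixes f :: "real \<Rightarrow> real"
  shows "(LINT s|interval_measure t. f s) = (LINT s|lborel. indicator {0<..t} s * f s)"
  by (simp add: integral_restrict_space)

lemma integrable_powr_interval_measure:
  assumes "\<rho> < 1"
  shows "integrable (interval_measure t) (\<lambda>s. s powr (- \<rho>))"
proof (cases "t \<ge> 0")
  case True
  have "integrable lborel (\<lambda>s. indicator {0..t} s * s powr (- \<rho>))"
    using has_bochner_integral_powr_from_0[OF assms True] by (simp add: has_bochner_integral_iff)
  hence "integrable lborel (\<lambda>s. indicator {0<..t} s * s powr (- \<rho>))"
    by (rule Bochner_Integration.integrable_bound) (auto simp: indicator_def)
  thus ?thesis by (simp add: integrable_restrict_space)
next
  case False
  hence "{0<..t} = {}" by auto
  thus ?thesis by (simp add: integrable_restrict_space)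
qed

lemma integral_powr_interval_measure_le:
  assumes "\<rho> < 1" "0 \<le> t" "t \<le> T"
  shows "(LINT s|interval_measure t. s powr (- \<rho>)) \<le> T powr (1 - \<rho>) / (1 - \<rho>)"
proof -
  have hb: "has_bochner_integral lborel (\<lambda>s::real. indicator {0..T} s * s powr (- \<rho>)) (T powr (1 - \<rho>) / (1 - \<rho>))"
    by (rule has_bochner_integral_powr_from_0) (use assms in auto)
  have "(LINT s|interval_measure t. s powr (- \<rho>)) \<le> (LINT s|lborel. indicator {0..T} s * s powr (- \<rho>))"
    unfolding integral_interval_measure
    using hb assms by (intro integral_mono') (auto simp: has_bochner_integral_iff indicator_def)
  thus ?thesis using hb by (simp add: has_bochner_integral_iff)
qed

text \<open>Each bound is used where its power is integrable: exponent below 1 near 0, exponent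
  above 1 beyond a. Extending both pieces past t keeps the result independent of t, also when a
  exceeds t.\<close>

lemma integral_split_le:
  assumes \<rho>: "\<rho> < 1" "\<rho>' > 1" and a: "a > 0" and nonneg: "p \<ge> 0" "q \<ge> 0"
    and d: "\<And>s. 0 < s \<Longrightarrow> s \<le> t \<Longrightarrow> d s \<le> p * s powr (- \<rho>)"
      "\<And>s. 0 < s \<Longrightarrow> s \<le> t \<Longrightarrow> d s \<le> q * s powr (- \<rho>')"
  shows "(LINT s|interval_measure t. d s)
           \<le> p * (a powr (1 - \<rho>) / (1 - \<rho>)) + q * (a powr (1 - \<rho>') / (\<rho>' - 1))"
proof -
  let ?m = "\<lambda>s. p * (indicator {0..a} s * s powr (- \<rho>)) + q * (indicator {a..} s * s powr (- \<rho>'))"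
  have hb: "has_bochner_integral lborel ?m (p * (a powr (1 - \<rho>) / (1 - \<rho>)) + q * (a powr (1 - \<rho>') / (\<rho>' - 1)))"
    using has_bochner_integral_powr_from_0[OF \<rho>(1)] has_bochner_integral_powr_to_inf[OF \<rho>(2) a] a
    by (intro has_bochner_integral_add has_bochner_integral_mult_right) auto
  have "(LINT s|interval_measure t. d s) \<le> (LINT s|lborel. ?m s)"
    unfolding integral_interval_measure
  proof (rule integral_mono')
    show "integrable lborel ?m" using hb by (simp add: has_bochner_integral_iff)
    fix s
    have nn: "0 \<le> p * s powr (- \<rho>)" "0 \<le> q * s powr (- \<rho>')" using nonneg by auto
    show "0 \<le> ?m s" using nn by (auto simp: indicator_def)
    show "indicator {0<..t} s * d s \<le> ?m s"
    proof (cases "0 < s \<and> s \<le> t")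
      case True
      thus ?thesis using d(1)[of s] d(2)[of s] nn by (cases "s \<le> a") (auto simp: indicator_def)
    next
      case False
      have "indicator {0<..t} s * d s = 0" using False by (auto simp: indicator_def)
      thus ?thesis using nn by (auto simp: indicator_def)
    qed
  qed
  thus ?thesis using hb by (simp add: has_bochner_integral_iff)
qed

text \<open>The integrable functions \<open>B k\<close> dominate the derivatives of order k, so
  differentiation under the integral can be repeated; measurability in s comes from
  \<open>hdd_as_limit\<close>.\<close>

lemma hdd_integral:
  fixes u :: "'s \<Rightarrow> 'x::real_vector \<Rightarrow> real" and \<iota> :: "'h::real_normed_vector \<Rightarrow> 'x"
  assumes diff: "\<And>s. s \<in> space N \<Longrightarrow> H_diff \<iota> n (u s)"
    and meas: "\<And>x. (\<lambda>s. u s x) \<in> borel_measurable N"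
    and bd: "\<And>s k. s \<in> space N \<Longrightarrow> k \<le> n \<Longrightarrow> H_bound \<iota> k (u s) (B k s)"
    and int: "\<And>k. k \<le> n \<Longrightarrow> integrable N (B k)"
  shows "length hs \<le> n \<Longrightarrow> integrable N (\<lambda>s. hdd \<iota> hs (u s) x)"
    and "H_diff \<iota> n (\<lambda>x. LINT s|N. u s x)"
    and "length hs \<le> n \<Longrightarrow> hdd \<iota> hs (\<lambda>x. LINT s|N. u s x) = (\<lambda>x. LINT s|N. hdd \<iota> hs (u s) x)"
    and "k \<le> n \<Longrightarrow> H_bound \<iota> k (\<lambda>x. LINT s|N. u s x) (LINT s|N. B k s)"
proof -
  have meas': "(\<lambda>s. hdd \<iota> hs (u s) x) \<in> borel_measurable N" if "length hs \<le> n" for hs x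
    using that
  proof (induction hs arbitrary: x)
    case Nil
    show ?case using meas by simp
  next
    case (Cons h hs)
    show ?case
    proof (rule borel_measurable_LIMSEQ_real)
      fix s assume "s \<in> space N"
      show "(\<lambda>j. real (Suc j) * (hdd \<iota> hs (u s) (x + (1 / real (Suc j)) *\<^sub>R \<iota> h) - hdd \<iota> hs (u s) x))
           \<longlonglongrightarrow> hdd \<iota> (h # hs) (u s) x"
        by (rule hdd_as_limit[OF diff[OF \<open>s \<in> space N\<close>]]) (use Cons.prems in simp)
    next
      fix j
      have "(\<lambda>s. hdd \<iota> hs (u s) y) \<in> borel_measurable N" for y
        using Cons.prems by (intro Cons.IH) simp
      thus "(\<lambda>s. real (Suc j) * (hdd \<iota> hs (u s) (x + (1 / real (Suc j)) *\<^sub>R \<iota> h) - hdd \<iota> hs (u s) x))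
          \<in> borel_measurable N"
        by (intro borel_measurable_times borel_measurable_diff borel_measurable_const)
    qed
  qed
  have bd': "\<bar>hdd \<iota> hs (u s) x\<bar> \<le> B (length hs) s * nprod hs" if "s \<in> space N" "length hs \<le> n" for s hs x
    using bd[OF that] by (simp add: H_bound_def)
  show int': "integrable N (\<lambda>s. hdd \<iota> hs (u s) x)" if "length hs \<le> n" for hs x
  proof (rule Bochner_Integration.integrable_bound)
    show "integrable N (\<lambda>s. B (length hs) s * nprod hs)"
      using int[OF that] by simp
    show "AE s in N. norm (hdd \<iota> hs (u s) x) \<le> norm (B (length hs) s * nprod hs)"
      using bd'[OF _ that, of _ x] by (intro AE_I2) (simp add: order_trans[OF _ abs_ge_self])
  qed (rule meas'[OF that])
  define D where "D hs = (\<lambda>x. LINT s|N. hdd \<iota> hs (u s) x)" for hs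
  have D: "((\<lambda>t. D hs (x + t *\<^sub>R \<iota> h)) has_real_derivative D (h # hs) x) (at 0)"
    if "length hs < n" for hs h x
  proof -
    have "((\<lambda>t. LINT s|N. hdd \<iota> hs (u s) (x + t *\<^sub>R \<iota> h)) has_real_derivative
            (LINT s|N. hdd \<iota> (h # hs) (u s) (x + 0 *\<^sub>R \<iota> h))) (at 0)"
    proof (rule derivative_under_integral)
      show "((\<lambda>t. hdd \<iota> hs (u s) (x + t *\<^sub>R \<iota> h)) has_real_derivative
              hdd \<iota> (h # hs) (u s) (x + t *\<^sub>R \<iota> h)) (at t)" if "s \<in> space N" for s t
        by (rule hdd_deriv[OF diff[OF that] \<open>length hs < n\<close>])
      show "integrable N (\<lambda>s. hdd \<iota> hs (u s) (x + t *\<^sub>R \<iota> h))" for t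
        using that by (intro int') simp
      show "\<bar>hdd \<iota> (h # hs) (u s) (x + t *\<^sub>R \<iota> h)\<bar> \<le> B (Suc (length hs)) s * nprod (h # hs)"
        if "s \<in> space N" for s t
        using bd'[OF that, of "h # hs"] \<open>length hs < n\<close> by (simp del: hdd.simps)
      show "integrable N (\<lambda>s. B (Suc (length hs)) s * nprod (h # hs))"
        using int[of "Suc (length hs)"] that by simp
      show "(\<lambda>s. hdd \<iota> (h # hs) (u s) (x + 0 *\<^sub>R \<iota> h)) \<in> borel_measurable N"
        using that by (intro meas') simp
    qed
    thus ?thesis by (simp add: D_def del: hdd.simps)
  qed
  have D0: "D [] = (\<lambda>x. LINT s|N. u s x)" by (simp add: D_def)
  show "H_diff \<iota> n (\<lambda>x. LINT s|N. u s x)" by (rule H_diffI(1)[of D, OF D0 D])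
  show eq: "hdd \<iota> hs (\<lambda>x. LINT s|N. u s x) = (\<lambda>x. LINT s|N. hdd \<iota> hs (u s) x)" if "length hs \<le> n" for hs
    using H_diffI(2)[of D, OF D0 D] that by (simp add: D_def)
  show "H_bound \<iota> k (\<lambda>x. LINT s|N. u s x) (LINT s|N. B k s)" if "k \<le> n"
    unfolding H_bound_def
  proof (intro allI impI)
    fix hs :: "'h list" and x assume k: "length hs = k"
    have "\<bar>LINT s|N. hdd \<iota> hs (u s) x\<bar> \<le> (LINT s|N. \<bar>hdd \<iota> hs (u s) x\<bar>)"
      by (rule integral_abs_bound)
    also have "\<dots> \<le> (LINT s|N. B k s * nprod hs)"
      using int[OF that] int'[of hs x] bd'[of _ hs x] k that by (intro integral_mono integrable_abs) auto
    finally show "\<bar>hdd \<iota> hs (\<lambda>x. LINT s|N. u s x) x\<bar> \<le> (LINT s|N. B k s) * nprod hs"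
      using eq[of hs] k that by simp
  qed
qed

section \<open>Regularity of the convolution integral\<close>

context mehler_H
begin

text \<open>The two strict inequalities for n say that the singularity of order n is integrable at 0
  and that of order n + 1 is integrable at infinity. The first gives the derivatives, both together
  their Hoelder bound.\<close>

lemma convolution_estimates:
  assumes \<alpha>: "0 \<le> \<alpha>" "\<alpha> < 1"
    and n: "real n < \<alpha> + 1 / \<theta>" "\<alpha> + 1 / \<theta> < real n + 1" and \<sigma>: "\<sigma> = \<alpha> + 1 / \<theta> - real n"
  shows "\<exists>C>0. \<forall>g G t. 0 \<le> t \<longrightarrow> t \<le> T \<longrightarrow> (\<forall>s\<in>{0..T}. Hol \<alpha> (g s) G) \<longrightarrow>
    (\<forall>x. (\<lambda>s. P s (g (t - s)) x) \<in> borel_measurable (interval_measure t)) \<longrightarrow>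
    (let v = (\<lambda>x. LINT s|interval_measure t. P s (g (t - s)) x) in
      H_diff \<iota> n v \<and> (\<forall>k\<le>n. H_bound \<iota> k v (C * G)) \<and>
      (\<forall>hs x h. length hs = n \<longrightarrow>
         \<bar>hdd \<iota> hs v (x + \<iota> h) - hdd \<iota> hs v x\<bar> \<le> C * G * norm h powr \<sigma> * nprod hs))"
proof -
  have "\<forall>k. \<exists>A>0. \<forall>\<phi> G t. Hol \<alpha> \<phi> G \<longrightarrow> 0 < t \<longrightarrow> t \<le> T \<longrightarrow>
           H_bound \<iota> (Suc k) (P t \<phi>) (A * G * t powr (- ((real (Suc k) - \<alpha>) * \<theta>)))"
    using P_derivative_bound[OF \<alpha>] by blast
  then obtain A where A: "\<And>k. A k > 0" "\<And>k \<phi> G t. Hol \<alpha> \<phi> G \<Longrightarrow> 0 < t \<Longrightarrow> t \<le> T \<Longrightarrow>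
           H_bound \<iota> (Suc k) (P t \<phi>) (A k * G * t powr (- ((real (Suc k) - \<alpha>) * \<theta>)))"
    by metis
  \<comment> \<open>Order 0 is exceptional: only the sup bound is available there, whereas the
    general formula would claim decay like t^(\<alpha> \<theta>) as t tends to 0.\<close>
  define r where "r k = (if k = 0 then 0 else (real k - \<alpha>) * \<theta>)" for k :: nat
  define a where "a k = (if k = 0 then 1 else A (k - 1))" for k
  have a: "a k > 0" for k using A by (simp add: a_def)
  have r_Suc: "r (Suc k) = (real (Suc k) - \<alpha>) * \<theta>" "a (Suc k) = A k" for k
    by (simp_all add: r_def a_def)
  have r_less: "r k < 1" if "k \<le> n" for k
  proof (cases "k = 0")
    case False
    have "real k - \<alpha> < 1 / \<theta>" using that n by simp
    thus ?thesis using \<theta> False by (simp add: r_def pos_less_divide_eq)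
  qed (simp add: r_def)
  have r_greater: "r (Suc n) > 1"
  proof -
    have "1 / \<theta> < real (Suc n) - \<alpha>" using n by simp
    thus ?thesis using \<theta> by (simp add: r_def pos_divide_less_eq)
  qed
  have bound: "H_bound \<iota> k (P t \<phi>) (a k * G * t powr (- r k))"
    if "Hol \<alpha> \<phi> G" "0 < t" "t \<le> T" for k \<phi> G t
  proof (cases k)
    case 0
    thus ?thesis using P_le[OF _ HolD(1,2)[OF that(1)], of t] that
      by (simp add: H_bound_def a_def r_def)
  next
    case (Suc j)
    thus ?thesis using A(2)[OF that, of j] r_Suc by simp
  qed
  \<comment> \<open>The exponent of the norm of h in the increment bound for small s. For n = 0 the
    increment is Hoelder by \<open>P_Holder\<close>; for n > 0 it is estimated by twice the bound of
    order n, without any gain in h.\<close>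
  define \<beta> where "\<beta> = (if n = 0 then \<alpha> else 0)"
  define b where "b = (if n = 0 then M else 2 * a n)"
  have b: "b > 0" using a M by (simp add: b_def)
  \<comment> \<open>Integrating either bound up to, respectively from, the cut at |h|^(1/\<theta>)
    gives the same power of |h|, because the two bounds are of equal order there.\<close>
  have \<beta>: "\<beta> + (1 - r n) / \<theta> = \<sigma>" "1 + (1 - r (Suc n)) / \<theta> = \<sigma>"
    using \<theta> by (auto simp: \<beta>_def r_def \<sigma> field_simps)
  have diff1: "\<bar>hdd \<iota> hs (P t \<phi>) (x + \<iota> h) - hdd \<iota> hs (P t \<phi>) x\<bar> \<le> b * G * norm h powr \<beta> * nprod hs * t powr (- r n)"
    if "Hol \<alpha> \<phi> G" "0 < t" "t \<le> T" "length hs = n" "h \<noteq> 0" for \<phi> G t hs x h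
  proof (cases "n = 0")
    case True
    thus ?thesis using P_Holder[OF _ _ that(1), of t x h] \<alpha> that
      by (simp add: r_def \<beta>_def b_def mult_ac)
  next
    case False
    have "\<bar>hdd \<iota> hs (P t \<phi>) y\<bar> \<le> a n * G * t powr (- r n) * nprod hs" for y
      by (rule H_boundD[OF bound]) (use that in auto)
    from this[of "x + \<iota> h"] this[of x]
    have "\<bar>hdd \<iota> hs (P t \<phi>) (x + \<iota> h) - hdd \<iota> hs (P t \<phi>) x\<bar> \<le> 2 * (a n * G * t powr (- r n) * nprod hs)"
      by linarith
    thus ?thesis using False that by (simp add: \<beta>_def b_def mult_ac)
  qed
  have diff2: "\<bar>hdd \<iota> hs (P t \<phi>) (x + \<iota> h) - hdd \<iota> hs (P t \<phi>) x\<bar> \<le> a (Suc n) * G * norm h * nprod hs * t powr (- r (Suc n))"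
    if "Hol \<alpha> \<phi> G" "0 < t" "t \<le> T" "length hs = n" for \<phi> G t hs x h
  proof -
    have "\<bar>hdd \<iota> hs (P t \<phi>) (x + 1 *\<^sub>R \<iota> h) - hdd \<iota> hs (P t \<phi>) x\<bar>
        \<le> a (Suc n) * G * t powr (- r (Suc n)) * nprod (h # hs) * \<bar>1\<bar>"
    proof (rule hdd_Lipschitz)
      show "H_diff \<iota> (Suc n) (P t \<phi>)"
        by (rule P_H_diff[OF HolD(1,2)[OF that(1)] that(2,3)])
      show "\<bar>hdd \<iota> (h # hs) (P t \<phi>) y\<bar> \<le> a (Suc n) * G * t powr (- r (Suc n)) * nprod (h # hs)" for y
        by (rule H_boundD[OF bound]) (use that in auto)
    qed (use that in auto)
    thus ?thesis by (simp add: mult_ac)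
  qed
  define c where "c k = a k * (T powr (1 - r k) / (1 - r k))" for k
  define c' where "c' = b / (1 - r n) + a (Suc n) / (r (Suc n) - 1)"
  define C where "C = (\<Sum>k\<le>n. c k) + c'"
  have c: "c k \<ge> 0" if "k \<le> n" for k
    using a[of k] r_less[OF that] by (simp add: c_def)
  have c': "c' > 0" unfolding c'_def
    using a[of "Suc n"] b r_less[of n] r_greater by (intro add_pos_pos) auto
  have Cc': "C \<ge> c'" using c sum_nonneg[of "{..n}" c] by (simp add: C_def)
  have Cc: "C \<ge> c k" if "k \<le> n" for k
    using c c' that member_le_sum[of k "{..n}" c] by (simp add: C_def)
  have C: "C > 0" using Cc' c' by linarith
  have main: "H_diff \<iota> n v" "k \<le> n \<Longrightarrow> H_bound \<iota> k v (C * G)"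
      "length hs = n \<Longrightarrow> \<bar>hdd \<iota> hs v (x + \<iota> h) - hdd \<iota> hs v x\<bar> \<le> C * G * norm h powr \<sigma> * nprod hs"
    if t: "0 \<le> t" "t \<le> T" and g: "\<forall>s\<in>{0..T}. Hol \<alpha> (g s) G"
      and meas: "\<forall>x. (\<lambda>s. P s (g (t - s)) x) \<in> borel_measurable (interval_measure t)"
      and v: "v = (\<lambda>x. LINT s|interval_measure t. P s (g (t - s)) x)" for g G t v k hs x h
  proof -
    let ?N = "interval_measure t"
    let ?u = "\<lambda>s. P s (g (t - s))"
    have s: "0 < s" "s \<le> T" "s \<le> t" "Hol \<alpha> (g (t - s)) G" if "s \<in> space ?N" for s
      using that t g by (auto simp: space_restrict_space)
    have G: "G \<ge> 0" using g T HolD(4)[of \<alpha> "g 0" G] by simp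
    have diff: "H_diff \<iota> m (?u s)" if "s \<in> space ?N" for s m
      by (rule P_H_diff[OF HolD(1,2)]) (use s[OF that] in auto)
    have bd: "H_bound \<iota> k (?u s) (a k * G * s powr (- r k))" if "s \<in> space ?N" for s k
      by (rule bound) (use s[OF that] in auto)
    have int: "integrable ?N (\<lambda>s. a k * G * s powr (- r k))" if "k \<le> n" for k
      using integrable_powr_interval_measure[OF r_less[OF that]] by simp
    note I = hdd_integral[of ?N \<iota> n ?u, OF diff meas[rule_format] bd int, folded v]
    show "H_diff \<iota> n v" by (rule I(2))
    show "H_bound \<iota> k v (C * G)" if "k \<le> n"
    proof (rule H_bound_mono)
      show "H_bound \<iota> k v (LINT s|?N. a k * G * s powr (- r k))"
        by (rule I(4)) (use that in simp_all)
      have "(LINT s|?N. a k * G * s powr (- r k)) = a k * G * (LINT s|?N. s powr (- r k))" by simp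
      also have "\<dots> \<le> a k * G * (T powr (1 - r k) / (1 - r k))"
        using a[of k] G t r_less[OF that]
        by (intro mult_left_mono integral_powr_interval_measure_le) auto
      also have "\<dots> = c k * G" by (simp add: c_def)
      also have "\<dots> \<le> C * G" using Cc[OF that] G by (rule mult_right_mono)
      finally show "(LINT s|?N. a k * G * s powr (- r k)) \<le> C * G" .
    qed
    show "\<bar>hdd \<iota> hs v (x + \<iota> h) - hdd \<iota> hs v x\<bar> \<le> C * G * norm h powr \<sigma> * nprod hs" if hs: "length hs = n"
    proof (cases "h = 0")
      case True
      have "\<iota> 0 = 0" using embedding by (rule linear_0[OF bounded_linear.linear])
      thus ?thesis using True by simp
    next
      case False
      let ?e = "norm h powr (1 / \<theta>)"
      let ?d = "\<lambda>s. \<bar>hdd \<iota> hs (?u s) (x + \<iota> h) - hdd \<iota> hs (?u s) x\<bar>"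
      have e: "?e powr z = norm h powr (z / \<theta>)" for z by (simp add: powr_powr)
      have int': "integrable ?N (\<lambda>s. hdd \<iota> hs (?u s) y)" for y
        by (rule I(1)) (use hs in simp_all)
      have eq: "hdd \<iota> hs v = (\<lambda>x. LINT s|?N. hdd \<iota> hs (?u s) x)"
        by (rule I(3)) (use hs in simp_all)
      define p where "p = b * G * norm h powr \<beta> * nprod hs"
      define q where "q = a (Suc n) * G * norm h * nprod hs"
      have pq: "p \<ge> 0" "q \<ge> 0"
        using G b a[of "Suc n"] nprod_nonneg[of hs] by (simp_all add: p_def q_def)
      have d: "?d s \<le> p * s powr (- r n)" "?d s \<le> q * s powr (- r (Suc n))" if "0 < s" "s \<le> t" for s
      proof -
        have s: "Hol \<alpha> (g (t - s)) G" "s \<le> T" using that t g by auto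
        show "?d s \<le> p * s powr (- r n)" "?d s \<le> q * s powr (- r (Suc n))"
          unfolding p_def q_def
          by (rule diff1[OF s(1) that(1) s(2) hs False], rule diff2[OF s(1) that(1) s(2) hs])
      qed
      have "\<bar>hdd \<iota> hs v (x + \<iota> h) - hdd \<iota> hs v x\<bar>
          = \<bar>LINT s|?N. hdd \<iota> hs (?u s) (x + \<iota> h) - hdd \<iota> hs (?u s) x\<bar>"
        unfolding eq by (simp only: Bochner_Integration.integral_diff[OF int' int'])
      also have "\<dots> \<le> (LINT s|?N. ?d s)" by (rule integral_abs_bound)
      also have "\<dots> \<le> p * (?e powr (1 - r n) / (1 - r n)) + q * (?e powr (1 - r (Suc n)) / (r (Suc n) - 1))"
        by (rule integral_split_le[OF r_less[OF order_refl] r_greater _ pq d]) (use False in auto)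
      also have "p * (?e powr (1 - r n) / (1 - r n)) =
          b / (1 - r n) * (G * nprod hs * (norm h powr \<beta> * norm h powr ((1 - r n) / \<theta>)))"
        unfolding e p_def by simp
      also have "q * (?e powr (1 - r (Suc n)) / (r (Suc n) - 1)) =
          a (Suc n) / (r (Suc n) - 1) * (G * nprod hs * (norm h powr 1 * norm h powr ((1 - r (Suc n)) / \<theta>)))"
        unfolding e q_def by simp
      finally have "\<bar>hdd \<iota> hs v (x + \<iota> h) - hdd \<iota> hs v x\<bar> \<le> c' * (G * nprod hs * norm h powr \<sigma>)"
        unfolding powr_add[symmetric] \<beta> by (simp only: c'_def distrib_right)
      also have "\<dots> \<le> C * (G * nprod hs * norm h powr \<sigma>)"
        using G nprod_nonneg[of hs] by (intro mult_right_mono[OF Cc']) simp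
      finally show ?thesis by (simp add: mult_ac)
    qed
  qed
  show ?thesis
    unfolding Let_def using C main by (intro exI[of _ C] conjI allI impI) auto
qed

end

section \<open>From directional derivatives to the spaces along \<open>H\<close>\<close>

lemma nprod_eq_0_iff: "nprod hs = 0 \<longleftrightarrow> 0 \<in> set hs"
  by (induction hs) auto

lemma nprod_pos: "0 \<notin> set hs \<Longrightarrow> nprod hs > 0"
  using nprod_nonneg[of hs] nprod_eq_0_iff[of hs] by (simp add: less_le)

lemma mlin_norm_le:
  assumes "\<And>hs. length hs = n \<Longrightarrow> 0 \<notin> set hs \<Longrightarrow> \<bar>T hs\<bar> \<le> B * nprod hs"
  shows "mlin_norm n T \<le> ennreal B"
  unfolding mlin_norm_def
proof (rule SUP_least)
  fix hs :: "'a list" assume "hs \<in> {hs. length hs = n \<and> 0 \<notin> set hs}"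
  thus "ennreal (\<bar>T hs\<bar> / nprod hs) \<le> ennreal B"
    using assms[of hs] nprod_pos[of hs] by (intro ennreal_leI) (simp add: pos_divide_le_eq)
qed

lemma le_mlin_norm:
  assumes "length hs = n" "0 \<notin> set hs"
  shows "ennreal (\<bar>T hs\<bar> / nprod hs) \<le> mlin_norm n T"
  unfolding mlin_norm_def by (rule SUP_upper) (use assms in auto)

text \<open>\<open>mlin_norm\<close> skips lists with a zero entry; linearity in that slot settles
  them.\<close>

lemma mlin_forms_zero:
  assumes "T \<in> mlin_forms n" "0 \<in> set hs"
  shows "T hs = 0"
proof (cases "length hs = n")
  case True
  from assms(2) obtain i where i: "i < length hs" "hs ! i = 0"
    by (auto simp: in_set_conv_nth)
  hence "linear (\<lambda>h. T (hs[i := h]))"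
    using assms(1) True by (auto simp: mlin_forms_def)
  from linear_0[OF this] show ?thesis using i list_update_id[of hs i] by simp
qed (use assms in \<open>auto simp: mlin_forms_def\<close>)

lemma mlin_forms_le:
  assumes "T \<in> mlin_forms n" "mlin_norm n T \<le> ennreal B" "B \<ge> 0" "length hs = n"
  shows "\<bar>T hs\<bar> \<le> B * nprod hs"
proof (cases "0 \<in> set hs")
  case True
  thus ?thesis using mlin_forms_zero[OF assms(1) True] assms(3) nprod_nonneg[of hs] by simp
next
  case False
  have "ennreal (\<bar>T hs\<bar> / nprod hs) \<le> ennreal B"
    using le_mlin_norm[OF assms(4) False, of T] assms(2) by (rule order_trans)
  hence "\<bar>T hs\<bar> / nprod hs \<le> B" using assms(3) by (simp add: ennreal_le_iff)
  thus ?thesis using nprod_pos[OF False] by (simp add: pos_divide_le_eq)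
qed

lemma mlin_forms_bounded:
  assumes "T \<in> mlin_forms n"
  obtains B where "B \<ge> 0" "\<And>hs. length hs = n \<Longrightarrow> \<bar>T hs\<bar> \<le> B * nprod hs"
proof
  have "mlin_norm n T < \<top>" using assms by (simp add: mlin_forms_def)
  hence "mlin_norm n T \<le> ennreal (enn2real (mlin_norm n T))" by simp
  thus "\<bar>T hs\<bar> \<le> enn2real (mlin_norm n T) * nprod hs" if "length hs = n" for hs
    using that by (intro mlin_forms_le[OF assms]) auto
qed simp

lemma mlin_formsI:
  assumes "\<And>hs. length hs \<noteq> n \<Longrightarrow> T hs = 0"
    and "\<And>hs i. length hs = n \<Longrightarrow> i < n \<Longrightarrow> linear (\<lambda>h. T (hs[i := h]))"
    and "\<And>hs. length hs = n \<Longrightarrow> \<bar>T hs\<bar> \<le> B * nprod hs"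
  shows "T \<in> mlin_forms n"
  using assms(1,2) le_less_trans[OF mlin_norm_le[OF assms(3)] ennreal_less_top]
  by (auto simp: mlin_forms_def)

lemma mlin_forms_Cons:
  assumes "T \<in> mlin_forms (Suc n)"
  shows "(\<lambda>hs. T (h # hs)) \<in> mlin_forms n"
proof -
  obtain B where B: "\<And>hs. length hs = Suc n \<Longrightarrow> \<bar>T hs\<bar> \<le> B * nprod hs"
    using mlin_forms_bounded[OF assms] by blast
  show ?thesis
  proof (rule mlin_formsI)
    show "linear (\<lambda>k. T (h # hs[i := k]))" if "length hs = n" "i < n" for hs i
    proof -
      have "linear (\<lambda>k. T ((h # hs)[Suc i := k]))"
        using assms that unfolding mlin_forms_def by (auto simp del: list_update.simps)
      thus ?thesis by simp
    qed
    show "\<bar>T (h # hs)\<bar> \<le> (B * norm h) * nprod hs" if "length hs = n" for hs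
      using B[of "h # hs"] that by (simp add: mult.assoc)
  qed (use assms in \<open>auto simp: mlin_forms_def\<close>)
qed

lemma mlin_forms_bounded_linear:
  assumes "T \<in> mlin_forms (Suc n)" "length hs = n"
  shows "bounded_linear (\<lambda>h. T (h # hs))"
proof -
  obtain B where B: "\<And>hs. length hs = Suc n \<Longrightarrow> \<bar>T hs\<bar> \<le> B * nprod hs"
    using mlin_forms_bounded[OF assms(1)] by blast
  have "linear (\<lambda>h. T ((0 # hs)[0 := h]))"
    using assms unfolding mlin_forms_def by (auto simp del: list_update.simps)
  hence lin: "linear (\<lambda>h. T (h # hs))" by simp
  show ?thesis
  proof (rule bounded_linear_intro[of _ "B * nprod hs"])
    show "norm (T (h # hs)) \<le> norm h * (B * nprod hs)" for h
      using B[of "h # hs"] assms(2) by (simp add: mult_ac)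
  qed (use linear_add[OF lin] linear_scale[OF lin] in auto)
qed

lemma mlin_uniform_boundedness:
  fixes \<F> :: "('h::banach list \<Rightarrow> real) set"
  assumes "\<F> \<subseteq> mlin_forms n" "\<And>hs. length hs = n \<Longrightarrow> \<exists>B. \<forall>T\<in>\<F>. \<bar>T hs\<bar> \<le> B"
  shows "\<exists>B\<ge>0. \<forall>T\<in>\<F>. \<forall>hs. length hs = n \<longrightarrow> \<bar>T hs\<bar> \<le> B * nprod hs"
  using assms
proof (induction n arbitrary: \<F>)
  case 0
  then obtain B where B: "\<forall>T\<in>\<F>. \<bar>T []\<bar> \<le> B" by force
  thus ?case by (intro exI[of _ "max B 0"]) (auto intro: max.coboundedI1)
next
  case (Suc n)
  define \<G> where "\<G> = {\<lambda>hs. T (h # hs) |T h. T \<in> \<F> \<and> norm h \<le> 1}"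
  have "\<G> \<subseteq> mlin_forms n" using Suc.prems(1) mlin_forms_Cons by (auto simp: \<G>_def)
  moreover have "\<exists>B. \<forall>T\<in>\<G>. \<bar>T hs\<bar> \<le> B" if hs: "length hs = n" for hs
  proof -
    have "\<exists>B\<ge>0. \<forall>T\<in>\<F>. \<forall>h. norm (T (h # hs)) \<le> B * norm h"
    proof (rule uniform_boundedness)
      show "bounded_linear (\<lambda>h. T (h # hs))" if "T \<in> \<F>" for T
        using Suc.prems(1) that hs by (intro mlin_forms_bounded_linear) auto
      show "\<exists>B. \<forall>T\<in>\<F>. norm (T (h # hs)) \<le> B" for h
        using Suc.prems(2)[of "h # hs"] hs by simp
    qed
    then obtain B where B: "B \<ge> 0" "\<And>T h. T \<in> \<F> \<Longrightarrow> \<bar>T (h # hs)\<bar> \<le> B * norm h" by auto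
    have "\<bar>T (h # hs)\<bar> \<le> B" if "T \<in> \<F>" "norm h \<le> 1" for T h
      using B(2)[OF that(1), of h] mult_left_mono[OF that(2) B(1)] by simp
    thus ?thesis by (auto simp: \<G>_def)
  qed
  ultimately have "\<exists>B\<ge>0. \<forall>T\<in>\<G>. \<forall>hs. length hs = n \<longrightarrow> \<bar>T hs\<bar> \<le> B * nprod hs"
    by (rule Suc.IH)
  then obtain B where B: "B \<ge> 0" "\<And>T h hs. T \<in> \<F> \<Longrightarrow> norm h \<le> 1 \<Longrightarrow> length hs = n \<Longrightarrow>
      \<bar>T (h # hs)\<bar> \<le> B * nprod hs"
    by (auto simp: \<G>_def)
  have "\<bar>T hs'\<bar> \<le> B * nprod hs'" if T: "T \<in> \<F>" and len: "length hs' = Suc n" for T hs'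
  proof -
    obtain h hs where hs: "hs' = h # hs" "length hs = n"
      using len by (auto simp: length_Suc_conv)
    interpret bounded_linear "\<lambda>h. T (h # hs)"
      using Suc.prems(1) T hs by (intro mlin_forms_bounded_linear) auto
    show ?thesis
    proof (cases "h = 0")
      case True
      thus ?thesis using zero hs by simp
    next
      case False
      have "\<bar>T ((inverse (norm h) *\<^sub>R h) # hs)\<bar> \<le> B * nprod hs"
        using False by (intro B(2) T hs) simp
      thus ?thesis using False hs by (simp add: scaleR abs_mult field_simps)
    qed
  qed
  thus ?case using B(1) by blast
qed

lemma has_H_derivative_pointwise:
  assumes D: "has_H_derivative \<iota> n F D x" and hs: "length hs = n" "0 \<notin> set hs"
  shows "((\<lambda>t. (F (x + t *\<^sub>R \<iota> h) hs - F x hs) / t) \<longlongrightarrow> D (h # hs)) (at 0)"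
proof -
  let ?q = "\<lambda>t. (F (x + t *\<^sub>R \<iota> h) hs - F x hs) / t - D (h # hs)"
  have "((\<lambda>t. ennreal (\<bar>?q t\<bar> / nprod hs)) \<longlongrightarrow> ennreal 0) (at 0)"
  proof (rule tendsto_sandwich[OF _ _ tendsto_const])
    show "((\<lambda>t. mlin_norm n (\<lambda>hs. (F (x + t *\<^sub>R \<iota> h) hs - F x hs) / t - D (h # hs))) \<longlongrightarrow> ennreal 0) (at 0)"
      using D by (simp add: has_H_derivative_def)
    show "\<forall>\<^sub>F t in at 0. ennreal (\<bar>?q t\<bar> / nprod hs)
        \<le> mlin_norm n (\<lambda>hs. (F (x + t *\<^sub>R \<iota> h) hs - F x hs) / t - D (h # hs))"
      using le_mlin_norm[OF hs] by (intro always_eventually allI) fast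
  qed simp
  hence "((\<lambda>t. \<bar>?q t\<bar> / nprod hs) \<longlongrightarrow> 0) (at 0)"
    by (rule tendsto_ennrealD) (auto intro!: always_eventually divide_nonneg_nonneg nprod_nonneg)
  from tendsto_mult_right[OF this, of "nprod hs"]
  have "((\<lambda>t. \<bar>?q t\<bar>) \<longlongrightarrow> 0) (at 0)" using nprod_pos[OF hs(2)] by simp
  hence "(?q \<longlongrightarrow> 0) (at 0)" by (simp add: tendsto_rabs_zero_iff)
  from tendsto_add[OF this tendsto_const[of "D (h # hs)"]] show ?thesis by simp
qed

text \<open>Resolves the definite description in \<open>H_deriv\<close>. Lists of nonzero vectors
  are determined by pointwise limits, all others by the vanishing of multilinear forms
  there.\<close>

lemma has_H_derivative_unique:
  assumes "has_H_derivative \<iota> n F D x" "has_H_derivative \<iota> n F D' x"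
  shows "D = D'"
proof
  fix hs'
  have forms: "D \<in> mlin_forms (Suc n)" "D' \<in> mlin_forms (Suc n)"
    using assms by (auto simp: has_H_derivative_def)
  show "D hs' = D' hs'"
  proof (cases "length hs' = Suc n \<and> 0 \<notin> set hs'")
    case True
    then obtain h hs where hs: "hs' = h # hs" "length hs = n" "0 \<notin> set hs"
      by (auto simp: length_Suc_conv)
    show ?thesis
      unfolding hs(1)
      by (rule tendsto_unique[OF _ has_H_derivative_pointwise[OF assms(1) hs(2,3)]
            has_H_derivative_pointwise[OF assms(2) hs(2,3)]]) simp
  next
    case False
    have "T hs' = 0" if "T \<in> mlin_forms (Suc n)" for T
    proof (cases "length hs' = Suc n")
      case True
      thus ?thesis using False mlin_forms_zero[OF that] by simp
    qed (use that in \<open>simp add: mlin_forms_def\<close>)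
    from this[OF forms(1)] this[OF forms(2)] show ?thesis by simp
  qed
qed

text \<open>The counterpart of the norm of order n + \<sigma> for directional derivatives, with one
  constant for all pieces. \<open>H_C_D\<close> and \<open>H_regular_function.H_C_norm_le\<close>
  show that it agrees with that norm up to the factor n + 2.\<close>

definition H_regular ::
    "('h::real_normed_vector \<Rightarrow> 'x::real_vector) \<Rightarrow> nat \<Rightarrow> real \<Rightarrow> real \<Rightarrow> ('x \<Rightarrow> real) \<Rightarrow> bool" where
  "H_regular \<iota> n \<sigma> B f \<longleftrightarrow> H_diff \<iota> n f \<and> (\<forall>k\<le>n. H_bound \<iota> k f B) \<and>
     (\<forall>hs x h. length hs = n \<longrightarrow>
        \<bar>hdd \<iota> hs f (x + \<iota> h) - hdd \<iota> hs f x\<bar> \<le> B * norm h powr \<sigma> * nprod hs)"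

lemma H_regular_mono:
  assumes "H_regular \<iota> n \<sigma> B f" "B \<le> B'"
  shows "H_regular \<iota> n \<sigma> B' f"
proof -
  have "\<bar>hdd \<iota> hs f (x + \<iota> h) - hdd \<iota> hs f x\<bar> \<le> B' * norm h powr \<sigma> * nprod hs"
    if "length hs = n" for hs x h
  proof -
    have "\<bar>hdd \<iota> hs f (x + \<iota> h) - hdd \<iota> hs f x\<bar> \<le> B * norm h powr \<sigma> * nprod hs"
      using assms(1) that by (simp add: H_regular_def)
    also have "\<dots> \<le> B' * norm h powr \<sigma> * nprod hs"
      by (intro mult_right_mono assms(2) nprod_nonneg) simp
    finally show ?thesis .
  qed
  thus ?thesis
    using assms(1) by (auto simp: H_regular_def intro: H_bound_mono[OF _ assms(2)])
qed

lemma H_regular_add: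
  assumes "H_regular \<iota> n \<sigma> B f" "H_regular \<iota> n \<sigma> B' g"
  shows "H_regular \<iota> n \<sigma> (B + B') (\<lambda>x. f x + g x)"
proof -
  note add = hdd_add[of \<iota> n f g]
  have fg: "H_diff \<iota> n f" "H_diff \<iota> n g" using assms by (auto simp: H_regular_def)
  have "\<bar>hdd \<iota> hs f x + hdd \<iota> hs g x\<bar> \<le> (B + B') * nprod hs" if "length hs \<le> n" for hs x
  proof -
    have "\<bar>hdd \<iota> hs f x\<bar> \<le> B * nprod hs" "\<bar>hdd \<iota> hs g x\<bar> \<le> B' * nprod hs"
      using assms that by (auto simp: H_regular_def H_bound_def)
    thus ?thesis by (simp add: distrib_right)
  qed
  moreover have "\<bar>hdd \<iota> hs f (x + \<iota> h) + hdd \<iota> hs g (x + \<iota> h) - (hdd \<iota> hs f x + hdd \<iota> hs g x)\<bar>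
      \<le> (B + B') * norm h powr \<sigma> * nprod hs" if "length hs = n" for hs x h
  proof -
    have "\<bar>hdd \<iota> hs f (x + \<iota> h) - hdd \<iota> hs f x\<bar> \<le> B * norm h powr \<sigma> * nprod hs"
        "\<bar>hdd \<iota> hs g (x + \<iota> h) - hdd \<iota> hs g x\<bar> \<le> B' * norm h powr \<sigma> * nprod hs"
      using assms that by (auto simp: H_regular_def)
    thus ?thesis by (simp only: distrib_right)
  qed
  ultimately show ?thesis
    using add(1)[OF fg] add(2)[OF fg] by (auto simp: H_regular_def H_bound_def)
qed

section \<open>From directional derivatives to derivatives in operator norm\<close>

locale H_regular_function =
  fixes \<iota> :: "'h::banach \<Rightarrow> 'x::banach" and n :: nat and \<sigma> B :: real and f :: "'x \<Rightarrow> real"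
  assumes embedding: "bounded_linear \<iota>" and \<sigma>: "0 < \<sigma>" "\<sigma> < 1"
    and regular: "H_regular \<iota> n \<sigma> B f"
begin

sublocale bounded_linear \<iota> by (rule embedding)

lemma diff: "H_diff \<iota> n f"
  using regular by (simp add: H_regular_def)

lemma bound: "length hs \<le> n \<Longrightarrow> \<bar>hdd \<iota> hs f x\<bar> \<le> B * nprod hs"
  using regular by (auto simp: H_regular_def H_bound_def)

lemma B_nonneg: "B \<ge> 0"
  using bound[of "[]" 0] by simp

text \<open>Below the top order the next derivative gives a Lipschitz bound, and r \<le> r^\<sigma>
  for r at most 1. Restricting to small h thus gives one estimate valid at all orders.\<close>

lemma Holder:
  assumes "length hs \<le> n" "norm h \<le> 1"
  shows "\<bar>hdd \<iota> hs f (x + \<iota> h) - hdd \<iota> hs f x\<bar> \<le> B * norm h powr \<sigma> * nprod hs"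
proof (cases "length hs = n")
  case True
  thus ?thesis using regular by (auto simp: H_regular_def)
next
  case False
  hence less: "length hs < n" using assms by simp
  have "\<bar>hdd \<iota> hs f (x + 1 *\<^sub>R \<iota> h) - hdd \<iota> hs f x\<bar> \<le> B * nprod (h # hs) * \<bar>1\<bar>"
    by (rule hdd_Lipschitz[OF diff less bound]) (use less in simp)
  also have "\<dots> = B * norm h * nprod hs" by simp
  also have "\<dots> \<le> B * norm h powr \<sigma> * nprod hs"
  proof (intro mult_right_mono mult_left_mono B_nonneg nprod_nonneg)
    show "norm h \<le> norm h powr \<sigma>"
    proof (cases "h = 0")
      case False
      thus ?thesis using powr_mono'[of \<sigma> 1 "norm h"] assms(2) \<sigma> by simp
    qed simp
  qed
  finally show ?thesis by simp
qed

text \<open>Subtracting the linear term leaves a function whose derivative is an increment of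
  \<open>hdd \<iota> (h # hs) f\<close>, hence small by \<open>Holder\<close>. The rate depends
  neither on x nor, after division by \<open>nprod hs\<close>, on hs: this uniformity gives
  linearity, operator-norm limits and joint continuity.\<close>

lemma quotient_rate:
  assumes hs: "length hs < n" and t: "t \<noteq> 0" "\<bar>t\<bar> * norm h \<le> 1"
  shows "\<bar>(hdd \<iota> hs f (x + t *\<^sub>R \<iota> h) - hdd \<iota> hs f x) / t - hdd \<iota> (h # hs) f x\<bar>
           \<le> \<bar>t\<bar> powr \<sigma> * (B * norm h powr \<sigma> * norm h) * nprod hs"
proof -
  define c where "c = hdd \<iota> (h # hs) f x"
  define b where "b = \<bar>t\<bar> powr \<sigma> * (B * norm h powr \<sigma> * norm h) * nprod hs"
  have "norm ((hdd \<iota> hs f (x + t *\<^sub>R \<iota> h) - t * c) - (hdd \<iota> hs f (x + 0 *\<^sub>R \<iota> h) - 0 * c)) \<le> b * norm (t - 0)"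
  proof (rule field_differentiable_bound[of "cball 0 \<bar>t\<bar>"])
    fix r :: real assume "r \<in> cball 0 \<bar>t\<bar>"
    hence r: "\<bar>r\<bar> \<le> \<bar>t\<bar>" by simp
    have "((\<lambda>r. hdd \<iota> hs f (x + r *\<^sub>R \<iota> h) - r * c) has_real_derivative
        hdd \<iota> (h # hs) f (x + r *\<^sub>R \<iota> h) - c) (at r)"
      by (rule DERIV_diff[OF hdd_deriv[OF diff hs] DERIV_cmult_right[OF DERIV_ident, simplified]])
    thus "((\<lambda>r. hdd \<iota> hs f (x + r *\<^sub>R \<iota> h) - r * c) has_real_derivative
        hdd \<iota> (h # hs) f (x + r *\<^sub>R \<iota> h) - c) (at r within cball 0 \<bar>t\<bar>)"
      by (rule DERIV_subset) simp
    have rt: "norm (r *\<^sub>R h) \<le> \<bar>t\<bar> * norm h" using r by (simp add: mult_right_mono)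
    have "\<bar>hdd \<iota> (h # hs) f (x + \<iota> (r *\<^sub>R h)) - hdd \<iota> (h # hs) f x\<bar> \<le> B * norm (r *\<^sub>R h) powr \<sigma> * nprod (h # hs)"
      by (rule Holder) (use hs rt t in simp_all)
    also have "\<dots> \<le> B * (\<bar>t\<bar> * norm h) powr \<sigma> * nprod (h # hs)"
      using rt \<sigma> by (intro mult_right_mono mult_left_mono powr_mono2 B_nonneg nprod_nonneg) auto
    also have "\<dots> = b" by (simp add: b_def powr_mult)
    finally show "norm (hdd \<iota> (h # hs) f (x + r *\<^sub>R \<iota> h) - c) \<le> b"
      by (simp add: c_def scaleR del: hdd.simps)
  qed auto
  hence "\<bar>(hdd \<iota> hs f (x + t *\<^sub>R \<iota> h) - hdd \<iota> hs f x - t * c) / t\<bar> \<le> b"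
    using t by (simp add: abs_divide divide_le_eq algebra_simps)
  moreover have "(hdd \<iota> hs f (x + t *\<^sub>R \<iota> h) - hdd \<iota> hs f x - t * c) / t
      = (hdd \<iota> hs f (x + t *\<^sub>R \<iota> h) - hdd \<iota> hs f x) / t - c"
    using t by (simp add: diff_divide_distrib)
  ultimately show ?thesis by (simp only: b_def c_def)
qed

text \<open>For additivity, a step along a + b is a step along a followed by one along b from a
  moved base point. Uniformity of \<open>quotient_rate\<close> in the base point makes this
  legitimate; homogeneity is the chain rule.\<close>

lemma linear_first:
  assumes hs: "length hs < n"
  shows "linear (\<lambda>h. hdd \<iota> (h # hs) f x)"
proof (rule linearI)
  fix a b :: 'h
  define X where "X j = 1 / real (Suc j)" for j
  have X: "X \<longlonglongrightarrow> 0" "X j > 0" for j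
    using LIMSEQ_inverse_real_of_nat by (auto simp: X_def[abs_def] inverse_eq_divide)
  have small: "\<forall>\<^sub>F j in sequentially. \<bar>X j\<bar> * norm c \<le> 1" for c :: 'h
  proof -
    have "(\<lambda>j. \<bar>X j\<bar> * norm c) \<longlonglongrightarrow> \<bar>0\<bar> * norm c" by (intro tendsto_intros X)
    hence "\<forall>\<^sub>F j in sequentially. \<bar>X j\<bar> * norm c < 1" by (rule order_tendstoD) simp
    thus ?thesis by eventually_elim simp
  qed
  have pw: "(\<lambda>j. \<bar>X j\<bar> powr \<sigma> * c) \<longlonglongrightarrow> 0" for c
  proof -
    have "(\<lambda>j. \<bar>X j\<bar> powr \<sigma>) \<longlonglongrightarrow> \<bar>0\<bar> powr \<sigma>"
      using \<sigma> by (intro tendsto_powr2 tendsto_intros X) auto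
    from tendsto_mult_left_zero[OF this[simplified]] show ?thesis by simp
  qed
  have lim: "(\<lambda>j. (hdd \<iota> hs f (y j + X j *\<^sub>R \<iota> c) - hdd \<iota> hs f (y j)) / X j - hdd \<iota> (c # hs) f (y j)) \<longlonglongrightarrow> 0"
    for c y
  proof (rule Lim_null_comparison[OF _ pw])
    show "\<forall>\<^sub>F j in sequentially. norm ((hdd \<iota> hs f (y j + X j *\<^sub>R \<iota> c) - hdd \<iota> hs f (y j)) / X j
          - hdd \<iota> (c # hs) f (y j)) \<le> \<bar>X j\<bar> powr \<sigma> * ((B * norm c powr \<sigma> * norm c) * nprod hs)"
      using small[of c]
    proof eventually_elim
      case (elim j)
      show ?case using quotient_rate[OF hs _ elim, of "y j"] X(2)[of j]
        by (simp add: mult.assoc del: hdd.simps)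
    qed
  qed
  \<comment> \<open>The second step starts at a base point that tends to x; by \<open>Holder\<close>
    the derivative along b at that point tends to the one at x.\<close>
  have lim2: "(\<lambda>j. hdd \<iota> (b # hs) f (x + X j *\<^sub>R \<iota> a) - hdd \<iota> (b # hs) f x) \<longlonglongrightarrow> 0"
  proof (rule Lim_null_comparison[OF _ pw])
    show "\<forall>\<^sub>F j in sequentially. norm (hdd \<iota> (b # hs) f (x + X j *\<^sub>R \<iota> a) - hdd \<iota> (b # hs) f x)
        \<le> \<bar>X j\<bar> powr \<sigma> * (B * norm a powr \<sigma> * nprod (b # hs))"
      using small[of a]
    proof eventually_elim
      case (elim j)
      have "\<bar>hdd \<iota> (b # hs) f (x + \<iota> (X j *\<^sub>R a)) - hdd \<iota> (b # hs) f x\<bar> \<le> B * norm (X j *\<^sub>R a) powr \<sigma> * nprod (b # hs)"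
        by (rule Holder) (use hs elim in simp_all)
      thus ?case by (simp add: scaleR powr_mult mult_ac del: hdd.simps)
    qed
  qed
  define Q where "Q c y j = (hdd \<iota> hs f (y + X j *\<^sub>R \<iota> c) - hdd \<iota> hs f y) / X j" for c y j
  have split: "Q (a + b) x j = Q a x j + Q b (x + X j *\<^sub>R \<iota> a) j" for j
    by (simp add: Q_def add scaleR_right_distrib add.assoc diff_divide_distrib)
  have "(\<lambda>j. (Q (a + b) x j - hdd \<iota> ((a + b) # hs) f x) - (Q a x j - hdd \<iota> (a # hs) f x)
      - (Q b (x + X j *\<^sub>R \<iota> a) j - hdd \<iota> (b # hs) f (x + X j *\<^sub>R \<iota> a))
      - (hdd \<iota> (b # hs) f (x + X j *\<^sub>R \<iota> a) - hdd \<iota> (b # hs) f x)) \<longlonglongrightarrow> 0 - 0 - 0 - 0"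
    unfolding Q_def by (intro tendsto_diff lim lim2)
  hence "(\<lambda>j::nat. hdd \<iota> (a # hs) f x + hdd \<iota> (b # hs) f x - hdd \<iota> ((a + b) # hs) f x) \<longlonglongrightarrow> 0"
    by (simp add: split algebra_simps del: hdd.simps)
  thus "hdd \<iota> ((a + b) # hs) f x = hdd \<iota> (a # hs) f x + hdd \<iota> (b # hs) f x"
    by (simp add: LIMSEQ_const_iff del: hdd.simps)
next
  fix c :: real and a :: 'h
  have "((\<lambda>r. hdd \<iota> hs f (x + r *\<^sub>R \<iota> a)) has_real_derivative hdd \<iota> (a # hs) f x) (at (c * 0))"
    using hdd_deriv[OF diff hs, of x a 0] by (simp del: hdd.simps)
  from DERIV_chain2[OF this DERIV_cmult_Id]
  have "((\<lambda>r. hdd \<iota> hs f (x + r *\<^sub>R \<iota> (c *\<^sub>R a))) has_real_derivative hdd \<iota> (a # hs) f x * c) (at 0)"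
    by (simp add: scaleR mult.commute del: hdd.simps)
  from DERIV_imp_deriv[OF this]
  show "hdd \<iota> ((c *\<^sub>R a) # hs) f x = c *\<^sub>R hdd \<iota> (a # hs) f x"
    by (simp add: mult.commute)
qed

text \<open>The head slot is \<open>linear_first\<close>. For a later slot, linearity holds at every
  point by induction, and differentiating the linear relations in the head direction preserves
  them.\<close>

lemma linear_slot:
  assumes "length hs \<le> n" "i < length hs"
  shows "linear (\<lambda>h. hdd \<iota> (hs[i := h]) f x)"
  using assms
proof (induction hs arbitrary: i x)
  case (Cons k hs)
  show ?case
  proof (cases i)
    case 0
    thus ?thesis using linear_first[of hs x] Cons.prems by (simp del: hdd.simps)
  next
    case (Suc j)
    have len: "length (hs[j := h]) < n" for h using Cons.prems by simp
    have IH: "linear (\<lambda>h. hdd \<iota> (hs[j := h]) f y)" for y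
      using Cons.prems Suc by (intro Cons.IH) auto
    have D: "((\<lambda>t. hdd \<iota> (hs[j := h]) f (x + t *\<^sub>R \<iota> k)) has_real_derivative hdd \<iota> (k # hs[j := h]) f x) (at 0)" for h
      using hdd_deriv[OF diff len[of h], of x k 0] by (simp del: hdd.simps)
    have "linear (\<lambda>h. hdd \<iota> (k # hs[j := h]) f x)"
    proof (rule linearI)
      show "hdd \<iota> (k # hs[j := a + b]) f x = hdd \<iota> (k # hs[j := a]) f x + hdd \<iota> (k # hs[j := b]) f x" for a b
        using DERIV_unique[OF D[of "a + b"]] DERIV_add[OF D[of a] D[of b]]
        unfolding linear_add[OF IH] by blast
      show "hdd \<iota> (k # hs[j := c *\<^sub>R a]) f x = c *\<^sub>R hdd \<iota> (k # hs[j := a]) f x" for a c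
        using DERIV_unique[OF D[of "c *\<^sub>R a"]] DERIV_cmult[OF D[of a], of c]
        unfolding linear_scale[OF IH] real_scaleR_def by blast
    qed
    thus ?thesis using Suc by simp
  qed
qed simp

text \<open>Cut off at length k because \<open>mlin_forms\<close> requires the value 0 on lists of
  any other length.\<close>

definition form :: "nat \<Rightarrow> 'x \<Rightarrow> 'h list \<Rightarrow> real" where
  "form k x hs = (if length hs = k then hdd \<iota> hs f x else 0)"

lemma form_mlin: "k \<le> n \<Longrightarrow> form k x \<in> mlin_forms k"
  by (rule mlin_formsI[of _ _ B]) (use linear_slot bound in \<open>auto simp: form_def\<close>)

text \<open>\<open>quotient_rate\<close> carries the factor \<open>nprod hs\<close>, so the
  convergence is in the norm of k-linear forms.\<close>

lemma form_has_H_derivative: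
  assumes "k < n"
  shows "has_H_derivative \<iota> k (form k) (form (Suc k) x) x"
  unfolding has_H_derivative_def
proof (intro conjI allI)
  show "form (Suc k) x \<in> mlin_forms (Suc k)" using assms by (intro form_mlin) simp
  fix h :: 'h
  let ?r = "\<lambda>t. \<bar>t\<bar> powr \<sigma> * (B * norm h powr \<sigma> * norm h)"
  show "((\<lambda>t. mlin_norm k (\<lambda>hs. (form k (x + t *\<^sub>R \<iota> h) hs - form k x hs) / t - form (Suc k) x (h # hs)))
      \<longlongrightarrow> 0) (at 0)"
  proof (rule tendsto_sandwich[OF _ _ tendsto_const])
    have "((\<lambda>t. \<bar>t\<bar> * norm h) \<longlongrightarrow> \<bar>0\<bar> * norm h) (at (0::real))" by (intro tendsto_intros)
    hence "\<forall>\<^sub>F t in at (0::real). \<bar>t\<bar> * norm h < 1" by (rule order_tendstoD) simp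
    moreover have "\<forall>\<^sub>F t in at (0::real). t \<noteq> 0" by (simp add: eventually_at_filter)
    ultimately show "\<forall>\<^sub>F t in at 0. mlin_norm k (\<lambda>hs. (form k (x + t *\<^sub>R \<iota> h) hs - form k x hs) / t
        - form (Suc k) x (h # hs)) \<le> ennreal (?r t)"
    proof eventually_elim
      case (elim t)
      show ?case
        using quotient_rate[of _ t h x] elim assms
        by (intro mlin_norm_le) (simp add: form_def del: hdd.simps)
    qed
    have "((\<lambda>t::real. \<bar>t\<bar> powr \<sigma>) \<longlongrightarrow> \<bar>0\<bar> powr \<sigma>) (at 0)"
      using \<sigma> by (intro tendsto_powr2 tendsto_intros) auto
    from tendsto_mult_left_zero[OF this[simplified]]
    have "(?r \<longlongrightarrow> 0) (at 0)" by simp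
    thus "((\<lambda>t. ennreal (?r t)) \<longlongrightarrow> 0) (at 0)"
      using tendsto_ennrealI[of ?r 0] by simp
  qed simp
qed

lemma H_deriv_eq: "k \<le> n \<Longrightarrow> H_deriv \<iota> k f = form k"
proof (induction k)
  case 0
  show ?case by (auto simp: form_def fun_eq_iff)
next
  case (Suc k)
  have the_eq: "(THE D. has_H_derivative \<iota> k (form k) D x) = form (Suc k) x" for x
  proof (rule the_equality)
    show "has_H_derivative \<iota> k (form k) (form (Suc k) x) x"
      using Suc.prems by (intro form_has_H_derivative) simp
    thus "D = form (Suc k) x" if "has_H_derivative \<iota> k (form k) D x" for D
      by (rule has_H_derivative_unique[OF that])
  qed
  have IH: "H_deriv \<iota> k f = form k" using Suc by simp
  show ?case by (simp only: H_deriv.simps IH the_eq)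
qed

lemma H_deriv_hdd: "length hs \<le> n \<Longrightarrow> H_deriv \<iota> (length hs) f x hs = hdd \<iota> hs f x"
  by (simp add: H_deriv_eq form_def)

text \<open>The norm consists of the sup norm, n derivative norms and the Hoelder seminorm, each at
  most B.\<close>

lemma H_C_norm_le:
  assumes "frac \<gamma> = \<sigma>" "nat \<lfloor>\<gamma>\<rfloor> = n"
  shows "H_C_norm \<iota> \<gamma> f \<le> ennreal ((real n + 2) * B)"
proof -
  have 1: "(SUP x. ennreal \<bar>f x\<bar>) \<le> ennreal B"
    using bound[of "[]"] by (auto intro!: SUP_least ennreal_leI)
  have 2: "(SUP x. mlin_norm k (H_deriv \<iota> k f x)) \<le> ennreal B" if "k \<le> n" for k
    using bound that by (auto intro!: SUP_least mlin_norm_le simp: H_deriv_eq form_def)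
  have 3: "H_Holder_seminorm \<iota> \<sigma> n (H_deriv \<iota> n f) \<le> ennreal B"
    unfolding H_Holder_seminorm_def
  proof (intro SUP_least)
    fix x and h :: 'h assume "h \<in> - {0}"
    hence h: "norm h powr \<sigma> > 0" by simp
    have "mlin_norm n (\<lambda>hs. H_deriv \<iota> n f (x + \<iota> h) hs - H_deriv \<iota> n f x hs) \<le> ennreal (B * norm h powr \<sigma>)"
      using regular by (intro mlin_norm_le) (simp add: H_deriv_eq form_def H_regular_def)
    hence "mlin_norm n (\<lambda>hs. H_deriv \<iota> n f (x + \<iota> h) hs - H_deriv \<iota> n f x hs) / ennreal (norm h powr \<sigma>)
        \<le> ennreal (B * norm h powr \<sigma>) / ennreal (norm h powr \<sigma>)"
      by (rule divide_right_mono_ennreal)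
    also have "\<dots> = ennreal B" using h B_nonneg by (simp add: divide_ennreal)
    finally show "mlin_norm n (\<lambda>hs. H_deriv \<iota> n f (x + \<iota> h) hs - H_deriv \<iota> n f x hs) / ennreal (norm h powr \<sigma>)
        \<le> ennreal B" .
  qed
  have "(\<Sum>k = 1..n. SUP x. mlin_norm k (H_deriv \<iota> k f x)) \<le> (\<Sum>k = 1..n. ennreal B)"
    by (intro sum_mono 2) simp
  also have "\<dots> = ennreal (real n * B)"
    using B_nonneg by (simp add: ennreal_mult ennreal_of_nat_eq_real_of_nat)
  finally have "H_C_norm \<iota> \<gamma> f \<le> ennreal B + ennreal (real n * B) + ennreal B"
    unfolding H_C_norm_def H_Cn_norm_def assms using 1 3 \<sigma> by (auto intro!: add_mono)
  also have "\<dots> = ennreal ((real n + 2) * B)"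
    using B_nonneg by (simp add: ennreal_plus[symmetric] algebra_simps del: ennreal_plus)
  finally show ?thesis .
qed

end

text \<open>Difference quotients converge at a rate that only depends on the regularity constant, so
  derivatives inherit joint continuity in a parameter.\<close>

lemma hdd_joint_continuous:
  fixes f :: "'z::metric_space \<Rightarrow> 'x::banach \<Rightarrow> real" and \<iota> :: "'h::banach \<Rightarrow> 'x"
  assumes emb: "bounded_linear \<iota>" and \<sigma>: "0 < \<sigma>" "\<sigma> < 1"
    and reg: "\<And>z. z \<in> A \<Longrightarrow> H_regular \<iota> n \<sigma> B (f z)"
    and cont: "continuous_on (A \<times> UNIV) (\<lambda>(z, x). f z x)"
    and "length hs \<le> n"
  shows "continuous_on (A \<times> UNIV) (\<lambda>(z, x). hdd \<iota> hs (f z) x)"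
  using assms(6)
proof (induction hs)
  case Nil
  show ?case using cont by simp
next
  case (Cons h hs)
  hence IH: "continuous_on (A \<times> UNIV) (\<lambda>(z, x). hdd \<iota> hs (f z) x)" by simp
  let ?X = "\<lambda>j. 1 / real (Suc j)"
  let ?Q = "\<lambda>j (z, x). (hdd \<iota> hs (f z) (x + ?X j *\<^sub>R \<iota> h) - hdd \<iota> hs (f z) x) / ?X j"
  have X: "?X \<longlonglongrightarrow> 0" using LIMSEQ_inverse_real_of_nat by (simp add: inverse_eq_divide)
  show ?case
  proof (rule uniform_limit_theorem)
    show "\<forall>\<^sub>F j in sequentially. continuous_on (A \<times> UNIV) (?Q j)"
    proof (rule always_eventually, rule allI)
      fix j
      have "continuous_on (A \<times> UNIV) (\<lambda>p. (\<lambda>(z, x). hdd \<iota> hs (f z) x) (fst p, snd p + ?X j *\<^sub>R \<iota> h))"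
        by (rule continuous_on_compose2[OF IH]) (auto intro!: continuous_intros)
      thus "continuous_on (A \<times> UNIV) (?Q j)"
        using IH by (auto simp: case_prod_unfold intro!: continuous_intros)
    qed
    have "(\<lambda>j. \<bar>?X j\<bar> powr \<sigma>) \<longlonglongrightarrow> \<bar>0\<bar> powr \<sigma>"
      using \<sigma> by (intro tendsto_powr2 tendsto_intros X) auto
    from tendsto_mult_left_zero[OF this[simplified]]
    have lim: "(\<lambda>j. \<bar>?X j\<bar> powr \<sigma> * ((B * norm h powr \<sigma> * norm h) * nprod hs)) \<longlonglongrightarrow> 0" by simp
    have "(\<lambda>j. \<bar>?X j\<bar> * norm h) \<longlonglongrightarrow> \<bar>0\<bar> * norm h" by (intro tendsto_intros X)
    hence ev: "\<forall>\<^sub>F j in sequentially. \<bar>?X j\<bar> * norm h < 1" by (rule order_tendstoD) simp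
    show "uniform_limit (A \<times> UNIV) ?Q (\<lambda>(z, x). hdd \<iota> (h # hs) (f z) x) sequentially"
    proof (rule uniform_limitI)
      fix e :: real assume "e > 0"
      with order_tendstoD(2)[OF lim] have
        "\<forall>\<^sub>F j in sequentially. \<bar>?X j\<bar> powr \<sigma> * ((B * norm h powr \<sigma> * norm h) * nprod hs) < e" by blast
      with ev show "\<forall>\<^sub>F j in sequentially. \<forall>p\<in>A \<times> UNIV. dist (?Q j p) ((\<lambda>(z, x). hdd \<iota> (h # hs) (f z) x) p) < e"
      proof eventually_elim
        case (elim j)
        show ?case
        proof
          fix p assume "p \<in> A \<times> (UNIV :: 'x set)"
          then obtain z x where p: "p = (z, x)" "z \<in> A" by auto
          interpret H_regular_function \<iota> n \<sigma> B "f z"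
            by (rule H_regular_function.intro[OF emb \<sigma> reg[OF p(2)]])
          have "\<bar>?Q j (z, x) - hdd \<iota> (h # hs) (f z) x\<bar> \<le> \<bar>?X j\<bar> powr \<sigma> * (B * norm h powr \<sigma> * norm h) * nprod hs"
            unfolding prod.case by (rule quotient_rate) (use Cons.prems elim in auto)
          thus "dist (?Q j p) ((\<lambda>(z, x). hdd \<iota> (h # hs) (f z) x) p) < e"
            using elim(2) by (simp add: p dist_real_def mult.assoc del: hdd.simps)
        qed
      qed
    qed
  qed simp
qed

section \<open>Passage between \<open>H_regular\<close> and the spaces \<open>H_C\<close>\<close>

lemma H_C_I:
  fixes \<iota> :: "'h::banach \<Rightarrow> 'x::banach"
  assumes emb: "bounded_linear \<iota>" and \<sigma>: "0 < \<sigma>" "\<sigma> < 1" and \<gamma>: "frac \<gamma> = \<sigma>" "nat \<lfloor>\<gamma>\<rfloor> = n"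
    and reg: "H_regular \<iota> n \<sigma> B f" and cont: "continuous_on UNIV f"
  shows "f \<in> H_C \<iota> \<gamma>"
proof -
  interpret H_regular_function \<iota> n \<sigma> B f
    by (rule H_regular_function.intro[OF emb \<sigma> reg])
  have cont': "continuous_on UNIV (hdd \<iota> hs f)" if "length hs \<le> n" for hs
  proof -
    \<comment> \<open>A dummy one-point parameter set reduces continuity of the derivatives in x to
      the joint statement.\<close>
    have "continuous_on ({0::real} \<times> UNIV) (\<lambda>(z, x). f x)"
      unfolding case_prod_unfold
      by (rule continuous_on_compose2[OF cont]) (auto intro!: continuous_intros)
    from hdd_joint_continuous[OF emb \<sigma> reg this that]
    have *: "continuous_on ({0::real} \<times> UNIV) (\<lambda>(z, x). hdd \<iota> hs f x)" .
    have "continuous_on UNIV (\<lambda>x. (\<lambda>(z, x). hdd \<iota> hs f x) (0::real, x))"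
      by (rule continuous_on_compose2[OF *]) (auto intro!: continuous_intros)
    thus ?thesis by simp
  qed
  have bcf: "hdd \<iota> hs f \<in> bcontfun" if "length hs \<le> n" for hs
    by (rule bcontfun_normI[OF cont'[OF that], of "B * nprod hs"]) (use bound[OF that] in simp)
  have "f \<in> H_Cn \<iota> n"
    unfolding H_Cn_def
  proof (intro CollectI conjI allI impI)
    show "f \<in> bcontfun" using bcf[of "[]"] by simp
    show "\<exists>D. has_H_derivative \<iota> k (H_deriv \<iota> k f) D x" if "k < n" for k x
      using form_has_H_derivative[OF that] H_deriv_eq[of k] that by auto
    show "(\<lambda>x. H_deriv \<iota> k f x hs) \<in> bcontfun" if "k \<le> n" "length hs = k" for k hs
      using bcf[of hs] that by (simp add: H_deriv_eq form_def)
  qed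
  moreover have "H_Holder_seminorm \<iota> \<sigma> n (H_deriv \<iota> n f) \<le> H_C_norm \<iota> \<gamma> f"
    using \<sigma> by (simp add: H_C_norm_def \<gamma>)
  hence "H_Holder_seminorm \<iota> \<sigma> n (H_deriv \<iota> n f) < \<top>"
    using H_C_norm_le[OF \<gamma>] by (meson ennreal_less_top le_less_trans)
  ultimately show ?thesis by (simp add: H_C_def \<gamma>)
qed

text \<open>Membership bounds the derivatives only for each fixed list of directions; the uniform
  boundedness principle for multilinear forms makes their norms finite, after which the norm itself
  serves as the regularity constant.\<close>

lemma H_C_D:
  fixes \<iota> :: "'h::banach \<Rightarrow> 'x::banach"
  assumes emb: "bounded_linear \<iota>" and f: "f \<in> H_C \<iota> \<gamma>" and \<sigma>: "frac \<gamma> = \<sigma>" "\<sigma> \<noteq> 0" and n: "nat \<lfloor>\<gamma>\<rfloor> = n"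
  shows "continuous_on UNIV f" "H_C_norm \<iota> \<gamma> f < \<top>"
    "H_regular \<iota> n \<sigma> (enn2real (H_C_norm \<iota> \<gamma> f)) f"
    "\<bar>f x\<bar> \<le> enn2real (H_C_norm \<iota> \<gamma> f)"
proof -
  have Cn: "f \<in> bcontfun" "\<And>k x. k < n \<Longrightarrow> \<exists>D. has_H_derivative \<iota> k (H_deriv \<iota> k f) D x"
      "\<And>k hs. k \<le> n \<Longrightarrow> length hs = k \<Longrightarrow> (\<lambda>x. H_deriv \<iota> k f x hs) \<in> bcontfun"
    and Hol: "H_Holder_seminorm \<iota> \<sigma> n (H_deriv \<iota> n f) < \<top>"
    using f \<sigma> unfolding H_C_def H_Cn_def by (auto simp: n)
  show cont: "continuous_on UNIV f" using Cn(1) by (simp add: bcontfun_def)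
  \<comment> \<open>Existence from \<open>H_Cn\<close> and uniqueness make the \<open>THE\<close> in
    \<open>H_deriv\<close> denote the actual derivative.\<close>
  have deriv: "has_H_derivative \<iota> k (H_deriv \<iota> k f) (H_deriv \<iota> (Suc k) f x) x" if "k < n" for k x
    using theI'[of "\<lambda>D. has_H_derivative \<iota> k (H_deriv \<iota> k f) D x"] Cn(2)[OF that, of x]
      has_H_derivative_unique by (metis H_deriv.simps(2))
  have forms: "H_deriv \<iota> k f x \<in> mlin_forms k" if "k \<le> n" for k x
  proof (cases k)
    case 0
    show ?thesis unfolding 0 by (rule mlin_formsI[of _ _ "\<bar>f x\<bar>"]) auto
  next
    case (Suc j)
    thus ?thesis using deriv[of j x] that by (simp add: has_H_derivative_def del: H_deriv.simps)
  qed
  have zero: "H_deriv \<iota> k f x hs = 0" if "k \<le> n" "0 \<in> set hs" for k x hs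
    by (rule mlin_forms_zero[OF forms[OF that(1)] that(2)])
  define D where "D hs x = H_deriv \<iota> (length hs) f x hs" for hs x
  have D: "((\<lambda>t. D hs (x + t *\<^sub>R \<iota> h)) has_real_derivative D (h # hs) x) (at 0)" if "length hs < n" for hs h x
  proof (cases "0 \<in> set hs")
    case True
    have "D hs y = 0" "D (h # hs) y = 0" for y
      unfolding D_def using that True by (auto intro!: zero simp del: H_deriv.simps)
    thus ?thesis by simp
  next
    case False
    from has_H_derivative_pointwise[OF deriv[OF that] refl False, of x h]
    show ?thesis by (simp add: DERIV_def D_def del: H_deriv.simps)
  qed
  have D0: "D [] = f" by (simp add: D_def fun_eq_iff)
  have diff: "H_diff \<iota> n f" by (rule H_diffI(1)[of D, OF D0 D])
  have hdd: "hdd \<iota> hs f = D hs" if "length hs \<le> n" for hs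
    by (rule H_diffI(2)[of D, OF D0 D that])
  have fin: "(SUP x. mlin_norm k (H_deriv \<iota> k f x)) < \<top>" if "k \<le> n" for k
  proof -
    have "\<exists>B\<ge>0. \<forall>T\<in>range (H_deriv \<iota> k f). \<forall>hs. length hs = k \<longrightarrow> \<bar>T hs\<bar> \<le> B * nprod hs"
    proof (rule mlin_uniform_boundedness)
      show "range (H_deriv \<iota> k f) \<subseteq> mlin_forms k" using forms[OF that] by auto
      fix hs :: "'h list" assume "length hs = k"
      hence "bounded (range (\<lambda>x. H_deriv \<iota> k f x hs))"
        using Cn(3)[OF that] by (auto simp: bcontfun_def)
      thus "\<exists>B. \<forall>T\<in>range (H_deriv \<iota> k f). \<bar>T hs\<bar> \<le> B"
        by (auto simp: bounded_iff)
    qed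
    then obtain B where "B \<ge> 0" "\<And>x hs. length hs = k \<Longrightarrow> \<bar>H_deriv \<iota> k f x hs\<bar> \<le> B * nprod hs"
      by auto
    hence "(SUP x. mlin_norm k (H_deriv \<iota> k f x)) \<le> ennreal B"
      by (intro SUP_least mlin_norm_le) auto
    thus ?thesis by (meson ennreal_less_top le_less_trans)
  qed
  have fin0: "(SUP x. ennreal \<bar>f x\<bar>) < \<top>"
  proof -
    have "bounded (range f)" using Cn(1) by (simp add: bcontfun_def)
    then obtain B where "\<And>x. \<bar>f x\<bar> \<le> B" by (auto simp: bounded_iff)
    hence "(SUP x. ennreal \<bar>f x\<bar>) \<le> ennreal B" by (intro SUP_least ennreal_leI)
    thus ?thesis by (meson ennreal_less_top le_less_trans)
  qed
  show norm_fin: "H_C_norm \<iota> \<gamma> f < \<top>"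
    using fin0 fin Hol \<sigma>
    by (auto simp: H_C_norm_def H_Cn_norm_def n less_top)
  define F where "F = enn2real (H_C_norm \<iota> \<gamma> f)"
  have F: "F \<ge> 0" "ennreal F = H_C_norm \<iota> \<gamma> f" using norm_fin by (auto simp: F_def)
  have le0: "(SUP x. ennreal \<bar>f x\<bar>) \<le> ennreal F"
    unfolding F H_C_norm_def H_Cn_norm_def by (simp add: add.assoc add_increasing2)
  show "\<bar>f x\<bar> \<le> enn2real (H_C_norm \<iota> \<gamma> f)" for x
  proof -
    have "ennreal \<bar>f x\<bar> \<le> ennreal F" by (rule order_trans[OF SUP_upper le0]) simp
    thus ?thesis by (simp only: ennreal_le_iff[OF F(1)] flip: F_def)
  qed
  hence f_le: "\<bar>f x\<bar> \<le> F" for x by (simp add: F_def)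
  have le: "mlin_norm k (H_deriv \<iota> k f x) \<le> ennreal F" if "1 \<le> k" "k \<le> n" for k x
  proof -
    have "mlin_norm k (H_deriv \<iota> k f x) \<le> (SUP x. mlin_norm k (H_deriv \<iota> k f x))"
      by (rule SUP_upper) simp
    also have "\<dots> \<le> (\<Sum>k = 1..n. SUP x. mlin_norm k (H_deriv \<iota> k f x))"
      by (rule member_le_sum) (use that in auto)
    also have "\<dots> \<le> ennreal F"
      unfolding F H_C_norm_def H_Cn_norm_def n by (simp add: add.assoc add_increasing add_increasing2)
    finally show ?thesis .
  qed
  have "H_bound \<iota> k f F" if "k \<le> n" for k
  proof (cases "k = 0")
    case True
    thus ?thesis using f_le by (simp add: H_bound_def)
  next
    case False
    thus ?thesis using that mlin_forms_le[OF forms[OF that] le[OF _ that] F(1)]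
      by (simp add: H_bound_def hdd D_def)
  qed
  moreover have "\<bar>hdd \<iota> hs f (x + \<iota> h) - hdd \<iota> hs f x\<bar> \<le> F * norm h powr \<sigma> * nprod hs"
    if len: "length hs = n" and h: "h \<noteq> 0" for hs x h
  proof (cases "0 \<in> set hs")
    case True
    thus ?thesis using len zero[of n hs] F(1) nprod_nonneg[of hs] by (simp add: hdd D_def)
  next
    case False
    let ?w = "norm h powr \<sigma>"
    let ?m = "mlin_norm n (\<lambda>hs. H_deriv \<iota> n f (x + \<iota> h) hs - H_deriv \<iota> n f x hs)"
    have w: "?w > 0" using h by simp
    have "?m / ennreal ?w \<le> (SUP h\<in>-{0}. mlin_norm n (\<lambda>hs. H_deriv \<iota> n f (x + \<iota> h) hs
        - H_deriv \<iota> n f x hs) / ennreal (norm h powr \<sigma>))"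
      by (rule SUP_upper) (use h in simp)
    also have "\<dots> \<le> H_Holder_seminorm \<iota> \<sigma> n (H_deriv \<iota> n f)"
      unfolding H_Holder_seminorm_def by (rule SUP_upper) simp
    also have "\<dots> \<le> ennreal F"
      unfolding F H_C_norm_def n using \<sigma> by (simp add: add_increasing)
    finally have "?m / ennreal ?w * ennreal ?w \<le> ennreal F * ennreal ?w"
      by (rule mult_right_mono) simp
    also have "?m / ennreal ?w * ennreal ?w = ?m"
      using w unfolding ennreal_divide_times by (subst ennreal_divide_self) auto
    finally have "?m \<le> ennreal (F * ?w)" using F(1) by (simp add: ennreal_mult)
    with le_mlin_norm[OF len False, of "\<lambda>hs. H_deriv \<iota> n f (x + \<iota> h) hs - H_deriv \<iota> n f x hs"]
    have "ennreal (\<bar>H_deriv \<iota> n f (x + \<iota> h) hs - H_deriv \<iota> n f x hs\<bar> / nprod hs) \<le> ennreal (F * ?w)"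
      by (rule order_trans)
    hence "\<bar>H_deriv \<iota> n f (x + \<iota> h) hs - H_deriv \<iota> n f x hs\<bar> / nprod hs \<le> F * ?w"
      using F(1) by (subst (asm) ennreal_le_iff) auto
    thus ?thesis using len nprod_pos[OF False] by (simp add: pos_divide_le_eq hdd D_def)
  qed
  moreover have "\<bar>hdd \<iota> hs f (x + \<iota> h) - hdd \<iota> hs f x\<bar> \<le> F * norm h powr \<sigma> * nprod hs"
    if "h = 0" for hs x h
    using that linear_0[OF bounded_linear.linear[OF emb]] by simp
  ultimately show "H_regular \<iota> n \<sigma> (enn2real (H_C_norm \<iota> \<gamma> f)) f"
    using diff unfolding H_regular_def F_def[symmetric] by blast
qed

section \<open>Regularity of the mild solution\<close>

context mehler_H
begin

text \<open>The time of g and the shifted point \<open>S s x\<close> are put into the metric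
  parameter z of \<open>weak_limit\<close>, so that only the time of the measure is left to weak
  convergence.\<close>

lemma P_tendsto:
  fixes g :: "real \<Rightarrow> 'x \<Rightarrow> real"
  assumes g: "continuous_on UNIV (\<lambda>(r, x). g r x)" "\<And>r x. \<bar>g r x\<bar> \<le> B"
    and s: "\<And>j. s j \<ge> 0" "s0 \<ge> 0" and lim: "(s \<longlongrightarrow> s0) sequentially" "(r \<longlongrightarrow> r0) sequentially" "(x \<longlongrightarrow> x0) sequentially"
  shows "(\<lambda>j. P (s j) (g (r j)) (x j)) \<longlonglongrightarrow> P s0 (g r0) x0"
proof -
  have "(\<lambda>j. LINT y|\<mu> (s j). g (fst (r j, S (s j) (x j))) (snd (r j, S (s j) (x j)) + y))
      \<longlonglongrightarrow> (LINT y|\<mu> s0. g (fst (r0, S s0 x0)) (snd (r0, S s0 x0) + y))"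
  proof (rule weak_limit[where A = "{0..}" and G = "\<lambda>z y. g (fst z) (snd z + y)"])
    show "prob_space (\<mu> t) \<and> sets (\<mu> t) = sets borel" if "t \<in> {0..}" for t
      using prob sets_\<mu> that by auto
    show "(\<lambda>n. LINT x|\<mu> (s n). f x) \<longlonglongrightarrow> (LINT x|\<mu> s0. f x)" if "f \<in> bcontfun" for f :: "'x \<Rightarrow> real"
      by (rule continuous_on_tendsto_compose[OF weak[OF that] lim(1)]) (use s in auto)
    have "(\<lambda>j. (\<lambda>(t, x). S t x) (s j, x j)) \<longlonglongrightarrow> (\<lambda>(t, x). S t x) (s0, x0)"
      by (rule continuous_on_tendsto_compose[OF C0_semigroup_joint_continuous[OF semigroup]
            tendsto_Pair[OF lim(1,3)]]) (use s in auto)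
    thus "(\<lambda>j. (r j, S (s j) (x j))) \<longlonglongrightarrow> (r0, S s0 x0)"
      by (intro tendsto_Pair lim) simp
    have "continuous_on UNIV (\<lambda>p :: (real \<times> 'x) \<times> 'x. (\<lambda>(r, x). g r x) (fst (fst p), snd (fst p) + snd p))"
      by (rule continuous_on_compose2[OF g(1)]) (auto intro!: continuous_intros)
    thus "continuous_on UNIV (\<lambda>(z, y). g (fst z) (snd z + y))"
      by (simp add: case_prod_unfold)
  qed (use s g(2) in auto)
  thus ?thesis by (simp add: mehler_def)
qed

text \<open>The initial datum is already regular, so the derivatives stay on f and no singularity at
  t = 0 appears. Transporting at most n directions and the Hoelder increment by \<open>V t\<close>
  costs at most \<open>M ^ Suc n\<close>.\<close>

lemma P_H_regular:
  assumes f: "f \<in> borel_measurable borel" "H_regular \<iota> n \<sigma> F f" and \<sigma>: "0 \<le> \<sigma>" "\<sigma> \<le> 1"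
    and t: "0 \<le> t" "t \<le> T"
  shows "H_regular \<iota> n \<sigma> (M ^ Suc n * F) (P t f)"
proof -
  have diff: "H_diff \<iota> n f" and bd: "\<And>k. k \<le> n \<Longrightarrow> H_bound \<iota> k f F"
    and Hol: "\<And>hs x h. length hs = n \<Longrightarrow>
        \<bar>hdd \<iota> hs f (x + \<iota> h) - hdd \<iota> hs f x\<bar> \<le> F * norm h powr \<sigma> * nprod hs"
    using f(2) by (auto simp: H_regular_def)
  have "\<bar>f undefined\<bar> \<le> F" using H_boundD[OF bd, of 0 "[]" undefined] by simp
  hence F: "F \<ge> 0" by linarith
  note PP = P_hdd[OF t f(1) diff bd]
  let ?V = "map (V t)"
  have meas: "hdd \<iota> (?V hs) f \<in> borel_measurable borel" if "length hs \<le> n" for hs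
    by (rule hdd_measurable[OF diff f(1)]) (use that in simp)
  have bdV: "\<bar>hdd \<iota> (?V hs) f x\<bar> \<le> F * nprod (?V hs)" if "length hs \<le> n" for hs x
    by (rule H_boundD[OF bd[OF that]]) simp
  have nV: "nprod (?V hs) \<le> M ^ length hs * nprod hs" for hs by (rule nprod_V_le[OF t])
  have "H_bound \<iota> k (P t f) (M ^ Suc n * F)" if "k \<le> n" for k
    unfolding H_bound_def
  proof (intro allI impI)
    fix hs :: "'h list" and x assume k: "length hs = k"
    have "\<bar>P t (hdd \<iota> (?V hs) f) x\<bar> \<le> F * nprod (?V hs)"
      by (rule P_le[OF t(1) meas bdV]) (use k that in auto)
    also have "\<dots> \<le> F * (M ^ k * nprod hs)"
      using nV[of hs] k by (intro mult_left_mono F) simp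
    also have "\<dots> \<le> F * (M ^ Suc n * nprod hs)"
      using M that by (intro mult_left_mono mult_right_mono F nprod_nonneg power_increasing) auto
    finally show "\<bar>hdd \<iota> hs (P t f) x\<bar> \<le> M ^ Suc n * F * nprod hs"
      using PP(2)[of hs] k that by (simp add: mult_ac)
  qed
  moreover have "\<bar>hdd \<iota> hs (P t f) (x + \<iota> h) - hdd \<iota> hs (P t f) x\<bar> \<le> M ^ Suc n * F * norm h powr \<sigma> * nprod hs"
    if len: "length hs = n" for hs x h
  proof -
    let ?\<psi> = "hdd \<iota> (?V hs) f"
    have m: "?\<psi> \<in> borel_measurable borel" by (rule meas) (use len in simp)
    have b: "\<bar>?\<psi> x\<bar> \<le> F * nprod (?V hs)" for x by (rule bdV) (use len in simp)
    have eq: "hdd \<iota> hs (P t f) = P t ?\<psi>" by (rule PP(2)) (use len in simp_all)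
    have "hdd \<iota> hs (P t f) (x + \<iota> h) - hdd \<iota> hs (P t f) x = P t (\<lambda>z. ?\<psi> (z + \<iota> (V t h)) - ?\<psi> z) x"
      unfolding eq P_shift_eq[OF t]
      by (rule P_diff[OF t(1) measurable_translate_right[OF m] b m b])
    also have "\<bar>\<dots>\<bar> \<le> F * norm (V t h) powr \<sigma> * nprod (?V hs)"
      by (rule P_le[OF t(1) borel_measurable_diff[OF measurable_translate_right[OF m] m] Hol])
        (use len in simp)
    also have "\<dots> \<le> F * (M * norm h powr \<sigma>) * (M ^ n * nprod hs)"
      using nV[of hs] len M
      by (intro mult_mono mult_left_mono norm_V_powr_le \<sigma> t F mult_nonneg_nonneg nprod_nonneg) auto
    finally show ?thesis by (simp add: mult_ac)
  qed
  ultimately show ?thesis using PP(1) by (auto simp: H_regular_def)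
qed

text \<open>A continuous extension of g to all real times, since \<open>P_tendsto\<close> asks for
  continuity on the whole space.\<close>

definition clamp_time :: "(real \<Rightarrow> 'x \<Rightarrow> real) \<Rightarrow> real \<Rightarrow> 'x \<Rightarrow> real" where
  "clamp_time g r = g (max 0 (min T r))"

lemma clamp_time_eq: "r \<in> {0..T} \<Longrightarrow> clamp_time g r = g r"
  by (simp add: clamp_time_def)

lemma clamp_time_continuous:
  assumes "continuous_on ({0..T} \<times> UNIV) (\<lambda>(r, x). g r x)"
  shows "continuous_on UNIV (\<lambda>(r, x). clamp_time g r x)"
proof -
  have "continuous_on UNIV (\<lambda>p :: real \<times> 'x. (\<lambda>(r, x). g r x) (max 0 (min T (fst p)), snd p))"
    by (rule continuous_on_compose2[OF assms]) (use T in \<open>auto intro!: continuous_intros\<close>)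
  thus ?thesis by (simp add: clamp_time_def case_prod_unfold)
qed

lemma convolution_measurable:
  assumes g: "continuous_on ({0..T} \<times> UNIV) (\<lambda>(r, x). g r x)"
    "\<And>r x. r \<in> {0..T} \<Longrightarrow> \<bar>g r x\<bar> \<le> B" and t: "t \<le> T"
  shows "(\<lambda>s. P s (g (t - s)) x) \<in> borel_measurable (interval_measure t)"
proof -
  have B: "\<bar>clamp_time g r x\<bar> \<le> B" for r x
    using T by (auto simp: clamp_time_def intro!: g(2))
  have "continuous_on {0..} (\<lambda>s. P s (clamp_time g (t - s)) x)"
    unfolding continuous_on_sequentially o_def
    by (intro allI ballI impI P_tendsto[OF clamp_time_continuous[OF g(1)] B]) (auto intro!: tendsto_intros)
  hence "continuous_on {0<..t} (\<lambda>s. P s (clamp_time g (t - s)) x)"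
    by (rule continuous_on_subset) auto
  hence "continuous_on {0<..t} (\<lambda>s. P s (g (t - s)) x)"
    by (rule continuous_on_eq) (use t in \<open>auto simp: clamp_time_eq\<close>)
  thus ?thesis
    by (subst borel_measurable_restrict_space_iff)
      (auto dest: borel_measurable_continuous_on_indicator[rotated, of "{0<..t}"])
qed

text \<open>Dominated convergence on a fixed interval, the moving upper limit being encoded in the
  indicator function.\<close>

lemma convolution_tendsto:
  assumes g: "continuous_on ({0..T} \<times> UNIV) (\<lambda>(r, x). g r x)"
    "\<And>r x. r \<in> {0..T} \<Longrightarrow> \<bar>g r x\<bar> \<le> B"
    and t: "\<And>j. t j \<in> {0..T}" "t0 \<in> {0..T}" and lim: "t \<longlonglongrightarrow> t0" "x \<longlonglongrightarrow> x0"
  shows "(\<lambda>j. LINT s|interval_measure (t j). P s (g (t j - s)) (x j))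
           \<longlonglongrightarrow> (LINT s|interval_measure t0. P s (g (t0 - s)) x0)"
  unfolding integral_interval_measure
proof (rule integral_dominated_convergence[where w = "\<lambda>s. B * indicator {0..T} s"])
  have B: "\<bar>clamp_time g r x\<bar> \<le> B" for r x
    using T by (auto simp: clamp_time_def intro!: g(2))
  have B0: "B \<ge> 0" using B[of 0 0] by linarith
  have meas: "(\<lambda>s. indicator {0<..t} s * P s (g (t - s)) x) \<in> borel_measurable lborel" if "t \<in> {0..T}" for t x
  proof -
    have "(\<lambda>s. P s (g (t - s)) x) \<in> borel_measurable (interval_measure t)"
      by (rule convolution_measurable[OF g]) (use that in auto)
    thus ?thesis by (subst (asm) borel_measurable_restrict_space_iff) auto
  qed
  show "(\<lambda>s. indicator {0<..t0} s * P s (g (t0 - s)) x0) \<in> borel_measurable lborel"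
    "(\<lambda>s. indicator {0<..t j} s * P s (g (t j - s)) (x j)) \<in> borel_measurable lborel" for j
    by (rule meas[OF t(2)], rule meas[OF t(1)])
  show "integrable lborel (\<lambda>s. B * indicator {0..T} s)"
    using T by (intro integrable_mult_right) (auto intro!: integrable_real_indicator)
  have g_cont: "continuous_on UNIV (g r)" if "r \<in> {0..T}" for r
  proof -
    have "continuous_on UNIV (\<lambda>x. (\<lambda>(r, x). g r x) (r, x))"
      by (rule continuous_on_compose2[OF g(1)]) (use that in \<open>auto intro!: continuous_intros\<close>)
    thus ?thesis by simp
  qed
  show "AE s in lborel. norm (indicator {0<..t j} s * P s (g (t j - s)) (x j)) \<le> B * indicator {0..T} s" for j
  proof (rule AE_I2)
    fix s
    show "norm (indicator {0<..t j} s * P s (g (t j - s)) (x j)) \<le> B * indicator {0..T} s"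
    proof (cases "s \<in> {0<..t j}")
      case True
      hence s: "0 \<le> s" "s \<le> T" "t j - s \<in> {0..T}" using t(1)[of j] by auto
      have "\<bar>P s (g (t j - s)) (x j)\<bar> \<le> B"
        by (rule P_le[OF s(1) borel_measurable_continuous_onI[OF g_cont[OF s(3)]] g(2)[OF s(3)]])
      thus ?thesis using True s by simp
    qed (use B0 in \<open>auto simp: indicator_def\<close>)
  qed
  \<comment> \<open>Away from \<open>t0\<close> the indicator of the moving interval is eventually
    constant; \<open>t0\<close> itself is a null set.\<close>
  have "AE s in lborel. s \<noteq> t0" by (rule AE_lborel_singleton)
  thus "AE s in lborel. (\<lambda>j. indicator {0<..t j} s * P s (g (t j - s)) (x j))
      \<longlonglongrightarrow> indicator {0<..t0} s * P s (g (t0 - s)) x0"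
  proof eventually_elim
    case (elim s)
    consider "s \<le> 0" | "0 < s" "s < t0" | "t0 < s" using elim by linarith
    thus ?case
    proof cases
      case 1
      thus ?thesis by simp
    next
      case 2
      have P: "(\<lambda>j. P s (clamp_time g (t j - s)) (x j)) \<longlonglongrightarrow> P s (clamp_time g (t0 - s)) x0"
        using 2 by (intro P_tendsto[OF clamp_time_continuous[OF g(1)] B] tendsto_intros lim) auto
      have "\<forall>\<^sub>F j in sequentially. s < t j" using lim(1) 2(2) by (rule order_tendstoD)
      hence "\<forall>\<^sub>F j in sequentially. P s (clamp_time g (t j - s)) (x j)
          = indicator {0<..t j} s * P s (g (t j - s)) (x j)"
      proof eventually_elim
        case (elim j)
        thus ?case using 2 t(1)[of j] by (simp add: clamp_time_eq)
      qed
      from Lim_transform_eventually[OF P this] show ?thesis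
        using 2 t(2) by (simp add: clamp_time_eq)
    next
      case 3
      have "\<forall>\<^sub>F j in sequentially. t j < s" using lim(1) 3 by (rule order_tendstoD)
      hence "\<forall>\<^sub>F j in sequentially. 0 = indicator {0<..t j} s * P s (g (t j - s)) (x j)"
        by eventually_elim simp
      from Lim_transform_eventually[OF tendsto_const this] show ?thesis using 3 by simp
    qed
  qed
qed

text \<open>The reflection s \<mapsto> t - s moves the singularity from the moving endpoint t to
  0.\<close>

lemma mild_solution_eq:
  assumes "t \<ge> 0" and meas: "(\<lambda>s. P s (g (t - s)) x) \<in> borel_measurable (interval_measure t)"
  shows "mild_solution S \<mu> f g t x = P t f x + (LINT s|interval_measure t. P s (g (t - s)) x)"
proof -
  have meas': "(\<lambda>s. indicator {0<..t} s * P s (g (t - s)) x) \<in> borel_measurable lborel"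
    using meas by (subst (asm) borel_measurable_restrict_space_iff) auto
  \<comment> \<open>The endpoint s = 0 is split off as a single term, so that measurability of the
    closed-interval integrand follows from the half-open one.\<close>
  have split: "indicator {0..t} (t - s) * P s (g (t - s)) x
      = indicator {0<..t} s * P s (g (t - s)) x + indicator {0} s * P 0 (g t) x" for s
    using assms(1) by (auto simp: indicator_def)
  have "(LINT s:{0..t}|lborel. P (t - s) (g s) x) = (LINT s|lborel. indicator {0..t} s * P (t - s) (g s) x)"
    by (simp add: set_lebesgue_integral_def)
  also have "\<dots> = (LINT s|lborel. indicator {0..t} (t - s) * P s (g (t - s)) x)"
    using lborel_integral_real_affine[of "-1" "\<lambda>s. indicator {0..t} s * P (t - s) (g s) x" t] by simp
  also have "\<dots> = (LINT s|lborel. indicator {0<..t} s * P s (g (t - s)) x)"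
  proof (rule integral_cong_AE)
    show "(\<lambda>s. indicator {0..t} (t - s) * P s (g (t - s)) x) \<in> borel_measurable lborel"
      unfolding split by (intro borel_measurable_add meas' borel_measurable_times) auto
    have "AE s in lborel. s \<noteq> (0::real)" by (rule AE_lborel_singleton)
    thus "AE s in lborel. indicator {0..t} (t - s) * P s (g (t - s)) x = indicator {0<..t} s * P s (g (t - s)) x"
      by eventually_elim (auto simp: indicator_def)
  qed (rule meas')
  finally show ?thesis by (simp add: mild_solution_def integral_interval_measure)
qed

text \<open>The common form of both parts of the theorem, the hypothesis on g being expressed by
  \<open>Hol\<close> with \<alpha> = 0 allowed. It joins the transport estimate for the initial
  datum with the convolution estimates and translates the result into
  \<open>H_C_time\<close>.\<close>

lemma mild_solution_regularity:
  assumes \<alpha>: "0 \<le> \<alpha>" "\<alpha> < 1" and \<gamma>: "\<gamma> = \<alpha> + 1 / \<theta>" "\<gamma> \<notin> \<nat>"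
  shows "\<exists>C>0. \<forall>f g G. f \<in> H_C \<iota> \<gamma> \<and> g \<in> Cb_time T \<and> (\<forall>s\<in>{0..T}. Hol \<alpha> (g s) G) \<longrightarrow>
      mild_solution S \<mu> f g \<in> H_C_time \<iota> T \<gamma> \<and>
      H_C_time_norm \<iota> T \<gamma> (mild_solution S \<mu> f g) \<le> ennreal (C * (enn2real (H_C_norm \<iota> \<gamma> f) + G))"
proof -
  define n where "n = nat \<lfloor>\<gamma>\<rfloor>"
  define \<sigma> where "\<sigma> = frac \<gamma>"
  have "\<gamma> > 0" using \<alpha> \<gamma> \<theta> by (simp add: add_nonneg_pos)
  hence n: "real n = of_int \<lfloor>\<gamma>\<rfloor>" by (simp add: n_def)
  hence \<sigma>_eq: "\<sigma> = \<alpha> + 1 / \<theta> - real n" by (simp add: \<sigma>_def frac_def \<gamma>)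
  have "\<sigma> \<noteq> 0"
    using \<gamma>(2) n by (metis \<sigma>_def frac_def diff_eq_diff_eq diff_self eq_iff_diff_eq_0 of_nat_in_Nats)
  hence \<sigma>: "0 < \<sigma>" "\<sigma> < 1" using frac_ge_0[of \<gamma>] frac_lt_1[of \<gamma>] by (auto simp: \<sigma>_def)
  have n_bounds: "real n < \<alpha> + 1 / \<theta>" "\<alpha> + 1 / \<theta> < real n + 1"
    using \<sigma> \<sigma>_eq by auto
  note \<gamma>n = \<sigma>_def[symmetric] n_def[symmetric]
  obtain C0 where C0: "C0 > 0" and conv: "\<And>g G t. 0 \<le> t \<Longrightarrow> t \<le> T \<Longrightarrow> (\<forall>s\<in>{0..T}. Hol \<alpha> (g s) G) \<Longrightarrow>
    (\<forall>x. (\<lambda>s. P s (g (t - s)) x) \<in> borel_measurable (interval_measure t)) \<Longrightarrow>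
      H_regular \<iota> n \<sigma> (C0 * G) (\<lambda>x. LINT s|interval_measure t. P s (g (t - s)) x)"
    using convolution_estimates[OF \<alpha> n_bounds \<sigma>_eq] unfolding Let_def H_regular_def by blast
  \<comment> \<open>One summand for \<open>P t f\<close>, one for the integral; the factor n + 2 in
    the final constant is that of \<open>H_C_norm_le\<close>.\<close>
  define C1 where "C1 = M ^ Suc n + C0"
  have C1: "C1 > 0" using C0 M by (simp add: C1_def add_pos_pos)
  have main: "mild_solution S \<mu> f g \<in> H_C_time \<iota> T \<gamma> \<and>
      H_C_time_norm \<iota> T \<gamma> (mild_solution S \<mu> f g)
        \<le> ennreal ((real n + 2) * C1 * (enn2real (H_C_norm \<iota> \<gamma> f) + G))"
    if f: "f \<in> H_C \<iota> \<gamma>" and g: "g \<in> Cb_time T" and Hol: "\<forall>s\<in>{0..T}. Hol \<alpha> (g s) G" for f g G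
  proof -
    define F where "F = enn2real (H_C_norm \<iota> \<gamma> f)"
    define v where "v = mild_solution S \<mu> f g"
    define B where "B = C1 * (F + G)"
    note fD = H_C_D[OF embedding f \<gamma>n(1) \<open>\<sigma> \<noteq> 0\<close> \<gamma>n(2), folded F_def]
    have F: "F \<ge> 0" by (simp add: F_def)
    have G: "G \<ge> 0" using Hol T HolD(4)[of \<alpha> "g 0" G] by simp
    have g_cont: "continuous_on ({0..T} \<times> UNIV) (\<lambda>(t, x). g t x)" using g by (simp add: Cb_time_def)
    have g_bd: "\<bar>g r x\<bar> \<le> G" if "r \<in> {0..T}" for r x using Hol HolD(2) that by blast
    have f_meas: "f \<in> borel_measurable borel" by (rule borel_measurable_continuous_onI[OF fD(1)])
    have meas: "(\<lambda>s. P s (g (t - s)) x) \<in> borel_measurable (interval_measure t)" if "t \<in> {0..T}" for t x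
      by (rule convolution_measurable[OF g_cont g_bd]) (use that in auto)
    have v_eq: "v t = (\<lambda>x. P t f x + (LINT s|interval_measure t. P s (g (t - s)) x))" if "t \<in> {0..T}" for t
      unfolding v_def by (rule ext, rule mild_solution_eq[OF _ meas[OF that]]) (use that in simp)
    have reg: "H_regular \<iota> n \<sigma> B (v t)" if t: "t \<in> {0..T}" for t
    proof -
      have "H_regular \<iota> n \<sigma> (M ^ Suc n * F + C0 * G)
          (\<lambda>x. P t f x + (LINT s|interval_measure t. P s (g (t - s)) x))"
        using t \<sigma> by (intro H_regular_add P_H_regular[OF f_meas fD(3)] conv Hol allI meas) auto
      moreover have "M ^ Suc n * F + C0 * G \<le> B"
        using F G C0 M by (simp add: B_def C1_def algebra_simps)
      ultimately show ?thesis
        unfolding v_eq[OF t] by (rule H_regular_mono)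
    qed
    have cont: "continuous_on ({0..T} \<times> UNIV) (\<lambda>(t, x). v t x)"
      unfolding continuous_on_sequentially o_def
    proof (intro allI ballI impI)
      fix p :: "nat \<Rightarrow> real \<times> 'x" and a :: "real \<times> 'x"
      assume a: "a \<in> {0..T} \<times> UNIV" and p: "(\<forall>j. p j \<in> {0..T} \<times> UNIV) \<and> p \<longlonglongrightarrow> a"
      define t x where "t j = fst (p j)" and "x j = snd (p j)" for j
      have lim: "t \<longlonglongrightarrow> fst a" "x \<longlonglongrightarrow> snd a"
        using p by (auto simp: t_def[abs_def] x_def[abs_def] intro!: tendsto_fst tendsto_snd)
      have t: "t j \<in> {0..T}" "fst a \<in> {0..T}" for j using a p by (auto simp: t_def mem_Times_iff)
      have "continuous_on UNIV (\<lambda>(r :: real, x). f x)"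
        unfolding case_prod_unfold by (rule continuous_on_compose2[OF fD(1)]) (auto intro!: continuous_intros)
      from P_tendsto[OF this fD(4) _ _ lim(1) tendsto_const lim(2)] t
      have "(\<lambda>j. P (t j) f (x j)) \<longlonglongrightarrow> P (fst a) f (snd a)" by auto
      from tendsto_add[OF this convolution_tendsto[OF g_cont g_bd t lim]]
      show "(\<lambda>j. case p j of (t, x) \<Rightarrow> v t x) \<longlonglongrightarrow> (case a of (t, x) \<Rightarrow> v t x)"
        using v_eq[OF t(1)] v_eq[OF t(2)] by (simp add: t_def x_def case_prod_unfold)
    qed
    have cont_x: "continuous_on UNIV (v t)" if "t \<in> {0..T}" for t
    proof -
      have "continuous_on UNIV (\<lambda>x. (\<lambda>(t, x). v t x) (t, x))"
        by (rule continuous_on_compose2[OF cont]) (use that in \<open>auto intro!: continuous_intros\<close>)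
      thus ?thesis by simp
    qed
    have rf: "H_regular_function \<iota> n \<sigma> B (v t)" if "t \<in> {0..T}" for t
      by (rule H_regular_function.intro[OF embedding \<sigma> reg[OF that]])
    have HC: "v t \<in> H_C \<iota> \<gamma>" if "t \<in> {0..T}" for t
      by (rule H_C_I[OF embedding \<sigma> \<gamma>n reg[OF that] cont_x[OF that]])
    have norm: "H_C_time_norm \<iota> T \<gamma> v \<le> ennreal ((real n + 2) * B)"
      unfolding H_C_time_norm_def
      by (rule SUP_least) (rule H_regular_function.H_C_norm_le[OF rf \<gamma>n])
    have "v \<in> Cb_time T"
    proof -
      have "\<bar>v t x\<bar> \<le> B" if "t \<in> {0..T}" for t x
        using H_regular_function.bound[OF rf[OF that], of "[]" x] by simp
      hence "bounded ((\<lambda>(t, x). v t x) ` ({0..T} \<times> UNIV))"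
        unfolding bounded_iff by (intro exI[of _ B]) auto
      thus ?thesis using cont by (simp add: Cb_time_def)
    qed
    moreover have "continuous_on ({0..T} \<times> UNIV) (\<lambda>(t, x). H_deriv \<iota> k (v t) x hs)"
      if k: "k \<le> n" "length hs = k" for k hs
    proof -
      have hs: "length hs \<le> n" using k by simp
      have "continuous_on ({0..T} \<times> UNIV) (\<lambda>(t, x). hdd \<iota> hs (v t) x)"
        by (rule hdd_joint_continuous[OF embedding \<sigma> reg cont hs])
      moreover have "(\<lambda>(t, x). H_deriv \<iota> k (v t) x hs) p = (\<lambda>(t, x). hdd \<iota> hs (v t) x) p"
        if "p \<in> {0..T} \<times> UNIV" for p
        using H_regular_function.H_deriv_hdd[OF rf hs] that k by auto
      ultimately show ?thesis by (simp cong: continuous_on_cong)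
    qed
    moreover have "H_C_time_norm \<iota> T \<gamma> v < \<top>"
      using norm by (meson ennreal_less_top le_less_trans)
    ultimately show ?thesis
      using HC norm unfolding v_def[symmetric] F_def[symmetric]
      by (auto simp: H_C_time_def B_def \<gamma>n mult.assoc)
  qed
  have "(real n + 2) * C1 > 0" using C1 by simp
  thus ?thesis using main by blast
qed

end

theorem theorem3p12:
  fixes S :: "real \<Rightarrow> 'x::{banach, second_countable_topology} \<Rightarrow>\<^sub>L 'x"
    and \<mu> :: "real \<Rightarrow> 'x measure"
    and Ht :: "real \<Rightarrow> 'x set"
    and \<iota> :: "'h::banach \<Rightarrow> 'x"
    and M K \<theta> \<omega> T :: real
  assumes semigroup: "C0_semigroup S"
    and measures: "mehler_measures S \<mu>"
    and Ht_subspace: "\<And>t. t > 0 \<Longrightarrow> subspace (Ht t) \<and> Ht t \<noteq> {0}"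
    and Ht_fomin: "\<And>t h. t > 0 \<Longrightarrow> h \<in> Ht t \<Longrightarrow> fomin_differentiable (\<mu> t) h"
    and embedding: "bounded_linear \<iota>" "inj \<iota>"
    and constants: "M > 0" "K > 0" "\<theta> > 0"
    and S_on_H: "\<And>t h. t > 0 \<Longrightarrow> \<exists>k. S t (\<iota> h) = \<iota> k \<and> norm k \<le> M * exp (\<omega> * t) * norm h"
    and S_into_Ht: "\<And>t h. t > 0 \<Longrightarrow> S t (\<iota> h) \<in> Ht t"
    and density_bound: "\<And>t h. t > 0 \<Longrightarrow>
          \<exists>\<beta>. fomin_density (\<mu> t) (S t (\<iota> h)) \<beta> \<and>
              (LINT x|\<mu> t. \<bar>\<beta> x\<bar>) \<le> K * exp (\<omega> * t) * t powr (- \<theta>) * norm h"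
    and T_pos: "T > 0"
  shows "(1 / \<theta> \<notin> \<nat> \<longrightarrow>
           (\<exists>C>0. \<forall>f g. f \<in> H_C \<iota> (1 / \<theta>) \<and> g \<in> Cb_time T \<longrightarrow>
              mild_solution S \<mu> f g \<in> H_C_time \<iota> T (1 / \<theta>) \<and>
              H_C_time_norm \<iota> T (1 / \<theta>) (mild_solution S \<mu> f g)
                \<le> ennreal C * (H_C_norm \<iota> (1 / \<theta>) f + Cb_time_norm T g))) \<and>
         (\<forall>\<alpha>. 0 < \<alpha> \<and> \<alpha> < 1 \<and> \<alpha> + 1 / \<theta> \<notin> \<nat> \<longrightarrow>
           (\<exists>C>0. \<forall>f g. f \<in> H_C \<iota> (\<alpha> + 1 / \<theta>) \<and> g \<in> H_C_time \<iota> T \<alpha> \<longrightarrow>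
              mild_solution S \<mu> f g \<in> H_C_time \<iota> T (\<alpha> + 1 / \<theta>) \<and>
              H_C_time_norm \<iota> T (\<alpha> + 1 / \<theta>) (mild_solution S \<mu> f g)
                \<le> ennreal C * (H_C_norm \<iota> (\<alpha> + 1 / \<theta>) f + H_C_time_norm \<iota> T \<alpha> g)))"
proof -
  \<comment> \<open>Bounds \<open>exp (\<omega> * t)\<close> on the whole interval for either sign
    of \<omega>; this is where the constants acquire their dependence on T.\<close>
  define E where "E = exp (\<bar>\<omega>\<bar> * T)"
  \<comment> \<open>The hypotheses concern t > 0 only; at t = 0 the semigroup is the identity, which
    calls for the constant 1.\<close>
  define V where "V t h = (if t = 0 then h
      else SOME k. S t (\<iota> h) = \<iota> k \<and> norm k \<le> M * exp (\<omega> * t) * norm h)" for t h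
  have exp_le: "exp (\<omega> * t) \<le> E" if "0 \<le> t" "t \<le> T" for t
  proof -
    have "\<omega> * t \<le> \<bar>\<omega>\<bar> * t" using that by (intro mult_right_mono) auto
    also have "\<dots> \<le> \<bar>\<omega>\<bar> * T" using that by (intro mult_left_mono) auto
    finally show ?thesis by (simp add: E_def)
  qed
  have V: "S t (\<iota> h) = \<iota> (V t h)" "norm (V t h) \<le> M * exp (\<omega> * t) * norm h" if "t > 0" for t h
    using someI_ex[OF S_on_H[OF that, of h]] that by (auto simp: V_def)
  \<comment> \<open>The maximum with 1 covers t = 0 and meets the requirement M \<ge> 1 of the
    locale.\<close>
  interpret mehler_H S \<mu> \<iota> V "max 1 (M * E)" "K * E" \<theta> T
  proof (rule mehler_H.intro)
    show "K * E > 0" using constants by (simp add: E_def)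
    fix t and h :: 'h assume t: "0 \<le> t" "t \<le> T"
    show "S t (\<iota> h) = \<iota> (V t h)"
    proof (cases "t = 0")
      case True
      thus ?thesis using semigroup by (simp add: C0_semigroup_def V_def)
    qed (use V(1) t in auto)
    show "norm (V t h) \<le> max 1 (M * E) * norm h"
    proof (cases "t = 0")
      case True
      thus ?thesis using mult_right_mono[of 1 "max 1 (M * E)" "norm h"] by (simp add: V_def)
    next
      case False
      hence "norm (V t h) \<le> M * exp (\<omega> * t) * norm h" using V(2) t by simp
      also have "\<dots> \<le> max 1 (M * E) * norm h"
        using exp_le[OF t] constants
        by (intro mult_right_mono max.coboundedI2 mult_left_mono) auto
      finally show ?thesis .
    qed
  next
    fix t and h :: 'h assume t: "0 < t" "t \<le> T"
    obtain \<beta> where \<beta>: "fomin_density (\<mu> t) (S t (\<iota> h)) \<beta>"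
        "(LINT x|\<mu> t. \<bar>\<beta> x\<bar>) \<le> K * exp (\<omega> * t) * t powr (- \<theta>) * norm h"
      using density_bound[OF t(1)] by blast
    have "K * exp (\<omega> * t) * t powr (- \<theta>) * norm h \<le> K * E * t powr (- \<theta>) * norm h"
      using exp_le[of t] t constants by (intro mult_right_mono mult_left_mono) auto
    with \<beta> show "\<exists>\<beta>. fomin_density (\<mu> t) (S t (\<iota> h)) \<beta> \<and>
        (LINT x|\<mu> t. \<bar>\<beta> x\<bar>) \<le> K * E * t powr (- \<theta>) * norm h"
      by (meson order_trans)
  qed (use semigroup measures embedding constants T_pos in auto)
  have enn2real_le: "ennreal (enn2real e) \<le> e" for e
    by (cases e) auto
  have final: "ennreal (C * (F + 2 * G)) \<le> ennreal (2 * C) * (ennreal F + ennreal G)"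
    if "C > 0" "F \<ge> 0" "G \<ge> 0" for C F G
  proof -
    have "C * (F + 2 * G) \<le> 2 * C * (F + G)" using that by (simp add: algebra_simps)
    hence "ennreal (C * (F + 2 * G)) \<le> ennreal (2 * C * (F + G))" by (rule ennreal_leI)
    also have "\<dots> = ennreal (2 * C) * (ennreal F + ennreal G)"
      using that by (subst ennreal_mult) (auto simp: ennreal_plus)
    finally show ?thesis .
  qed
  show ?thesis
  proof (intro conjI allI impI)
    assume "1 / \<theta> \<notin> \<nat>"
    then obtain C where C: "C > 0" "\<And>f g G. f \<in> H_C \<iota> (1 / \<theta>) \<Longrightarrow> g \<in> Cb_time T \<Longrightarrow>
        (\<forall>s\<in>{0..T}. Hol 0 (g s) G) \<Longrightarrow> mild_solution S \<mu> f g \<in> H_C_time \<iota> T (1 / \<theta>) \<and>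
        H_C_time_norm \<iota> T (1 / \<theta>) (mild_solution S \<mu> f g)
          \<le> ennreal (C * (enn2real (H_C_norm \<iota> (1 / \<theta>) f) + G))"
      using mild_solution_regularity[of 0 "1 / \<theta>"] by auto
    have "mild_solution S \<mu> f g \<in> H_C_time \<iota> T (1 / \<theta>) \<and>
        H_C_time_norm \<iota> T (1 / \<theta>) (mild_solution S \<mu> f g)
          \<le> ennreal (2 * C) * (H_C_norm \<iota> (1 / \<theta>) f + Cb_time_norm T g)"
      if f: "f \<in> H_C \<iota> (1 / \<theta>)" and g: "g \<in> Cb_time T" for f g
    proof -
      define G where "G = enn2real (Cb_time_norm T g)"
      obtain B where B: "\<And>t x. t \<in> {0..T} \<Longrightarrow> \<bar>g t x\<bar> \<le> B"
        using g by (fastforce simp: Cb_time_def bounded_iff)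
      have "Cb_time_norm T g \<le> ennreal B"
        unfolding Cb_time_norm_def by (intro SUP_least ennreal_leI B)
      hence fin: "Cb_time_norm T g < \<top>" by (meson ennreal_less_top le_less_trans)
      hence G: "G \<ge> 0" "ennreal G = Cb_time_norm T g" by (auto simp: G_def)
      have bd: "\<bar>g s x\<bar> \<le> G" if "s \<in> {0..T}" for s x
      proof -
        have "ennreal \<bar>g s x\<bar> \<le> ennreal G"
          unfolding G Cb_time_norm_def by (rule SUP_upper2[OF that], rule SUP_upper) simp
        thus ?thesis using G(1) by (subst (asm) ennreal_le_iff)
      qed
      \<comment> \<open>Two values of g differ by at most twice its sup norm. At h = 0, where
        \<open>0 powr 0 = 0\<close>, the increment is 0 as well.\<close>
      have "Hol 0 (g s) (2 * G)" if s: "s \<in> {0..T}" for s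
        unfolding Hol_def
      proof (intro conjI allI)
        have "continuous_on UNIV (\<lambda>x. (\<lambda>(t, x). g t x) (s, x))"
          by (rule continuous_on_compose2[of "{0..T} \<times> UNIV"])
            (use g s in \<open>auto simp: Cb_time_def intro!: continuous_intros\<close>)
        thus "g s \<in> borel_measurable borel" by (simp add: borel_measurable_continuous_onI)
        show "\<bar>g s x\<bar> \<le> 2 * G" for x using bd[OF s, of x] G(1) by simp
        show "\<bar>g s (x + \<iota> h) - g s x\<bar> \<le> 2 * G * norm h powr 0" for x h
          using bd[OF s, of x] bd[OF s, of "x + \<iota> h"] linear_0[OF bounded_linear.linear[OF embedding(1)]]
          by (cases "h = 0") auto
      qed
      hence v: "mild_solution S \<mu> f g \<in> H_C_time \<iota> T (1 / \<theta>)"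
        "H_C_time_norm \<iota> T (1 / \<theta>) (mild_solution S \<mu> f g)
          \<le> ennreal (C * (enn2real (H_C_norm \<iota> (1 / \<theta>) f) + 2 * G))"
        using C(2)[OF f g, of "2 * G"] by auto
      note v(2)
      also have "\<dots> \<le> ennreal (2 * C) * (ennreal (enn2real (H_C_norm \<iota> (1 / \<theta>) f)) + ennreal G)"
        by (rule final) (use C G in auto)
      also have "\<dots> \<le> ennreal (2 * C) * (H_C_norm \<iota> (1 / \<theta>) f + Cb_time_norm T g)"
        unfolding G by (intro mult_left_mono add_right_mono enn2real_le) simp
      finally show ?thesis using v(1) by blast
    qed
    thus "\<exists>C>0. \<forall>f g. f \<in> H_C \<iota> (1 / \<theta>) \<and> g \<in> Cb_time T \<longrightarrow>
        mild_solution S \<mu> f g \<in> H_C_time \<iota> T (1 / \<theta>) \<and>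
        H_C_time_norm \<iota> T (1 / \<theta>) (mild_solution S \<mu> f g)
          \<le> ennreal C * (H_C_norm \<iota> (1 / \<theta>) f + Cb_time_norm T g)"
      using C(1) by (intro exI[of _ "2 * C"]) auto
  next
    fix \<alpha> assume \<alpha>: "0 < \<alpha> \<and> \<alpha> < 1 \<and> \<alpha> + 1 / \<theta> \<notin> \<nat>"
    let ?\<gamma> = "\<alpha> + 1 / \<theta>"
    from \<alpha> obtain C where C: "C > 0" "\<And>f g G. f \<in> H_C \<iota> ?\<gamma> \<Longrightarrow> g \<in> Cb_time T \<Longrightarrow>
        (\<forall>s\<in>{0..T}. Hol \<alpha> (g s) G) \<Longrightarrow> mild_solution S \<mu> f g \<in> H_C_time \<iota> T ?\<gamma> \<and>
        H_C_time_norm \<iota> T ?\<gamma> (mild_solution S \<mu> f g) \<le> ennreal (C * (enn2real (H_C_norm \<iota> ?\<gamma> f) + G))"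
      using mild_solution_regularity[of \<alpha> ?\<gamma>] by auto
    have \<alpha>_frac: "frac \<alpha> = \<alpha>" "nat \<lfloor>\<alpha>\<rfloor> = 0" using \<alpha> by (auto simp: frac_eq floor_eq_iff)
    have "mild_solution S \<mu> f g \<in> H_C_time \<iota> T ?\<gamma> \<and>
        H_C_time_norm \<iota> T ?\<gamma> (mild_solution S \<mu> f g)
          \<le> ennreal (2 * C) * (H_C_norm \<iota> ?\<gamma> f + H_C_time_norm \<iota> T \<alpha> g)"
      if f: "f \<in> H_C \<iota> ?\<gamma>" and g: "g \<in> H_C_time \<iota> T \<alpha>" for f g
    proof -
      define G where "G = enn2real (H_C_time_norm \<iota> T \<alpha> g)"
      have G: "G \<ge> 0" "ennreal G = H_C_time_norm \<iota> T \<alpha> g"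
        using g by (auto simp: G_def H_C_time_def)
      have "Hol \<alpha> (g s) (2 * G)" if s: "s \<in> {0..T}" for s
      proof -
        define N where "N = enn2real (H_C_norm \<iota> \<alpha> (g s))"
        have gs: "g s \<in> H_C \<iota> \<alpha>" using g s by (simp add: H_C_time_def)
        note D = H_C_D[OF embedding(1) gs \<alpha>_frac(1) _ \<alpha>_frac(2), folded N_def]
        have N: "N \<ge> 0" by (simp add: N_def)
        have "ennreal N \<le> ennreal G"
          unfolding G H_C_time_norm_def N_def using s by (intro SUP_upper2[OF s] enn2real_le)
        \<comment> \<open>The slack factor 2 matches the bounded case, so that \<open>final\<close>
          serves both parts.\<close>
        hence NG: "N \<le> 2 * G" using G(1) by (simp add: ennreal_le_iff)
        show ?thesis
          unfolding Hol_def
        proof (intro conjI allI)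
          show "g s \<in> borel_measurable borel"
            using D(1) \<alpha> by (intro borel_measurable_continuous_onI) auto
          show "\<bar>g s x\<bar> \<le> 2 * G" for x using D(4)[of x] \<alpha> NG by auto
          \<comment> \<open>Since \<alpha> lies strictly between 0 and 1, its integer part is 0 and
            the top derivative in \<open>H_regular\<close> is the function itself.\<close>
          have "\<bar>hdd \<iota> [] (g s) (x + \<iota> h) - hdd \<iota> [] (g s) x\<bar> \<le> N * norm h powr \<alpha> * nprod ([] :: 'h list)" for x h
            using D(3) \<alpha> unfolding H_regular_def by auto
          thus "\<bar>g s (x + \<iota> h) - g s x\<bar> \<le> 2 * G * norm h powr \<alpha>" for x h
            using order_trans[OF _ mult_right_mono[OF NG]] by simp
        qed
      qed
      moreover have "g \<in> Cb_time T" using g by (simp add: H_C_time_def)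
      ultimately have v: "mild_solution S \<mu> f g \<in> H_C_time \<iota> T ?\<gamma>"
        "H_C_time_norm \<iota> T ?\<gamma> (mild_solution S \<mu> f g)
          \<le> ennreal (C * (enn2real (H_C_norm \<iota> ?\<gamma> f) + 2 * G))"
        using C(2)[OF f, of g "2 * G"] by auto
      note v(2)
      also have "\<dots> \<le> ennreal (2 * C) * (ennreal (enn2real (H_C_norm \<iota> ?\<gamma> f)) + ennreal G)"
        by (rule final) (use C G in auto)
      also have "\<dots> \<le> ennreal (2 * C) * (H_C_norm \<iota> ?\<gamma> f + H_C_time_norm \<iota> T \<alpha> g)"
        unfolding G by (intro mult_left_mono add_right_mono enn2real_le) simp
      finally show ?thesis using v(1) by blast
    qed
    thus "\<exists>C>0. \<forall>f g. f \<in> H_C \<iota> ?\<gamma> \<and> g \<in> H_C_time \<iota> T \<alpha> \<longrightarrow>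
        mild_solution S \<mu> f g \<in> H_C_time \<iota> T ?\<gamma> \<and>
        H_C_time_norm \<iota> T ?\<gamma> (mild_solution S \<mu> f g)
          \<le> ennreal C * (H_C_norm \<iota> ?\<gamma> f + H_C_time_norm \<iota> T \<alpha> g)"
      using C(1) by (intro exI[of _ "2 * C"]) auto
  qed
qed

end
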